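(* Let $n\ge 3$ and $\mathbb{F}\in\{\mathbb{R},\mathbb{C},\mathbb{H}\}$. Then $\mathcal{B}_{n,\mathbb{F}}$ is an austere submanifold of the unit sphere $S(n,\mathbb{F})$ with flat normal bundle.
   Context: Let $m=\dim_{\mathbb{R}}\mathbb{F}\in\{1,2,4\}$ and $p=\left[\frac{n-1}{2}\right]$. $A^*$ denotes the conjugate transpose. $E(n,\mathbb{F})=\{A\in M(n,\mathbb{F}): A^*=A,\ \operatorname{tr}A=0\}$ is a real vector space of dimension $N(n,\mathbb{F})=\frac12 n(n-1)m+n-1$ with inner product $\langle A,B\rangle=\mathfrak{R}(\operatorname{tr}AB^* )$ ($\mathfrak{R}$ is the real part), and $S(n,\mathbb{F})$ is its unit sphere. Define $\Phi_{n,\mathbb{F}}:S(n,\mathbb{F})\to\mathbb{R}^p$, $A\mapsto(\operatorname{tr}A^3,\operatorname{tr}A^5,\dots,\operatorname{tr}A^{2p+1})$. $\mathcal{B}_{n,\mathbb{F}}$ is the set of regular points of $\Phi_{n,\mathbb{F}}$ (points where the differential is surjective) lying in $\Phi_{n,\mathbb{F}}^{-1}(0)$; by the regular level set theorem it is an embedded submanifold of $S(n,\mathbb{F})$ of dimension $N(n,\mathbb{F})-p-1$, with the induced metric. A submanifold of a Riemannian manifold is austere if, for every normal vector $\xi$, all symmetric polynomials of odd degree in the eigenvalues of the shape operator $S_\xi$ vanish; equivalently the principal curvatures with respect to $\xi$, counted with multiplicity, have the form $\lambda_1,-\lambda_1,\dots,\lambda_q,-\lambda_q,0,\dots,0$.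 Flat normal bundle means that the normal connection has zero curvature. *)

theory Defs
  imports "HOL-Analysis.Analysis" "HOL-Library.Multiset"
begin

section \<open>The quaternions\<close>

codatatype quat = Quat (qRe: real) (qI: real) (qJ: real) (qK: real)

lemma quat_eq_iff: "x = y \<longleftrightarrow> qRe x = qRe y \<and> qI x = qI y \<and> qJ x = qJ y \<and> qK x = qK y"
  by (auto intro: quat.expand)

instantiation quat :: ab_group_add
begin

primcorec zero_quat where
  "qRe 0 = 0" | "qI 0 = 0" | "qJ 0 = 0" | "qK 0 = 0"

primcorec plus_quat where
  "qRe (x + y) = qRe x + qRe y"
| "qI (x + y) = qI x + qI y"
| "qJ (x + y) = qJ x + qJ y"
| "qK (x + y) = qK x + qK y"

primcorec uminus_quat where
  "qRe (- x) = - qRe x" | "qI (- x) = - qI x" | "qJ (- x) = - qJ x" | "qK (- x) = - qK x"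

primcorec minus_quat where
  "qRe (x - y) = qRe x - qRe y"
| "qI (x - y) = qI x - qI y"
| "qJ (x - y) = qJ x - qJ y"
| "qK (x - y) = qK x - qK y"

instance
  by standard (simp_all add: quat_eq_iff)

end

instantiation quat :: ring_1
begin

primcorec one_quat where
  "qRe 1 = 1" | "qI 1 = 0" | "qJ 1 = 0" | "qK 1 = 0"

primcorec times_quat where
  "qRe (x * y) = qRe x * qRe y - qI x * qI y - qJ x * qJ y - qK x * qK y"
| "qI (x * y) = qRe x * qI y + qI x * qRe y + qJ x * qK y - qK x * qJ y"
| "qJ (x * y) = qRe x * qJ y - qI x * qK y + qJ x * qRe y + qK x * qI y"
| "qK (x * y) = qRe x * qK y + qI x * qJ y - qJ x * qI y + qK x * qRe y"

instance
  by standard (simp_all add: quat_eq_iff algebra_simps)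

end

instantiation quat :: real_algebra_1
begin

primcorec scaleR_quat where
  "qRe (scaleR r x) = r * qRe x"
| "qI (scaleR r x) = r * qI x"
| "qJ (scaleR r x) = r * qJ x"
| "qK (scaleR r x) = r * qK x"

instance
  by standard (simp_all add: quat_eq_iff algebra_simps)

end

instantiation quat :: real_div_algebra
begin

primcorec inverse_quat where
  "qRe (inverse x) = qRe x / ((qRe x)\<^sup>2 + (qI x)\<^sup>2 + (qJ x)\<^sup>2 + (qK x)\<^sup>2)"
| "qI (inverse x) = - qI x / ((qRe x)\<^sup>2 + (qI x)\<^sup>2 + (qJ x)\<^sup>2 + (qK x)\<^sup>2)"
| "qJ (inverse x) = - qJ x / ((qRe x)\<^sup>2 + (qI x)\<^sup>2 + (qJ x)\<^sup>2 + (qK x)\<^sup>2)"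
| "qK (inverse x) = - qK x / ((qRe x)\<^sup>2 + (qI x)\<^sup>2 + (qJ x)\<^sup>2 + (qK x)\<^sup>2)"

definition "x div y = x * inverse y" for x y :: quat

instance
proof
  fix x y :: quat
  let ?s = "(qRe x)\<^sup>2 + (qI x)\<^sup>2 + (qJ x)\<^sup>2 + (qK x)\<^sup>2"
  have s: "?s \<noteq> 0" if "x \<noteq> 0"
  proof
    assume "?s = 0"
    then have "(qRe x)\<^sup>2 = 0 \<and> (qI x)\<^sup>2 = 0 \<and> (qJ x)\<^sup>2 = 0 \<and> (qK x)\<^sup>2 = 0"
      by (smt (verit) zero_le_power2)
    with that show False
      by (simp add: quat_eq_iff)
  qed
  have r: "a * (a / t) + b * (b / t) + c * (c / t) + d * (d / t) = 1"
    if "t = a\<^sup>2 + b\<^sup>2 + c\<^sup>2 + d\<^sup>2" "t \<noteq> 0" for a b c d t :: real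
  proof -
    have "a * (a / t) + b * (b / t) + c * (c / t) + d * (d / t) = (a\<^sup>2 + b\<^sup>2 + c\<^sup>2 + d\<^sup>2) / t"
      by (simp add: power2_eq_square add_divide_distrib)
    with that show ?thesis by simp
  qed
  show "inverse x * x = 1" if "x \<noteq> 0"
    using r[OF refl s[OF that]] by (simp add: quat_eq_iff mult.commute)
  show "x * inverse x = 1" if "x \<noteq> 0"
    using r[OF refl s[OF that]] by (simp add: quat_eq_iff mult.commute)
  show "x div y = x * inverse y"
    by (simp add: divide_quat_def)
  show "inverse (0::quat) = 0"
    by (simp add: quat_eq_iff)
qed

end

instantiation quat :: real_inner
begin

definition inner_quat :: "quat \<Rightarrow> quat \<Rightarrow> real"
  where "inner_quat x y = qRe x * qRe y + qI x * qI y + qJ x * qJ y + qK x * qK y"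

definition norm_quat :: "quat \<Rightarrow> real"
  where "norm_quat x = sqrt (inner x x)"

definition sgn_quat :: "quat \<Rightarrow> quat"
  where "sgn_quat x = x /\<^sub>R norm x"

definition dist_quat :: "quat \<Rightarrow> quat \<Rightarrow> real"
  where "dist_quat x y = norm (x - y)"

definition uniformity_quat :: "(quat \<times> quat) filter"
  where "uniformity_quat = (INF e\<in>{0<..}. principal {(x, y). dist x y < e})"

definition open_quat :: "quat set \<Rightarrow> bool"
  where "open_quat U \<longleftrightarrow> (\<forall>x\<in>U. eventually (\<lambda>(x', y). x' = x \<longrightarrow> y \<in> U) uniformity)"

instance
proof
  fix x y z :: quat and r :: real and U :: "quat set"
  show "dist x y = norm (x - y)" by (simp add: dist_quat_def)
  show "sgn x = x /\<^sub>R norm x" by (simp add: sgn_quat_def)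
  show "uniformity = (INF e\<in>{0<..}. principal {(x, y). dist x (y::quat) < e})"
    by (simp add: uniformity_quat_def)
  show "open U \<longleftrightarrow> (\<forall>x\<in>U. \<forall>\<^sub>F (x', y) in uniformity. x' = x \<longrightarrow> y \<in> U)"
    by (simp add: open_quat_def)
  show "inner x y = inner y x" by (simp add: inner_quat_def mult.commute)
  show "inner (x + y) z = inner x z + inner y z" by (simp add: inner_quat_def algebra_simps)
  show "inner (r *\<^sub>R x) y = r * inner x y" by (simp add: inner_quat_def algebra_simps)
  show "0 \<le> inner x x" by (simp add: inner_quat_def)
  show "(inner x x = 0) = (x = 0)"
  proof
    assume "inner x x = 0"
    then have "qRe x * qRe x = 0 \<and> qI x * qI x = 0 \<and> qJ x * qJ x = 0 \<and> qK x * qK x = 0"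
      unfolding inner_quat_def by (smt (verit) zero_le_square)
    then show "x = 0" by (simp add: quat_eq_iff)
  qed (simp add: inner_quat_def)
  show "norm x = sqrt (inner x x)" by (simp add: norm_quat_def)
qed

end

instance quat :: real_normed_div_algebra
proof
  fix x y :: quat
  have "inner (x * y) (x * y) = inner x x * inner y y"
    unfolding inner_quat_def times_quat.sel by algebra
  then show "norm (x * y) = norm x * norm y"
    by (simp add: norm_quat_def real_sqrt_mult)
qed

instantiation quat :: euclidean_space
begin

definition Basis_quat :: "quat set"
  where "Basis_quat = {Quat 1 0 0 0, Quat 0 1 0 0, Quat 0 0 1 0, Quat 0 0 0 1}"

instance
proof
  fix u v x :: quat
  show "(Basis :: quat set) \<noteq> {}" "finite (Basis :: quat set)"
    by (simp_all add: Basis_quat_def)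
  show "inner u v = (if u = v then 1 else 0)" if "u \<in> Basis" "v \<in> Basis"
    using that unfolding Basis_quat_def
    by (elim insertE emptyE; hypsubst; simp add: inner_quat_def)
  show "(\<forall>u\<in>Basis. inner x u = 0) \<longleftrightarrow> x = 0"
    unfolding quat_eq_iff[of x] by (simp add: Basis_quat_def inner_quat_def)
qed

end

lemma DIM_quat [simp]: "DIM(quat) = 4"
  by (simp add: Basis_quat_def)


section \<open>The class of the algebras $\mathbb{R}$, $\mathbb{C}$, $\mathbb{H}$\<close>

text \<open>The only purpose of the class is to treat the three algebras uniformly. Its real part is
  \<open>\<lambda>x. x \<bullet> 1\<close>.\<close>

class conj_div_algebra = real_normed_div_algebra + euclidean_space +
  fixes conjg :: "'a \<Rightarrow> 'a"
  assumes conjg_add: "conjg (x + y) = conjg x + conjg y"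
    and conjg_mult: "conjg (x * y) = conjg y * conjg x"
    and conjg_conjg: "conjg (conjg x) = x"
    and add_conjg: "x + conjg x = (2 * (x \<bullet> 1)) *\<^sub>R 1"
    and inner_conv_conjg: "x \<bullet> y = (x * conjg y) \<bullet> 1"

definition real_part :: "'a::conj_div_algebra \<Rightarrow> real"
  where "real_part x = x \<bullet> 1"

instantiation real :: conj_div_algebra
begin

definition conjg_real :: "real \<Rightarrow> real"
  where "conjg_real x = x"

instance
  by standard (simp_all add: conjg_real_def)

end

instantiation complex :: conj_div_algebra
begin

definition conjg_complex :: "complex \<Rightarrow> complex"
  where "conjg_complex = cnj"

instance
  by standard (simp_all add: conjg_complex_def complex_eq_iff inner_complex_def)

end

instantiation quat :: conj_div_algebra
begin

definition conjg_quat :: "quat \<Rightarrow> quat"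
  where "conjg_quat x = Quat (qRe x) (- qI x) (- qJ x) (- qK x)"

instance
  by standard (simp_all add: conjg_quat_def quat_eq_iff inner_quat_def algebra_simps)

end

lemma real_part_real [simp]: "real_part (x::real) = x"
  by (simp add: real_part_def)

lemma real_part_complex [simp]: "real_part = Re"
  by (auto simp: real_part_def inner_complex_def)

lemma real_part_quat [simp]: "real_part = qRe"
  by (auto simp: real_part_def inner_quat_def)


section \<open>Hermitian matrices and the set $\mathcal{B}$\<close>

definition conj_transpose :: "'f::conj_div_algebra^'n^'m \<Rightarrow> 'f^'m^'n"
  where "conj_transpose A = map_matrix conjg (transpose A)"

text \<open>The power \<open>^\<close> of the type \<open>'f^'n^'n\<close> is the entrywise one, so the matrix power has to be
  defined.\<close>

definition matrix_power :: "'f::semiring_1^'n^'n \<Rightarrow> nat \<Rightarrow> 'f^'n^'n"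
  where "matrix_power A k = ((**) A ^^ k) (mat 1)"

text \<open>The library inner product of \<open>'f^'n^'n\<close> is $\mathfrak{R}(\mathrm{tr}\, AB^*)$.\<close>

lemma inner_matrix_eq: "A \<bullet> B = real_part (trace (A ** conj_transpose B))"
  for A B :: "'f::conj_div_algebra^'n^'n"
proof -
  have "real_part (trace (A ** conj_transpose B))
      = (\<Sum>i\<in>UNIV. \<Sum>k\<in>UNIV. (A $ i $ k * conjg (B $ i $ k)) \<bullet> 1)"
    by (simp add: real_part_def trace_def matrix_matrix_mult_def conj_transpose_def
        transpose_def inner_sum_left)
  also have "\<dots> = A \<bullet> B"
    by (simp add: inner_vec_def inner_conv_conjg[symmetric])
  finally show ?thesis by simp
qed

definition hermitian_traceless :: "('f::conj_div_algebra^'n^'n) set"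
  where "hermitian_traceless = {A. conj_transpose A = A \<and> trace A = 0}"

definition unit_sphere :: "('f::conj_div_algebra^'n^'n) set"
  where "unit_sphere = {A \<in> hermitian_traceless. norm A = 1}"

definition num_p :: "nat \<Rightarrow> nat"
  where "num_p n = (n - 1) div 2"

text \<open>Dimension of the space of traceless Hermitian \<open>n \<times> n\<close> matrices over an algebra of real
  dimension \<open>m\<close>.\<close>

definition dim_N :: "nat \<Rightarrow> nat \<Rightarrow> nat"
  where "dim_N m n = n * (n - 1) * m div 2 + (n - 1)"

text \<open>\<open>Phi k A\<close> for \<open>k = 1, \<dots>, p\<close> are the components of the map \<open>\<Phi>\<close>. For
  Hermitian \<open>A\<close> the trace of a power of \<open>A\<close> is real, see \<open>trace_matrix_power_real\<close> below.\<close>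

definition Phi :: "nat \<Rightarrow> 'f::conj_div_algebra^'n^'n \<Rightarrow> real"
  where "Phi k A = real_part (trace (matrix_power A (2 * k + 1)))"

lemma conjg_0 [simp]: "conjg (0::'f::conj_div_algebra) = 0"
  using conjg_add[of "0::'f" 0] by simp

lemma conjg_1 [simp]: "conjg (1::'f::conj_div_algebra) = 1"
  by (metis conjg_conjg conjg_mult mult.right_neutral)

lemma conjg_sum: "conjg (sum f I) = (\<Sum>i\<in>I. conjg (f i :: 'f::conj_div_algebra))"
  by (induction I rule: infinite_finite_induct) (simp_all add: conjg_add)

lemma conj_transpose_mult:
  "conj_transpose (A ** B) = conj_transpose B ** conj_transpose (A :: 'f::conj_div_algebra^'n^'n)"
  by (simp add: vec_eq_iff conj_transpose_def transpose_def matrix_matrix_mult_def conjg_sum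
      conjg_mult)

lemma conj_transpose_mat_1: "conj_transpose (mat 1 :: 'f::conj_div_algebra^'n^'n) = mat 1"
  by (simp add: vec_eq_iff conj_transpose_def transpose_def mat_def)

lemma matrix_power_Suc: "matrix_power A (Suc k) = A ** matrix_power A k"
  by (simp add: matrix_power_def)

lemma matrix_power_commute: "matrix_power A k ** A = A ** matrix_power A k"
proof (induction k)
  case 0
  show ?case by (simp add: matrix_power_def)
next
  case (Suc k)
  then show ?case by (simp add: matrix_power_Suc matrix_mul_assoc[symmetric])
qed

lemma trace_matrix_power_real:
  fixes A :: "'f::conj_div_algebra^'n^'n"
  assumes "conj_transpose A = A"
  shows "trace (matrix_power A k) = of_real (real_part (trace (matrix_power A k)))"
proof -
  have *: "conj_transpose (matrix_power A k) = matrix_power A k"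
  proof (induction k)
    case 0
    show ?case by (simp add: matrix_power_def conj_transpose_mat_1)
  next
    case (Suc k)
    then show ?case
      by (simp add: matrix_power_Suc conj_transpose_mult assms matrix_power_commute)
  qed
  let ?t = "trace (matrix_power A k)"
  have "conjg (matrix_power A k $ i $ i) = matrix_power A k $ i $ i" for i
    using arg_cong[OF *, of "\<lambda>M. M $ i $ i"] by (simp add: conj_transpose_def transpose_def)
  then have "conjg ?t = ?t"
    by (simp add: trace_def conjg_sum)
  then have "2 *\<^sub>R ?t = (2 * real_part ?t) *\<^sub>R 1"
    using add_conjg[of ?t] by (simp only: real_part_def scaleR_2)
  also have "\<dots> = 2 *\<^sub>R of_real (real_part ?t)"
    by (simp add: of_real_def)
  finally show ?thesis
    by (metis scaleR_cancel_left zero_neq_numeral)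
qed


section \<open>Submanifolds of Euclidean spaces\<close>

primrec C_on :: "nat \<Rightarrow> ('a::real_normed_vector \<Rightarrow> 'b::real_normed_vector) \<Rightarrow> 'a set \<Rightarrow> bool"
  where
    "C_on 0 f U \<longleftrightarrow> continuous_on U f"
  | "C_on (Suc k) f U \<longleftrightarrow>
       (\<forall>x\<in>U. f differentiable (at x)) \<and> (\<forall>v. C_on k (\<lambda>x. frechet_derivative f (at x) v) U)"

text \<open>To be used for open sets \<open>U\<close>.\<close>

definition smooth_on :: "('a::real_normed_vector \<Rightarrow> 'b::real_normed_vector) \<Rightarrow> 'a set \<Rightarrow> bool"
  where "smooth_on f U \<longleftrightarrow> (\<forall>k. C_on k f U)"

definition embedded_submanifold :: "nat \<Rightarrow> 'v::euclidean_space set \<Rightarrow> bool"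
  where "embedded_submanifold d M \<longleftrightarrow>
    (\<forall>x\<in>M. \<exists>U W \<phi> \<psi>. \<exists>L::'v set. open U \<and> x \<in> U \<and> open W \<and> homeomorphism U W \<phi> \<psi> \<and>
       smooth_on \<phi> U \<and> smooth_on \<psi> W \<and> subspace L \<and> dim L = d \<and> \<phi> ` (M \<inter> U) = L \<inter> W)"

text \<open>An embedded submanifold of a Euclidean space that lies in another embedded submanifold \<open>N\<close> is
  an embedded submanifold of \<open>N\<close>, and conversely.\<close>

definition submanifold_of :: "nat \<Rightarrow> 'v::euclidean_space set \<Rightarrow> 'v set \<Rightarrow> bool"
  where "submanifold_of d M N \<longleftrightarrow>
    (\<exists>e. embedded_submanifold e N) \<and> embedded_submanifold d M \<and> M \<subseteq> N"

definition smooth_along :: "'v::euclidean_space set \<Rightarrow> ('v \<Rightarrow> 'w::euclidean_space) \<Rightarrow> bool"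
  where "smooth_along M f \<longleftrightarrow>
    (\<forall>x\<in>M. \<exists>U g. open U \<and> x \<in> U \<and> smooth_on g U \<and> (\<forall>y\<in>M \<inter> U. g y = f y))"

definition tangent_space :: "'v::euclidean_space set \<Rightarrow> 'v \<Rightarrow> 'v set"
  where "tangent_space M x =
    {v. \<exists>\<gamma> e. 0 < e \<and> smooth_on \<gamma> {-e<..<e::real} \<and> \<gamma> ` {-e<..<e} \<subseteq> M \<and> \<gamma> 0 = x \<and>
          (\<gamma> has_vector_derivative v) (at 0)}"

text \<open>The differential of a map defined on \<open>M\<close>. The derivative within \<open>M\<close> depends only on the values
  of \<open>f\<close> on \<open>M\<close>. As a linear map on the surrounding space it is not unique, but for differentiable
  \<open>f\<close> its values at tangent vectors \<open>v\<close> of \<open>M\<close> are, and only these are used.\<close>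

definition differential :: "'v::euclidean_space set \<Rightarrow> ('v \<Rightarrow> 'w::euclidean_space) \<Rightarrow> 'v \<Rightarrow> 'v \<Rightarrow> 'w"
  where "differential M f x v = frechet_derivative f (at x within M) v"


section \<open>Riemannian geometry of submanifolds\<close>

text \<open>All submanifolds carry the metric induced from the surrounding Euclidean space; \<open>N\<close> is the
  ambient manifold and \<open>M\<close> a submanifold of \<open>N\<close>. Vector fields along \<open>M\<close> are functions of which
  only the values on \<open>M\<close> matter.\<close>

definition orth_proj :: "'v::euclidean_space set \<Rightarrow> 'v \<Rightarrow> 'v"
  where "orth_proj W v = (THE w. w \<in> W \<and> v - w \<in> orthogonal_comp W)"

definition normal_space :: "'v::euclidean_space set \<Rightarrow> 'v set \<Rightarrow> 'v \<Rightarrow> 'v set"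
  where "normal_space N M x = tangent_space N x \<inter> orthogonal_comp (tangent_space M x)"

definition tangent_field :: "'v::euclidean_space set \<Rightarrow> ('v \<Rightarrow> 'v) \<Rightarrow> bool"
  where "tangent_field M X \<longleftrightarrow> smooth_along M X \<and> (\<forall>x\<in>M. X x \<in> tangent_space M x)"

definition normal_field :: "'v::euclidean_space set \<Rightarrow> 'v set \<Rightarrow> ('v \<Rightarrow> 'v) \<Rightarrow> bool"
  where "normal_field N M \<zeta> \<longleftrightarrow> smooth_along M \<zeta> \<and> (\<forall>x\<in>M. \<zeta> x \<in> normal_space N M x)"

text \<open>The Levi-Civita connection of \<open>N\<close>, applied to a vector field \<open>Y\<close> along \<open>M\<close> tangent to \<open>N\<close>: the
  tangential part of the Euclidean derivative.\<close>

definition levi_civita :: "'v::euclidean_space set \<Rightarrow> 'v set \<Rightarrow> ('v \<Rightarrow> 'v) \<Rightarrow> 'v \<Rightarrow> 'v \<Rightarrow> 'v"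
  where "levi_civita N M Y x v = orth_proj (tangent_space N x) (differential M Y x v)"

text \<open>The Weingarten formula: if the normal field \<open>\<zeta>\<close> extends \<open>\<xi>\<close>, then \<open>- S\<^sub>\<xi> v\<close> is the
  component tangent to \<open>M\<close> of the covariant derivative of \<open>\<zeta>\<close> in direction \<open>v\<close>. The result does not
  depend on the choice of the extension \<open>\<zeta>\<close>, which always exists on all of \<open>M\<close>, for example by
  projecting the constant vector \<open>\<xi>\<close> to the normal spaces.\<close>

definition shape_operator :: "'v::euclidean_space set \<Rightarrow> 'v set \<Rightarrow> 'v \<Rightarrow> 'v \<Rightarrow> 'v \<Rightarrow> 'v"
  where "shape_operator N M x \<xi> v =
    (let \<zeta> = (SOME \<zeta>. normal_field N M \<zeta> \<and> \<zeta> x = \<xi>)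
     in - orth_proj (tangent_space M x) (levi_civita N M \<zeta> x v))"

text \<open>\<open>\<Lambda>\<close> is the multiset of all \<open>dim T\<close> eigenvalues of the operator \<open>F\<close> on the subspace \<open>T\<close>. The
  multiplicities are geometric; shape operators are self-adjoint, so that these are also the
  algebraic ones.\<close>

definition has_eigenvalues :: "'v::euclidean_space set \<Rightarrow> ('v \<Rightarrow> 'v) \<Rightarrow> real multiset \<Rightarrow> bool"
  where "has_eigenvalues T F \<Lambda> \<longleftrightarrow>
    size \<Lambda> = dim T \<and> (\<forall>c. count \<Lambda> c = dim {v \<in> T. F v = c *\<^sub>R v})"

definition austere_submanifold :: "nat \<Rightarrow> 'v::euclidean_space set \<Rightarrow> 'v set \<Rightarrow> bool"
  where "austere_submanifold d M N \<longleftrightarrow> submanifold_of d M N \<and>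
    (\<forall>x\<in>M. \<forall>\<xi>\<in>normal_space N M x. \<exists>\<Lambda> z.
       has_eigenvalues (tangent_space M x) (shape_operator N M x \<xi>)
         (\<Lambda> + image_mset uminus \<Lambda> + replicate_mset z 0))"

definition normal_connection :: "'v::euclidean_space set \<Rightarrow> 'v set \<Rightarrow> ('v \<Rightarrow> 'v) \<Rightarrow> ('v \<Rightarrow> 'v) \<Rightarrow> 'v \<Rightarrow> 'v"
  where "normal_connection N M X \<zeta> x = orth_proj (normal_space N M x) (levi_civita N M \<zeta> x (X x))"

definition lie_bracket :: "'v::euclidean_space set \<Rightarrow> ('v \<Rightarrow> 'v) \<Rightarrow> ('v \<Rightarrow> 'v) \<Rightarrow> 'v \<Rightarrow> 'v"
  where "lie_bracket M X Y x = differential M Y x (X x) - differential M X x (Y x)"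

definition normal_curvature ::
    "'v::euclidean_space set \<Rightarrow> 'v set \<Rightarrow> ('v \<Rightarrow> 'v) \<Rightarrow> ('v \<Rightarrow> 'v) \<Rightarrow> ('v \<Rightarrow> 'v) \<Rightarrow> 'v \<Rightarrow> 'v"
  where "normal_curvature N M X Y \<zeta> x =
    normal_connection N M X (normal_connection N M Y \<zeta>) x
    - normal_connection N M Y (normal_connection N M X \<zeta>) x
    - normal_connection N M (lie_bracket M X Y) \<zeta> x"

definition flat_normal_bundle :: "'v::euclidean_space set \<Rightarrow> 'v set \<Rightarrow> bool"
  where "flat_normal_bundle M N \<longleftrightarrow>
    (\<forall>X Y \<zeta>. tangent_field M X \<longrightarrow> tangent_field M Y \<longrightarrow> normal_field N M \<zeta> \<longrightarrow>
       (\<forall>x\<in>M. normal_curvature N M X Y \<zeta> x = 0))"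


section \<open>Regular points of \<open>\<Phi>\<close>\<close>

text \<open>A vector of $\mathbb{R}^p$ is given by the values \<open>c k\<close> for \<open>k \<in> {1..p}\<close>.\<close>

definition regular_point :: "'f::conj_div_algebra^'n^'n \<Rightarrow> bool"
  where "regular_point A \<longleftrightarrow> A \<in> unit_sphere \<and>
    (\<forall>c::nat \<Rightarrow> real. \<exists>X\<in>tangent_space unit_sphere A. \<forall>k\<in>{1..num_p CARD('n)}.
       differential unit_sphere (Phi k) A X = c k)"

definition set_B :: "('f::conj_div_algebra^'n^'n) set"
  where "set_B = {A. regular_point A \<and> (\<forall>k\<in>{1..num_p CARD('n)}. Phi k A = 0)}"

end

theory Submission
  imports Defs "HOL-Computational_Algebra.Polynomial_FPS" "HOL-Combinatorics.Permutations"
begin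

text \<open>
  Let \<open>p = [(n-1)/2]\<close>. At a point \<open>A\<close> of \<open>\<B>\<close> all odd power sums of the eigenvalues of \<open>A\<close> up to exponent
  \<open>n\<close> vanish. By Newton's identities, the spectrum of \<open>A\<close> is symmetric with respect to 0
  (\<open>symmetric_spectrum\<close>). Two consequences carry the proof: a unitary \<open>U\<close> conjugates \<open>A\<close> to \<open>- A\<close>
  (\<open>unitary_to_negative\<close>), and \<open>A\<^sup>2\<close> has at most \<open>p + 1\<close> different eigenvalues, so that
  \<open>I, A\<^sup>2, \<dots>, A\<^sup>2\<^sup>p\<close> span all even powers of \<open>A\<close> (\<open>even_power_reduction\<close>).

  The gradient of \<open>tr A\<^sup>2\<^sup>k\<^sup>+\<^sup>1\<close> is a multiple of \<open>A\<^sup>2\<^sup>k\<close>. So \<open>\<B>\<close> is a regular level set, hence an embedded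
  submanifold, and its normal bundle in the sphere has the global frame \<open>\<xi> k\<close>, the traceless part of
  \<open>A\<^sup>2\<^sup>k\<close>, \<open>k = 1, \<dots>, p\<close>. The derivative of \<open>\<xi> k\<close> is, up to multiples of the identity, the operator
  \<open>T k X = \<Sum>A\<^sup>i X A\<^sup>j\<close>, summed over \<open>i + j = 2 k - 1\<close>. These operators are self-adjoint and commute. By
  \<open>shape_operator_eq\<close>, the shape operator of \<open>\<Sum>k. c k \<xi> k\<close> is the negative of the tangential part of
  \<open>\<Sum>k. c k T k\<close>.

  Austerity: \<open>\<tau> X = - U X U\<^sup>*\<close> is an isometry that fixes \<open>A\<close>, maps \<open>\<B>\<close> to itself and reverses all normal
  vectors at \<open>A\<close>. It preserves the tangent space and anticommutes with the shape operators, so the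
  eigenvalues \<open>c\<close> and \<open>- c\<close> have the same multiplicity (\<open>shape_operator_eigenvalues\<close>).

  Flatness: by the Ricci equation, in the form \<open>flat_normal_bundleI\<close>, it suffices that the inner product
  of the non-normal part of \<open>D\<xi> k Y\<close> with \<open>D\<xi> l X\<close> is symmetric in \<open>X\<close> and \<open>Y\<close>. The operators \<open>T k\<close>
  exchange the span of the even powers of \<open>A\<close>, which is the normal space together with the identity,
  and the span of the odd powers. Only the components \<open>X'\<close> and \<open>Y'\<close> of \<open>X\<close> and \<open>Y\<close> orthogonal to the
  odd powers matter, and the inner product becomes \<open>T k Y' \<bullet> T l X'\<close>
  (\<open>normal_frame_deriv_symmetric\<close>), which is symmetric because the operators are self-adjoint and
  commute.

  The arguments are the same over the three algebras. Over the quaternions, the real part of the trace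
  takes over the role of the trace.
\<close>

section \<open>Smooth maps and their inverses\<close>

lemma C_on_cong:
  assumes "open U" "\<And>x. x \<in> U \<Longrightarrow> f x = g x"
  shows "C_on k f U \<longleftrightarrow> C_on k g U"
  using assms(2)
proof (induction k arbitrary: f g)
  case 0
  then show ?case by (simp cong: continuous_on_cong)
next
  case (Suc k)
  have d: "(f has_derivative f') (at x) \<longleftrightarrow> (g has_derivative f') (at x)" if "x \<in> U" for x f'
    by (metis Suc.prems assms(1) has_derivative_transform_within_open that)
  then have "f differentiable (at x) \<longleftrightarrow> g differentiable (at x)" if "x \<in> U" for x
    using that by (simp add: differentiable_def)
  moreover have "frechet_derivative f (at x) = frechet_derivative g (at x)" if "x \<in> U" for x
    using d[OF that] by (simp add: frechet_derivative_def)
  then have "C_on k (\<lambda>x. frechet_derivative f (at x) v) U \<longleftrightarrow>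
      C_on k (\<lambda>x. frechet_derivative g (at x) v) U" for v
    by (intro Suc.IH) simp
  ultimately show ?case by simp
qed

lemma C_on_transform:
  "open U \<Longrightarrow> C_on k g U \<Longrightarrow> (\<And>x. x \<in> U \<Longrightarrow> f x = g x) \<Longrightarrow> C_on k f U"
  using C_on_cong[of U f g k] by blast

lemma C_on_SucI:
  assumes "open U" "\<And>x. x \<in> U \<Longrightarrow> (f has_derivative f' x) (at x)"
    and "\<And>v. C_on k (\<lambda>x. f' x v) U"
  shows "C_on (Suc k) f U"
proof -
  have "frechet_derivative f (at x) = f' x" if "x \<in> U" for x
    using assms(2)[OF that] frechet_derivative_at by metis
  then have "C_on k (\<lambda>x. frechet_derivative f (at x) v) U" for v
    by (intro C_on_transform[OF assms(1) assms(3)[of v]]) simp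
  then show ?thesis using assms(2) by (auto simp: differentiable_def)
qed

lemma C_on_has_derivative:
  "C_on (Suc k) f U \<Longrightarrow> x \<in> U \<Longrightarrow> (f has_derivative frechet_derivative f (at x)) (at x)"
  by (simp flip: frechet_derivative_works)

lemma C_on_SucD: "C_on (Suc k) f U \<Longrightarrow> C_on k f U"
proof (induction k arbitrary: f)
  case 0
  then show ?case
    by (auto intro!: continuous_at_imp_continuous_on differentiable_imp_continuous_within)
next
  case (Suc k)
  then show ?case by (metis C_on.simps(2))
qed

lemma C_on_mono: "C_on k f U \<Longrightarrow> l \<le> k \<Longrightarrow> C_on l f U"
  by (induction k) (auto simp: le_Suc_eq dest: C_on_SucD simp del: C_on.simps)

lemma C_on_subset: "C_on k f U \<Longrightarrow> V \<subseteq> U \<Longrightarrow> C_on k f V"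
  by (induction k arbitrary: f) (auto intro: continuous_on_subset)

lemma smooth_on_subset: "smooth_on f U \<Longrightarrow> V \<subseteq> U \<Longrightarrow> smooth_on f V"
  by (auto simp: smooth_on_def intro: C_on_subset)

lemma smooth_on_has_derivative:
  "smooth_on f U \<Longrightarrow> x \<in> U \<Longrightarrow> (f has_derivative frechet_derivative f (at x)) (at x)"
  unfolding smooth_on_def using C_on_has_derivative by blast

lemma smooth_on_frechet_derivative:
  "smooth_on f U \<Longrightarrow> smooth_on (\<lambda>x. frechet_derivative f (at x) v) U"
  unfolding smooth_on_def by (metis C_on.simps(2))

lemma smooth_on_imp_continuous_on: "smooth_on f U \<Longrightarrow> continuous_on U f"
  unfolding smooth_on_def by (metis C_on.simps(1))

lemma C_on_const: "C_on k (\<lambda>_. c) U"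
  by (induction k arbitrary: c) auto

lemma C_on_bounded_linear_id: "bounded_linear h \<Longrightarrow> open U \<Longrightarrow> C_on k h U"
proof (induction k)
  case 0
  then show ?case by (simp add: linear_continuous_on)
next
  case (Suc k)
  show ?case
    by (rule C_on_SucI[OF \<open>open U\<close>, of _ "\<lambda>_. h"])
      (use Suc.prems in \<open>auto simp: C_on_const intro: bounded_linear_imp_has_derivative\<close>)
qed

lemma C_on_add: "open U \<Longrightarrow> C_on k f U \<Longrightarrow> C_on k g U \<Longrightarrow> C_on k (\<lambda>x. f x + g x) U"
proof (induction k arbitrary: f g)
  case 0
  then show ?case by (simp add: continuous_on_add)
next
  case (Suc k)
  show ?case
  proof (rule C_on_SucI[OF \<open>open U\<close>])
    show "((\<lambda>x. f x + g x) has_derivative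
        (\<lambda>v. frechet_derivative f (at x) v + frechet_derivative g (at x) v)) (at x)" if "x \<in> U" for x
      using Suc.prems that by (auto intro!: has_derivative_add C_on_has_derivative simp del: C_on.simps)
    show "C_on k (\<lambda>x. frechet_derivative f (at x) v + frechet_derivative g (at x) v) U" for v
      using Suc.prems by (auto intro!: Suc.IH)
  qed
qed

lemma C_on_sum:
  assumes "open U" "\<And>i. i \<in> I \<Longrightarrow> C_on k (f i) U"
  shows "C_on k (\<lambda>x. \<Sum>i\<in>I. f i x) U"
  using assms(2) by (induction I rule: infinite_finite_induct) (auto intro: C_on_const C_on_add assms(1))

lemma C_on_bounded_bilinear:
  assumes "bounded_bilinear pr" "open U"
  shows "C_on k f U \<Longrightarrow> C_on k g U \<Longrightarrow> C_on k (\<lambda>x. pr (f x) (g x)) U"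
proof (induction k arbitrary: f g)
  case 0
  then show ?case using bounded_bilinear.continuous_on[OF assms(1)] by simp
next
  case (Suc k)
  show ?case
  proof (rule C_on_SucI[OF \<open>open U\<close>])
    show "((\<lambda>x. pr (f x) (g x)) has_derivative (\<lambda>v. pr (f x) (frechet_derivative g (at x) v)
       + pr (frechet_derivative f (at x) v) (g x))) (at x)" if "x \<in> U" for x
      using Suc.prems that
      by (intro bounded_bilinear.FDERIV[OF assms(1)] C_on_has_derivative)
    show "C_on k (\<lambda>x. pr (f x) (frechet_derivative g (at x) v)
       + pr (frechet_derivative f (at x) v) (g x)) U" for v
      using Suc.prems by (intro C_on_add Suc.IH assms(2) C_on_SucD[OF Suc.prems(1)]
          C_on_SucD[OF Suc.prems(2)]) simp_all
  qed
qed

lemmas C_on_scaleR = C_on_bounded_bilinear[OF bounded_bilinear_scaleR]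
lemmas C_on_inner = C_on_bounded_bilinear[OF bounded_bilinear_inner]

lemma C_on_bounded_linear:
  assumes "bounded_linear h" "open U"
  shows "C_on k f U \<Longrightarrow> C_on k (\<lambda>x. h (f x)) U"
proof (induction k arbitrary: f)
  case 0
  then show ?case using bounded_linear.continuous_on[OF assms(1)] by simp
next
  case (Suc k)
  show ?case
  proof (rule C_on_SucI[OF \<open>open U\<close>])
    show "((\<lambda>x. h (f x)) has_derivative (\<lambda>v. h (frechet_derivative f (at x) v))) (at x)"
      if "x \<in> U" for x
      using Suc.prems that
      by (intro bounded_linear.has_derivative[OF assms(1)] C_on_has_derivative)
    show "C_on k (\<lambda>x. h (frechet_derivative f (at x) v)) U" for v
      using Suc.prems by (auto intro!: Suc.IH)
  qed
qed

lemma linear_eq_sum_Basis: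
  fixes h :: "'a::euclidean_space \<Rightarrow> 'b::real_vector"
  assumes "linear h"
  shows "h v = (\<Sum>b\<in>Basis. (v \<bullet> b) *\<^sub>R h b)"
proof -
  have "h v = h (\<Sum>b\<in>Basis. (v \<bullet> b) *\<^sub>R b)" by (simp add: euclidean_representation)
  also have "\<dots> = (\<Sum>b\<in>Basis. (v \<bullet> b) *\<^sub>R h b)"
    by (simp add: linear_sum[OF assms] linear_scale[OF assms])
  finally show ?thesis .
qed

text \<open>The chain rule produces \<open>Df (g x) (Dg x v)\<close>, where both the base point and the vector move.
  Expanded in a basis, this is a sum of products of coordinates of \<open>Dg x v\<close> with the functions
  \<open>Df (g x) b\<close>, \<open>b\<close> fixed, and to these the induction hypothesis applies: hence \<open>f\<close> is arbitrary in the
  induction.\<close>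

lemma C_on_compose:
  fixes g :: "'a::real_normed_vector \<Rightarrow> 'b::euclidean_space" and f :: "'b \<Rightarrow> 'c::real_normed_vector"
  assumes "open U" "open W" "g ` U \<subseteq> W"
  shows "C_on k f W \<Longrightarrow> C_on k g U \<Longrightarrow> C_on k (\<lambda>x. f (g x)) U"
proof (induction k arbitrary: f)
  case 0
  then show ?case using assms(3) by (auto intro: continuous_on_compose2)
next
  case (Suc k)
  let ?f = "\<lambda>x. frechet_derivative f (at (g x))" and ?g = "\<lambda>x. frechet_derivative g (at x)"
  show ?case
  proof (rule C_on_SucI[OF \<open>open U\<close>])
    show "((\<lambda>x. f (g x)) has_derivative (\<lambda>v. ?f x (?g x v))) (at x)" if "x \<in> U" for x
      using Suc.prems that assms(3)
      by (intro has_derivative_compose[of g _ x UNIV f] C_on_has_derivative) auto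
    have "C_on k (\<lambda>x. \<Sum>b\<in>Basis. (?g x v \<bullet> b) *\<^sub>R ?f x b) U" for v
      using Suc.prems C_on_SucD[OF Suc.prems(2)]
      by (intro C_on_sum assms(1) C_on_scaleR C_on_inner C_on_const Suc.IH) auto
    moreover have "?f x (?g x v) = (\<Sum>b\<in>Basis. (?g x v \<bullet> b) *\<^sub>R ?f x b)" if "x \<in> U" for x v
      by (rule linear_eq_sum_Basis)
        (use C_on_has_derivative[OF Suc.prems(1)] that assms(3) in
          \<open>auto intro: has_derivative_linear\<close>)
    ultimately show "C_on k (\<lambda>x. ?f x (?g x v)) U" for v
      by (rule C_on_transform[OF assms(1)])
  qed
qed

text \<open>The product rule needs only continuity of the factor \<open>f\<close> if the other factor vanishes at the
  point. It is needed to differentiate the inverse of a family of linear maps, whose only regularity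
  known at that stage is continuity.\<close>

lemma has_derivative_scaleR_vanishing:
  fixes h :: "'a::real_normed_vector \<Rightarrow> 'b::real_normed_vector"
  assumes "(h has_derivative h') (at x)" "h x = 0" "isCont f x"
  shows "((\<lambda>y. f y *\<^sub>R h y) has_derivative (\<lambda>v. f x *\<^sub>R h' v)) (at x)"
proof -
  have bl: "bounded_linear h'" using assms(1) by (rule has_derivative_bounded_linear)
  obtain B where B: "B > 0" "\<And>y. norm (h' y) \<le> norm y * B"
    using bounded_linear.pos_bounded[OF bl] by blast
  have "((\<lambda>y. norm (h y - h x - h' (y - x)) / norm (y - x)) \<longlongrightarrow> 0) (at x)"
    using assms(1) by (simp add: has_derivative_iff_norm)
  then have 1: "((\<lambda>y. \<bar>f y\<bar> * (norm (h y - h x - h' (y - x)) / norm (y - x)) + \<bar>f y - f x\<bar> * B) \<longlongrightarrow>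
     \<bar>f x\<bar> * 0 + \<bar>f x - f x\<bar> * B) (at x)"
    using assms(3) by (intro tendsto_intros) (auto simp: isCont_def)
  have "((\<lambda>y. norm (f y *\<^sub>R h y - f x *\<^sub>R h x - f x *\<^sub>R h' (y - x)) / norm (y - x)) \<longlongrightarrow> 0) (at x)"
  proof (rule Lim_null_comparison[OF _ 1[simplified]], rule eventually_mono[OF eventually_True])
    fix y
    show "norm (norm (f y *\<^sub>R h y - f x *\<^sub>R h x - f x *\<^sub>R h' (y - x)) / norm (y - x))
      \<le> \<bar>f y\<bar> * norm (h y - h x - h' (y - x)) / norm (y - x) + \<bar>f y - f x\<bar> * B"
    proof (cases "y = x")
      case False
      have "f y *\<^sub>R h y - f x *\<^sub>R h x - f x *\<^sub>R h' (y - x)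
         = f y *\<^sub>R (h y - h x - h' (y - x)) + (f y - f x) *\<^sub>R h' (y - x)"
        by (simp add: assms(2) algebra_simps)
      then have "norm (f y *\<^sub>R h y - f x *\<^sub>R h x - f x *\<^sub>R h' (y - x))
        \<le> \<bar>f y\<bar> * norm (h y - h x - h' (y - x)) + \<bar>f y - f x\<bar> * norm (h' (y - x))"
        using norm_triangle_ineq by (metis (no_types, lifting) norm_scaleR)
      also have "\<dots> \<le> \<bar>f y\<bar> * norm (h y - h x - h' (y - x)) + \<bar>f y - f x\<bar> * (norm (y - x) * B)"
        by (intro add_left_mono mult_left_mono B) simp
      finally show ?thesis using False by (simp add: field_simps)
    qed (simp add: assms(2) bl linear_simps B(1) less_imp_le)
  qed
  then show ?thesis
    using bl by (simp add: has_derivative_iff_norm bounded_linear_const_scaleR)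
qed

text \<open>Inversion of linear maps is smooth. Everything follows from the identity
  \<open>b y - b z = b z (a z - a y) b y\<close>, read in coordinates: it bounds the variation of the inverse by
  the variation of \<open>a\<close>, and to first order it gives the derivative \<open>- b (Da) b\<close>.\<close>

context
  fixes a b :: "'a::euclidean_space \<Rightarrow> 'v::euclidean_space \<Rightarrow> 'v" and W :: "'a set"
  assumes W: "open W"
    and lin: "\<And>y. y \<in> W \<Longrightarrow> linear (a y)" "\<And>y. y \<in> W \<Longrightarrow> linear (b y)"
    and inv: "\<And>y u. y \<in> W \<Longrightarrow> a y (b y u) = u" "\<And>y u. y \<in> W \<Longrightarrow> b y (a y u) = u"
begin

lemma inverse_family_diff:
  assumes "y \<in> W" "z \<in> W"
  shows "b y u - b z u = (\<Sum>e\<in>Basis. (b y u \<bullet> e) *\<^sub>R b z (a z e - a y e))"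
proof -
  have "b y u - b z u = b z (a z (b y u) - a y (b y u))"
    using inv assms by (simp add: linear_diff[OF lin(2)])
  also have "\<dots> = b z (\<Sum>e\<in>Basis. (b y u \<bullet> e) *\<^sub>R (a z e - a y e))"
    unfolding linear_eq_sum_Basis[OF lin(1)[OF assms(2)], of "b y u"]
      linear_eq_sum_Basis[OF lin(1)[OF assms(1)], of "b y u"]
    by (simp add: sum_subtractf scaleR_diff_right)
  also have "\<dots> = (\<Sum>e\<in>Basis. (b y u \<bullet> e) *\<^sub>R b z (a z e - a y e))"
    by (simp add: linear_sum[OF lin(2)[OF assms(2)]] linear_scale[OF lin(2)[OF assms(2)]])
  finally show ?thesis .
qed

lemma inverse_family_continuous:
  assumes "\<And>u. continuous_on W (\<lambda>y. a y u)"
  shows "continuous_on W (\<lambda>y. b y u)"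
proof -
  have "isCont (\<lambda>y. b y u) z" if z: "z \<in> W" for z
  proof -
    define \<epsilon> where "\<epsilon> y = (\<Sum>e\<in>Basis. norm (b z (a z e - a y e)))" for y
    have bl: "bounded_linear (b z)" using lin(2)[OF z] by (simp add: linear_linear)
    have "isCont (\<lambda>y. a y e) z" for e
      using assms[of e] W z by (simp add: continuous_on_eq_continuous_at)
    then have "isCont \<epsilon> z" unfolding \<epsilon>_def
      by (intro continuous_intros bounded_linear.continuous[OF bl])
    then have lim: "(\<epsilon> \<longlongrightarrow> 0) (at z)"
      using linear_0[OF lin(2)[OF z]] by (simp add: isCont_def \<epsilon>_def)
    have le: "norm (b y u - b z u) \<le> \<epsilon> y * norm (b y u)" if "y \<in> W" for y
    proof -
      have "norm (b y u - b z u) \<le> (\<Sum>e\<in>Basis. norm ((b y u \<bullet> e) *\<^sub>R b z (a z e - a y e)))"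
        unfolding inverse_family_diff[OF that z] by (rule norm_sum)
      also have "\<dots> \<le> (\<Sum>e\<in>Basis. norm (b y u) * norm (b z (a z e - a y e)))"
        by (auto intro!: sum_mono mult_right_mono Basis_le_norm)
      finally show ?thesis by (simp add: \<epsilon>_def sum_distrib_left mult.commute)
    qed
    \<comment> \<open>Once \<open>\<epsilon> y \<le> 1/2\<close>, the unknown \<open>norm (b y u)\<close> on the right of \<open>le\<close> can be absorbed.\<close>
    have ev: "\<forall>\<^sub>F y in at z. norm (b y u - b z u) \<le> \<epsilon> y * (2 * norm (b z u))"
      using order_tendstoD(2)[OF lim, of "1/2", simplified]
        eventually_at_in_open'[OF W z]
    proof eventually_elim
      case (elim y)
      have "norm (b y u - b z u) \<le> \<epsilon> y * norm (b y u)" using le elim by blast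
      moreover have "\<epsilon> y * norm (b y u) \<le> 1/2 * norm (b y u)"
        using elim by (intro mult_right_mono) auto
      moreover have "norm (b y u) \<le> norm (b z u) + norm (b y u - b z u)"
        by (metis add.commute diff_add_cancel norm_triangle_ineq)
      ultimately have "norm (b y u) \<le> 2 * norm (b z u)" by linarith
      then have "\<epsilon> y * norm (b y u) \<le> \<epsilon> y * (2 * norm (b z u))"
        by (intro mult_left_mono) (auto simp: \<epsilon>_def sum_nonneg)
      then show ?case using le elim by fastforce
    qed
    have "((\<lambda>y. \<epsilon> y * (2 * norm (b z u))) \<longlongrightarrow> 0 * (2 * norm (b z u))) (at z)"
      using lim by (intro tendsto_intros)
    then have "((\<lambda>y. b y u - b z u) \<longlongrightarrow> 0) (at z)"
      by (intro Lim_null_comparison[OF ev]) simp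
    then show ?thesis by (simp add: isCont_def LIM_zero_iff)
  qed
  then show ?thesis by (simp add: continuous_at_imp_continuous_on)
qed

lemma inverse_family_C_on:
  "(\<And>u. C_on k (\<lambda>y. a y u) W) \<Longrightarrow> C_on k (\<lambda>y. b y u) W"
proof (induction k arbitrary: u)
  case 0
  then show ?case using inverse_family_continuous by simp
next
  case (Suc k)
  define D where "D y v e = frechet_derivative (\<lambda>y. a y e) (at y) v" for y v e
  define b' where "b' y v = (\<Sum>e\<in>Basis. (b y u \<bullet> e) *\<^sub>R b y (- D y v e))" for y v
  have b_cont: "continuous_on W (\<lambda>y. b y u)"
    using C_on_mono[OF Suc.prems, of 0] by (intro inverse_family_continuous) simp
  have D: "((\<lambda>y. a y e) has_derivative (\<lambda>v. D y v e)) (at y)" if "y \<in> W" for y e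
    unfolding D_def using C_on_has_derivative[OF Suc.prems that] .
  show ?case
  proof (rule C_on_SucI[OF W])
    fix z assume z: "z \<in> W"
    have bl: "bounded_linear (b z)" using lin(2)[OF z] by (simp add: linear_linear)
    have "((\<lambda>y. b z u + (\<Sum>e\<in>Basis. (b y u \<bullet> e) *\<^sub>R b z (a z e - a y e))) has_derivative
       (\<lambda>v. 0 + (\<Sum>e\<in>Basis. (b z u \<bullet> e) *\<^sub>R b z (0 - D z v e)))) (at z)"
    proof (intro has_derivative_add has_derivative_const has_derivative_sum
        has_derivative_scaleR_vanishing bounded_linear.has_derivative[OF bl] has_derivative_diff D z)
      show "isCont (\<lambda>y. b y u \<bullet> e) z" for e
        using b_cont W z by (auto simp: continuous_on_eq_continuous_at intro!: continuous_intros)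
    qed (simp add: linear_0 lin z)
    then have "((\<lambda>y. b z u + (\<Sum>e\<in>Basis. (b y u \<bullet> e) *\<^sub>R b z (a z e - a y e))) has_derivative b' z) (at z)"
      by (simp add: b'_def[abs_def])
    then show "((\<lambda>y. b y u) has_derivative b' z) (at z)"
      by (rule has_derivative_transform_within_open[OF _ W z])
        (simp flip: inverse_family_diff[OF _ z])
  next
    fix v
    have "C_on k (\<lambda>y. b y w) W" for w
      using Suc.IH C_on_SucD[OF Suc.prems] .
    moreover have "C_on k (\<lambda>y. D y v e) W" for e
      using Suc.prems by (simp add: D_def)
    ultimately have "C_on k (\<lambda>y. \<Sum>e\<in>Basis. (b y u \<bullet> e) *\<^sub>R (\<Sum>c\<in>Basis. (- (D y v e) \<bullet> c) *\<^sub>R b y c)) W"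
      using C_on_bounded_linear[OF bounded_linear_minus[OF bounded_linear_ident] W]
      by (intro C_on_sum C_on_scaleR C_on_inner C_on_const W) auto
    then show "C_on k (\<lambda>y. b' y v) W"
    proof (rule C_on_transform[OF W])
      fix y assume "y \<in> W"
      show "b' y v = (\<Sum>e\<in>Basis. (b y u \<bullet> e) *\<^sub>R (\<Sum>c\<in>Basis. (- (D y v e) \<bullet> c) *\<^sub>R b y c))"
        unfolding b'_def by (subst (2) linear_eq_sum_Basis[OF lin(2)[OF \<open>y \<in> W\<close>]]) simp
    qed
  qed
qed

end

text \<open>The inverse function theorem provides a differentiable local inverse \<open>\<psi>\<close>. Its derivative at
  \<open>y\<close> is the inverse of \<open>D\<phi> (\<psi> y)\<close>, so it is as often differentiable as \<open>\<psi>\<close> itself, and \<open>\<psi>\<close> gains one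
  order at each step of the induction.\<close>

lemma smooth_inverse_function:
  fixes \<phi> :: "'v::euclidean_space \<Rightarrow> 'v"
  assumes smooth: "smooth_on \<phi> UNIV" and id: "frechet_derivative \<phi> (at x) = id"
  obtains U W \<psi> where "open U" "x \<in> U" "open W" "homeomorphism U W \<phi> \<psi>" "smooth_on \<psi> W"
    "\<And>y. y \<in> U \<Longrightarrow> bij (frechet_derivative \<phi> (at y))"
    "\<And>y. y \<in> W \<Longrightarrow> (\<psi> has_derivative inv (frechet_derivative \<phi> (at (\<psi> y)))) (at y)"
proof -
  let ?D = "\<lambda>y. frechet_derivative \<phi> (at y)"
  have D: "(\<phi> has_derivative ?D y) (at y)" for y
    using smooth_on_has_derivative[OF smooth] by simp
  have bl: "bounded_linear (?D y)" for y using D has_derivative_bounded_linear by blast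
  define f' where "f' y = Blinfun (?D y)" for y
  have f': "blinfun_apply (f' y) = ?D y" for y
    unfolding f'_def using bl by (rule bounded_linear_Blinfun_apply)
  have der: "\<And>y. y \<in> UNIV \<Longrightarrow> (\<phi> has_derivative blinfun_apply (f' y)) (at y)"
    using D f' by simp
  have "continuous_on UNIV (\<lambda>y. blinfun_apply (f' y) v)" for v
    unfolding f' by (intro smooth_on_imp_continuous_on smooth_on_frechet_derivative smooth)
  then have cont: "continuous_on UNIV f'"
    by (intro continuous_on_blinfun_componentwise)
  have invf: "id_blinfun o\<^sub>L f' x = id_blinfun"
    by (rule blinfun_eqI) (simp add: f' id)
  obtain U W \<psi> \<psi>' where *: "open U" "U \<subseteq> UNIV" "x \<in> U" "open W" "\<phi> x \<in> W" "homeomorphism U W \<phi> \<psi>"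
    "\<And>y. y \<in> W \<Longrightarrow> (\<psi> has_derivative \<psi>' y) (at y)"
    "\<And>y. y \<in> W \<Longrightarrow> \<psi>' y = inv (?D (\<psi> y))"
    "\<And>y. y \<in> W \<Longrightarrow> bij (?D (\<psi> y))"
    using inverse_function_theorem[OF open_UNIV der cont UNIV_I invf] unfolding f' by blast
  have d: "(\<psi> has_derivative inv (?D (\<psi> y))) (at y)" if "y \<in> W" for y
    using *(7)[OF that] *(8)[OF that] by simp
  have lin: "linear (?D y)" for y using D has_derivative_linear by blast
  have inv: "?D (\<psi> y) (inv (?D (\<psi> y)) u) = u" "inv (?D (\<psi> y)) (?D (\<psi> y) u) = u"
    if "y \<in> W" for y u
    using *(9)[OF that] by (simp_all add: bij_is_surj surj_f_inv_f bij_is_inj)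
  have "C_on k \<psi> W" for k
  proof (induction k)
    case 0
    show ?case using * by (simp add: homeomorphism_def)
  next
    case (Suc k)
    show ?case
    proof (rule C_on_SucI[OF \<open>open W\<close> d])
      fix v
      have "C_on k (\<lambda>y. ?D (\<psi> y) u) W" for u
        by (intro C_on_compose[OF \<open>open W\<close> open_UNIV _ _ Suc])
          (use smooth_on_frechet_derivative[OF smooth] in \<open>simp_all add: smooth_on_def\<close>)
      then show "C_on k (\<lambda>y. inv (?D (\<psi> y)) v) W"
        by (intro inverse_family_C_on[where a = "\<lambda>y. ?D (\<psi> y)"
              and b = "\<lambda>y. inv (?D (\<psi> y))", OF \<open>open W\<close>] lin has_derivative_linear[OF d] inv)
    qed
  qed
  then have "smooth_on \<psi> W" by (simp add: smooth_on_def)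
  moreover have "bij (?D y)" if "y \<in> U" for y
    using *(9)[of "\<phi> y"] *(6) that by (auto simp: homeomorphism_def)
  ultimately show ?thesis using that[OF *(1,3,4,6)] d by blast
qed

text \<open>The second difference \<open>f (x + hu + hv) - f (x + hu) - f (x + hv) + f x\<close> is symmetric in \<open>u\<close> and
  \<open>v\<close>. Two applications of the mean value theorem turn it into \<open>h\<^sup>2\<close> times one of the mixed
  derivatives at a nearby point, and the order of the two applications decides which.\<close>

lemma second_derivative_symmetric_real:
  fixes f :: "'a::real_normed_vector \<Rightarrow> real"
  assumes U: "open U" "x \<in> U"
    and f: "\<And>y. y \<in> U \<Longrightarrow> (f has_derivative f' y) (at y)"
    and A: "\<And>y. y \<in> U \<Longrightarrow> ((\<lambda>y. f' y u) has_derivative A y) (at y)"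
    and B: "\<And>y. y \<in> U \<Longrightarrow> ((\<lambda>y. f' y v) has_derivative B y) (at y)"
    and cont: "continuous_on U (\<lambda>y. A y v)" "continuous_on U (\<lambda>y. B y u)"
  shows "A x v = B x u"
proof -
  have key: "\<exists>s t. 0 \<le> s \<and> s \<le> h \<and> 0 \<le> t \<and> t \<le> h \<and>
     f (x + h *\<^sub>R u + h *\<^sub>R v) - f (x + h *\<^sub>R u) - f (x + h *\<^sub>R v) + f x = h\<^sup>2 * A (x + s *\<^sub>R u + t *\<^sub>R v) v"
    if h: "0 < h" "\<And>s t. 0 \<le> s \<Longrightarrow> s \<le> h \<Longrightarrow> 0 \<le> t \<Longrightarrow> t \<le> h \<Longrightarrow> x + s *\<^sub>R u + t *\<^sub>R v \<in> U"
      and f: "\<And>y. y \<in> U \<Longrightarrow> (f has_derivative f' y) (at y)"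
      and A: "\<And>y. y \<in> U \<Longrightarrow> ((\<lambda>y. f' y u) has_derivative A y) (at y)"
    for h :: real and u v :: 'a and A
  proof -
    let ?\<phi> = "\<lambda>s. f (x + s *\<^sub>R u + h *\<^sub>R v) - f (x + s *\<^sub>R u)"
    have 1: "(?\<phi> has_real_derivative f' (x + s *\<^sub>R u + h *\<^sub>R v) u - f' (x + s *\<^sub>R u) u) (at s)"
      if "0 \<le> s" "s \<le> h" for s
    proof -
      have "x + s *\<^sub>R u + h *\<^sub>R v \<in> U" "x + s *\<^sub>R u \<in> U"
        using h(2)[of s h] h(2)[of s 0] h(1) that by auto
      note d = f[OF this(1)] f[OF this(2)]
      have "((\<lambda>s. x + s *\<^sub>R u + w) has_derivative (\<lambda>d. d *\<^sub>R u)) (at s)" for w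
        by (auto intro!: derivative_eq_intros)
      from diff_chain_at[OF this[of "h *\<^sub>R v"] d(1)] diff_chain_at[OF this[of 0], of f "f' (x + s *\<^sub>R u)"] d(2)
      have "(?\<phi> has_derivative (\<lambda>r. f' (x + s *\<^sub>R u + h *\<^sub>R v) (r *\<^sub>R u) - f' (x + s *\<^sub>R u) (r *\<^sub>R u))) (at s)"
        by (auto simp: o_def intro!: has_derivative_diff)
      moreover have "f' (x + s *\<^sub>R u + h *\<^sub>R v) (r *\<^sub>R u) - f' (x + s *\<^sub>R u) (r *\<^sub>R u)
         = (f' (x + s *\<^sub>R u + h *\<^sub>R v) u - f' (x + s *\<^sub>R u) u) * r" for r
        by (simp add: linear_scale[OF has_derivative_linear[OF d(1)]]
            linear_scale[OF has_derivative_linear[OF d(2)]] right_diff_distrib mult.commute)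
      ultimately show ?thesis by (simp add: has_field_derivative_def)
    qed
    obtain s where s: "0 < s" "s < h"
      "?\<phi> h - ?\<phi> 0 = (h - 0) * (f' (x + s *\<^sub>R u + h *\<^sub>R v) u - f' (x + s *\<^sub>R u) u)"
      using MVT2[OF h(1) 1] by auto
    let ?\<chi> = "\<lambda>t. f' (x + s *\<^sub>R u + t *\<^sub>R v) u"
    have 2: "(?\<chi> has_real_derivative A (x + s *\<^sub>R u + t *\<^sub>R v) v) (at t)" if "0 \<le> t" "t \<le> h" for t
    proof -
      have "x + s *\<^sub>R u + t *\<^sub>R v \<in> U" using h(2)[of s t] s that by auto
      note d = A[OF this]
      have "((\<lambda>t. x + s *\<^sub>R u + t *\<^sub>R v) has_derivative (\<lambda>d. d *\<^sub>R v)) (at t)"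
        by (auto intro!: derivative_eq_intros)
      from diff_chain_at[OF this d] 
      have "(?\<chi> has_derivative (\<lambda>r. A (x + s *\<^sub>R u + t *\<^sub>R v) (r *\<^sub>R v))) (at t)"
        by (simp add: o_def)
      moreover have "A (x + s *\<^sub>R u + t *\<^sub>R v) (r *\<^sub>R v) = A (x + s *\<^sub>R u + t *\<^sub>R v) v * r" for r
        by (simp add: linear_scale[OF has_derivative_linear[OF d]])
      ultimately show ?thesis by (simp add: has_field_derivative_def)
    qed
    obtain t where t: "0 < t" "t < h" "?\<chi> h - ?\<chi> 0 = (h - 0) * A (x + s *\<^sub>R u + t *\<^sub>R v) v"
      using MVT2[OF h(1) 2] by auto
    show ?thesis
      using s t by (intro exI[of _ s] exI[of _ t]) (auto simp: power2_eq_square algebra_simps)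
  qed
  have "A x v \<ge> B x u - 2 * e \<and> A x v \<le> B x u + 2 * e" if e: "e > 0" for e
  proof -
    have "isCont (\<lambda>y. A y v) x" "isCont (\<lambda>y. B y u) x"
      using cont U by (auto simp: continuous_on_eq_continuous_at)
    then have "\<forall>\<^sub>F y in nhds x. dist (A y v) (A x v) < e" "\<forall>\<^sub>F y in nhds x. dist (B y u) (B x u) < e"
      using e by (auto simp: isCont_def eventually_nhds_conv_at dest: tendstoD)
    with eventually_nhds_in_open[OF U]
    have "\<forall>\<^sub>F y in nhds x. y \<in> U \<and> dist (A y v) (A x v) < e \<and> dist (B y u) (B x u) < e"
      by eventually_elim auto
    then obtain d where d: "d > 0"
      "\<And>y. dist y x < d \<Longrightarrow> y \<in> U \<and> dist (A y v) (A x v) < e \<and> dist (B y u) (B x u) < e"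
      unfolding eventually_nhds_metric by blast
    define c where "c = norm u + norm v + 1"
    define h where "h = d / (2 * c)"
    have pos: "c > 0" by (simp add: c_def add_nonneg_pos)
    have h: "h > 0" using d(1) pos by (simp add: h_def)
    have near: "dist (x + s *\<^sub>R u + t *\<^sub>R v) x < d" if "0 \<le> s" "s \<le> h" "0 \<le> t" "t \<le> h" for s t
    proof -
      have "norm (s *\<^sub>R u + t *\<^sub>R v) \<le> s * norm u + t * norm v"
        using that norm_triangle_ineq[of "s *\<^sub>R u" "t *\<^sub>R v"] by simp
      also have "\<dots> \<le> h * norm u + h * norm v"
        using that by (intro add_mono mult_right_mono) auto
      also have "\<dots> \<le> h * c" using h by (simp add: c_def algebra_simps)
      also have "\<dots> = d / 2" using pos by (simp add: h_def)
      finally show ?thesis using d(1) by (simp add: dist_norm add.assoc)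
    qed
    obtain s t where st: "0 \<le> s" "s \<le> h" "0 \<le> t" "t \<le> h"
      "f (x + h *\<^sub>R u + h *\<^sub>R v) - f (x + h *\<^sub>R u) - f (x + h *\<^sub>R v) + f x = h\<^sup>2 * A (x + s *\<^sub>R u + t *\<^sub>R v) v"
      using key[OF h _ f A] near d(2) by blast
    have near2: "x + s *\<^sub>R v + t *\<^sub>R u \<in> U" if "0 \<le> s" "s \<le> h" "0 \<le> t" "t \<le> h" for s t
      using d(2)[OF near[OF that(3,4,1,2)]] by (simp add: algebra_simps)
    obtain s' t' where st': "0 \<le> s'" "s' \<le> h" "0 \<le> t'" "t' \<le> h"
      "f (x + h *\<^sub>R v + h *\<^sub>R u) - f (x + h *\<^sub>R v) - f (x + h *\<^sub>R u) + f x = h\<^sup>2 * B (x + s' *\<^sub>R v + t' *\<^sub>R u) u"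
      using key[OF h near2 f B] by blast
    have "h\<^sup>2 * A (x + s *\<^sub>R u + t *\<^sub>R v) v = h\<^sup>2 * B (x + t' *\<^sub>R u + s' *\<^sub>R v) u"
      using st(5) st'(5) by (simp add: algebra_simps)
    then have "A (x + s *\<^sub>R u + t *\<^sub>R v) v = B (x + t' *\<^sub>R u + s' *\<^sub>R v) u" using h by simp
    moreover have "dist (A (x + s *\<^sub>R u + t *\<^sub>R v) v) (A x v) < e"
      "dist (B (x + t' *\<^sub>R u + s' *\<^sub>R v) u) (B x u) < e"
      using d(2) near st st' by blast+
    ultimately show ?thesis unfolding dist_real_def by linarith
  qed
  note * = this
  show ?thesis
  proof (rule ccontr)
    assume "A x v \<noteq> B x u"
    then have "\<bar>A x v - B x u\<bar> / 4 > 0" by simp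
    from *[OF this] \<open>A x v \<noteq> B x u\<close> show False by (auto simp: abs_if field_simps split: if_splits)
  qed
qed

lemma second_derivative_symmetric:
  fixes f :: "'a::real_normed_vector \<Rightarrow> 'b::euclidean_space"
  assumes U: "open U" "x \<in> U" and f: "smooth_on f U"
  shows "frechet_derivative (\<lambda>y. frechet_derivative f (at y) u) (at x) v
       = frechet_derivative (\<lambda>y. frechet_derivative f (at y) v) (at x) u"
proof (rule euclidean_eqI)
  fix b :: 'b
  let ?A = "\<lambda>u y. frechet_derivative (\<lambda>y. frechet_derivative f (at y) u) (at y)"
  have 1: "smooth_on (\<lambda>y. frechet_derivative f (at y) u) U" for u
    by (rule smooth_on_frechet_derivative[OF f])
  have 2: "((\<lambda>y. frechet_derivative f (at y) u \<bullet> b) has_derivative (\<lambda>v. ?A u y v \<bullet> b)) (at y)"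
    if "y \<in> U" for u y
    by (intro has_derivative_inner_left smooth_on_has_derivative[OF 1 that])
  have 3: "((\<lambda>y. f y \<bullet> b) has_derivative (\<lambda>v. frechet_derivative f (at y) v \<bullet> b)) (at y)"
    if "y \<in> U" for y
    by (intro has_derivative_inner_left smooth_on_has_derivative[OF f that])
  have 4: "continuous_on U (\<lambda>y. ?A u y v \<bullet> b)" for u v
    by (intro continuous_on_inner continuous_on_const smooth_on_imp_continuous_on
        smooth_on_frechet_derivative 1)
  show "?A u x v \<bullet> b = ?A v x u \<bullet> b"
    by (rule second_derivative_symmetric_real[OF U 3 2 2 4 4])
qed

section \<open>Regular level sets\<close>

text \<open>The derivative of \<open>y \<mapsto> Df y (Y y)\<close>. Differentials of constraint functions applied to tangent
  fields and iterated covariant derivatives both have this form.\<close>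

lemma has_derivative_frechet_apply:
  fixes f :: "'a::euclidean_space \<Rightarrow> 'b::real_normed_vector"
  assumes U: "open U" "x \<in> U" and f: "smooth_on f U" and Y: "(Y has_derivative Y') (at x)"
  shows "((\<lambda>y. frechet_derivative f (at y) (Y y)) has_derivative
     (\<lambda>v. frechet_derivative (\<lambda>y. frechet_derivative f (at y) (Y x)) (at x) v
        + frechet_derivative f (at x) (Y' v))) (at x)"
proof -
  let ?D = "\<lambda>y. frechet_derivative f (at y)"
  let ?D2 = "\<lambda>u. frechet_derivative (\<lambda>y. ?D y u) (at x)"
  have D2: "((\<lambda>y. ?D y u) has_derivative ?D2 u) (at x)" for u
    by (rule smooth_on_has_derivative[OF smooth_on_frechet_derivative[OF f] U(2)])
  have lin: "linear (?D y)" if "y \<in> U" for y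
    using smooth_on_has_derivative[OF f that] by (rule has_derivative_linear)
  have rep: "(\<Sum>b\<in>Basis. (u \<bullet> b) *\<^sub>R ?D y b) = ?D y u" if "y \<in> U" for y u
    by (rule linear_eq_sum_Basis[OF lin[OF that], symmetric])
  have 1: "((\<lambda>y. ?D y (Z y)) has_derivative
      (\<lambda>v. (\<Sum>b\<in>Basis. (Z x \<bullet> b) *\<^sub>R ?D2 b v) + ?D x (Z' v))) (at x)"
    if Z: "(Z has_derivative Z') (at x)" for Z Z'
  proof -
    have "((\<lambda>y. \<Sum>b\<in>Basis. (Z y \<bullet> b) *\<^sub>R ?D y b) has_derivative
      (\<lambda>v. \<Sum>b\<in>Basis. (Z x \<bullet> b) *\<^sub>R ?D2 b v + (Z' v \<bullet> b) *\<^sub>R ?D x b)) (at x)"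
      by (intro has_derivative_sum has_derivative_scaleR has_derivative_inner_left Z D2)
    then have "((\<lambda>y. \<Sum>b\<in>Basis. (Z y \<bullet> b) *\<^sub>R ?D y b) has_derivative
      (\<lambda>v. (\<Sum>b\<in>Basis. (Z x \<bullet> b) *\<^sub>R ?D2 b v) + ?D x (Z' v))) (at x)"
      unfolding sum.distrib rep[OF U(2)] .
    then show ?thesis
      by (rule has_derivative_transform_within_open[OF _ U]) (rule rep)
  qed
  have "?D2 u v = (\<Sum>b\<in>Basis. (u \<bullet> b) *\<^sub>R ?D2 b v) + ?D x 0" for u v
    using fun_cong[OF has_derivative_unique[OF D2[of u] 1[of "\<lambda>_. u" "\<lambda>_. 0", OF has_derivative_const]], of v] .
  then have eq: "?D2 u v = (\<Sum>b\<in>Basis. (u \<bullet> b) *\<^sub>R ?D2 b v)" for u v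
    unfolding linear_0[OF lin[OF U(2)]] add_0_right .
  show ?thesis using 1[OF Y] unfolding eq[of "Y x"] .
qed

lemma subspace_add_iff: "subspace E \<Longrightarrow> w \<in> E \<Longrightarrow> y + w \<in> E \<longleftrightarrow> y \<in> E"
  by (metis add_diff_cancel subspace_add subspace_diff)

lemma subspace_memI_orthogonal:
  fixes E :: "'v::euclidean_space set"
  assumes "subspace E" "\<And>b. (\<And>w. w \<in> E \<Longrightarrow> w \<bullet> b = 0) \<Longrightarrow> v \<bullet> b = 0"
  shows "v \<in> E"
proof -
  have "v \<in> orthogonal_comp (orthogonal_comp E)"
    using assms(2) by (auto simp: orthogonal_comp_def orthogonal_def inner_commute)
  then show ?thesis by (simp add: orthogonal_comp_self assms(1))
qed

text \<open>The derivative within \<open>M\<close> is one of many linear maps. Its value at a tangent vector is forced by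
  composition with a curve in \<open>M\<close>, so it can be computed from any local extension of the function.\<close>

lemma differential_eq:
  fixes f :: "'v::euclidean_space \<Rightarrow> 'w::euclidean_space"
  assumes v: "v \<in> tangent_space M x" and U: "open U" "x \<in> U"
    and g: "(g has_derivative g') (at x)" and eq: "\<And>y. y \<in> M \<inter> U \<Longrightarrow> f y = g y"
  shows "differential M f x v = g' v"
proof -
  obtain \<gamma> e where \<gamma>: "0 < e" "\<gamma> ` {-e<..<e::real} \<subseteq> M" "\<gamma> 0 = x"
    "(\<gamma> has_vector_derivative v) (at 0)"
    using v unfolding tangent_space_def by blast
  have x: "x \<in> M" using \<gamma> by force
  obtain d where d: "d > 0" "ball x d \<subseteq> U" using U open_contains_ball by blast
  have fg: "(f has_derivative g') (at x within M)"
    by (rule has_derivative_transform_within[OF has_derivative_at_withinI[OF g] d(1) x])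
      (use d eq in \<open>auto simp: dist_commute subset_iff\<close>)
  let ?F = "frechet_derivative f (at x within M)"
  have F: "(f has_derivative ?F) (at x within M)"
    using frechet_derivative_works[THEN iffD1, OF differentiableI[OF fg]] .
  have "((\<lambda>t. f (\<gamma> t)) has_derivative (\<lambda>t. h (t *\<^sub>R v))) (at 0)"
    if h: "(f has_derivative h) (at x within M)" for h
  proof -
    have "(\<gamma> has_derivative (\<lambda>t. t *\<^sub>R v)) (at 0 within {-e<..<e})"
      using has_derivative_at_withinI[OF \<gamma>(4)[unfolded has_vector_derivative_def]] .
    moreover have "(f has_derivative h) (at (\<gamma> 0) within \<gamma> ` {-e<..<e})"
      using has_derivative_subset[OF h \<gamma>(2)] \<gamma>(3) by simp
    ultimately have "((\<lambda>t. f (\<gamma> t)) has_derivative (\<lambda>t. h (t *\<^sub>R v))) (at 0 within {-e<..<e})"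
      by (rule has_derivative_in_compose)
    moreover have "at 0 within {-e<..<e} = at 0"
      by (rule at_within_open) (use \<gamma>(1) in auto)
    ultimately show ?thesis by (simp only:)
  qed
  from fun_cong[OF has_derivative_unique[OF this[OF F] this[OF fg]], of 1]
  have "?F v = g' v" by simp
  then show ?thesis by (simp add: differential_def)
qed

text \<open>An identity that holds on \<open>M\<close> may be differentiated in tangent directions.\<close>

lemma tangent_derivative_zero:
  fixes h :: "'v::euclidean_space \<Rightarrow> 'w::euclidean_space"
  assumes "v \<in> tangent_space M x" "open U" "x \<in> U"
    and "(h has_derivative h') (at x)" "\<And>y. y \<in> M \<inter> U \<Longrightarrow> h y = 0"
  shows "h' v = 0"
proof -
  have "differential M (\<lambda>_. 0) x v = h' v"
    by (rule differential_eq[OF assms(1-4)]) (simp add: assms(5))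
  moreover have "differential M (\<lambda>_. 0 :: 'w) x v = 0"
    by (rule differential_eq[OF assms(1-3) has_derivative_const]) simp
  ultimately show ?thesis by simp
qed

lemma smooth_along_local:
  assumes "smooth_along M X" "x \<in> M"
  obtains U Z where "open U" "x \<in> U" "smooth_on Z U" "\<And>y. y \<in> M \<inter> U \<Longrightarrow> X y = Z y"
proof -
  obtain U Z where "open U" "x \<in> U" "smooth_on Z U" "\<forall>y\<in>M \<inter> U. Z y = X y"
    using assms unfolding smooth_along_def by blast
  then show ?thesis using that[of U Z] by simp
qed

text \<open>The points of a linear subspace \<open>E\<close> that satisfy finitely many equations whose differentials are
  jointly surjective on \<open>E\<close>. The linear equations of \<open>E\<close> are kept apart from the functions \<open>g i\<close>,
  since for Hermitian matrices they have no canonical enumeration.\<close>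

definition regular_level_set :: "'v::euclidean_space set \<Rightarrow> 'i set \<Rightarrow> ('i \<Rightarrow> 'v \<Rightarrow> real) \<Rightarrow> 'v set"
  where "regular_level_set E I g = {y \<in> E. (\<forall>i\<in>I. g i y = 0) \<and>
    (\<forall>c. \<exists>v\<in>E. \<forall>i\<in>I. frechet_derivative (g i) (at y) v = c i)}"

locale level_set =
  fixes E :: "'v::euclidean_space set" and I :: "'i set" and g :: "'i \<Rightarrow> 'v \<Rightarrow> real"
    and M :: "'v set"
  assumes subspace_E: "subspace E" and finite_I: "finite I"
    and smooth_g: "\<And>i. i \<in> I \<Longrightarrow> smooth_on (g i) UNIV"
    and M_eq: "M = regular_level_set E I g"
begin

abbreviation Dg :: "'i \<Rightarrow> 'v \<Rightarrow> 'v \<Rightarrow> real" where "Dg i y \<equiv> frechet_derivative (g i) (at y)"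

definition kernel :: "'v \<Rightarrow> 'v set" where "kernel y = {v \<in> E. \<forall>i\<in>I. Dg i y v = 0}"

lemma has_derivative_g: "i \<in> I \<Longrightarrow> (g i has_derivative Dg i y) (at y)"
  using smooth_on_has_derivative[OF smooth_g] by simp

lemma linear_Dg: "i \<in> I \<Longrightarrow> linear (Dg i y)"
  using has_derivative_g has_derivative_linear by blast

lemma subspace_kernel: "subspace (kernel y)"
  using subspace_E unfolding kernel_def subspace_def
  by (auto simp: linear_0[OF linear_Dg] linear_add[OF linear_Dg] linear_scale[OF linear_Dg])

text \<open>Surjectivity of the differentials gives vectors \<open>d i\<close> dual to them; every later use of regularity
  goes through these vectors.\<close>

lemma dual_vectors:
  assumes "x \<in> M"
  obtains d where
    "\<And>i j. i \<in> I \<Longrightarrow> j \<in> I \<Longrightarrow> Dg j x (d i) = (if i = j then 1 else 0)"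
    "\<And>c. (\<Sum>i\<in>I. c i *\<^sub>R d i) \<in> E"
    "\<And>c j. j \<in> I \<Longrightarrow> Dg j x (\<Sum>i\<in>I. c i *\<^sub>R d i) = c j"
proof -
  have "\<exists>v\<in>E. \<forall>j\<in>I. Dg j x v = (if i = j then 1 else 0)" for i
    using assms unfolding M_eq regular_level_set_def mem_Collect_eq
    by (elim conjE allE[of _ "\<lambda>j. if i = j then 1 else 0"])
  then obtain d where d: "\<And>i. d i \<in> E" "\<And>i j. j \<in> I \<Longrightarrow> Dg j x (d i) = (if i = j then 1 else 0)"
    by metis
  show ?thesis
  proof (rule that)
    show "Dg j x (d i) = (if i = j then 1 else 0)" if "j \<in> I" for i j
      using d(2) that .
    show "(\<Sum>i\<in>I. c i *\<^sub>R d i) \<in> E" for c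
      using d(1) subspace_E by (auto intro!: subspace_sum subspace_scale)
    show "Dg j x (\<Sum>i\<in>I. c i *\<^sub>R d i) = c j" if "j \<in> I" for c j
      by (simp add: linear_sum[OF linear_Dg[OF that]] linear_scale[OF linear_Dg[OF that]]
          d(2)[OF that] finite_I that if_distrib cong: if_cong)
  qed
qed

lemma dim_kernel:
  assumes "x \<in> M"
  shows "dim (kernel x) = dim E - card I"
proof -
  obtain d where d: "\<And>i j. i \<in> I \<Longrightarrow> j \<in> I \<Longrightarrow> Dg j x (d i) = (if i = j then 1 else 0)"
    and sum_E: "\<And>c. (\<Sum>i\<in>I. c i *\<^sub>R d i) \<in> E"
    and D_sum: "\<And>c j. j \<in> I \<Longrightarrow> Dg j x (\<Sum>i\<in>I. c i *\<^sub>R d i) = c j"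
    using dual_vectors[OF assms] by blast
  have inj: "inj_on d I"
    by (rule inj_onI) (metis d zero_neq_one)
  have sum_d: "(\<Sum>v\<in>d ` I. u v *\<^sub>R v) = (\<Sum>i\<in>I. u (d i) *\<^sub>R d i)" for u
    by (simp add: sum.reindex[OF inj])
  have "independent (d ` I)"
  proof
    assume "dependent (d ` I)"
    then obtain u i where "i \<in> I" "u (d i) \<noteq> 0" "(\<Sum>i\<in>I. u (d i) *\<^sub>R d i) = 0"
      using dependent_finite[of "d ` I"] finite_I sum_d by auto
    then show False using D_sum[of i "\<lambda>i. u (d i)"] linear_0[OF linear_Dg] by simp
  qed
  then have dim_d: "dim (span (d ` I)) = card I"
    by (simp add: dim_eq_card_independent card_image[OF inj])
  have span_d: "span (d ` I) = range (\<lambda>c. \<Sum>i\<in>I. c i *\<^sub>R d i)"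
  proof
    show "span (d ` I) \<subseteq> range (\<lambda>c. \<Sum>i\<in>I. c i *\<^sub>R d i)"
      using finite_I by (auto simp: span_finite sum_d)
    show "range (\<lambda>c. \<Sum>i\<in>I. c i *\<^sub>R d i) \<subseteq> span (d ` I)"
      by (auto intro!: span_sum span_scale intro: span_base)
  qed
  have "kernel x \<inter> span (d ` I) = {0}"
  proof safe
    fix v assume "v \<in> kernel x" "v \<in> span (d ` I)"
    then obtain c where v: "v = (\<Sum>i\<in>I. c i *\<^sub>R d i)" "\<forall>i\<in>I. Dg i x v = 0"
      by (auto simp: span_d kernel_def)
    then have "c i = 0" if "i \<in> I" for i using D_sum[OF that, of c] that by simp
    then show "v = 0" by (simp add: v(1))
  qed (auto intro: subspace_0[OF subspace_kernel] span_0)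
  moreover have "{v + w |v w. v \<in> kernel x \<and> w \<in> span (d ` I)} = E"
  proof safe
    show "v + w \<in> E" if "v \<in> kernel x" "w \<in> span (d ` I)" for v w
      using that sum_E subspace_E by (auto simp: kernel_def span_d intro!: subspace_add)
    fix v assume v: "v \<in> E"
    let ?w = "\<Sum>i\<in>I. Dg i x v *\<^sub>R d i"
    have "v - ?w \<in> kernel x"
      using v D_sum[of _ "\<lambda>i. Dg i x v"] subspace_E sum_E
      by (auto simp: kernel_def linear_diff[OF linear_Dg] intro: subspace_diff)
    then show "\<exists>w w'. v = w + w' \<and> w \<in> kernel x \<and> w' \<in> span (d ` I)"
      by (intro exI[of _ "v - ?w"] exI[of _ ?w]) (auto simp: span_d)
  qed
  ultimately have "dim E = dim (kernel x) + card I"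
    using dim_sums_Int[OF subspace_kernel[of x] subspace_span[of "d ` I"]] dim_d by simp
  then show ?thesis by simp
qed

text \<open>The map \<open>\<phi> y = y + \<Sum>i. (g i y - Dg i x y) d i\<close> has derivative \<open>id\<close> at \<open>x\<close>. It moves points only
  inside \<open>E\<close>, and \<open>Dg j x (\<phi> y) = g j y\<close>; so it flattens the level set to the kernel of the
  differentials at \<open>x\<close>. Since \<open>D\<phi>\<close> remains invertible near \<open>x\<close>, all solutions of the equations near
  \<open>x\<close> are regular.\<close>

lemma chart:
  assumes x: "x \<in> M"
  obtains U W \<phi> \<psi> where "open U" "x \<in> U" "open W" "homeomorphism U W \<phi> \<psi>"
    "smooth_on \<phi> UNIV" "smooth_on \<psi> W" "\<phi> ` (M \<inter> U) = kernel x \<inter> W"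
    "(\<psi> has_derivative id) (at (\<phi> x))"
proof -
  obtain d where d: "\<And>i j. i \<in> I \<Longrightarrow> j \<in> I \<Longrightarrow> Dg j x (d i) = (if i = j then 1 else 0)"
    and sum_E: "\<And>c. (\<Sum>i\<in>I. c i *\<^sub>R d i) \<in> E"
    and D_sum: "\<And>c j. j \<in> I \<Longrightarrow> Dg j x (\<Sum>i\<in>I. c i *\<^sub>R d i) = c j"
    using dual_vectors[OF x] by blast
  define \<phi> where "\<phi> y = y + (\<Sum>i\<in>I. (g i y - Dg i x y) *\<^sub>R d i)" for y
  define D\<phi> where "D\<phi> y v = v + (\<Sum>i\<in>I. (Dg i y v - Dg i x v) *\<^sub>R d i)" for y v
  have bl: "bounded_linear (Dg i x)" if "i \<in> I" for i
    using linear_Dg[OF that] by (simp add: linear_linear)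
  have "(\<phi> has_derivative D\<phi> y) (at y)" for y
    unfolding \<phi>_def[abs_def] D\<phi>_def[abs_def]
    by (intro has_derivative_add has_derivative_ident has_derivative_sum has_derivative_diff
        has_derivative_scaleR_left has_derivative_g bounded_linear_imp_has_derivative bl)
  then have D: "frechet_derivative \<phi> (at y) = D\<phi> y" for y
    using frechet_derivative_at by metis
  have "C_on k \<phi> UNIV" for k
    unfolding \<phi>_def[abs_def] diff_conv_add_uminus
    by (intro C_on_add C_on_sum C_on_scaleR C_on_const open_UNIV smooth_g[unfolded smooth_on_def, rule_format]
        C_on_bounded_linear_id[OF bounded_linear_ident] C_on_bounded_linear_id[OF bounded_linear_minus[OF bl]])
  then have smooth: "smooth_on \<phi> UNIV" by (simp add: smooth_on_def)
  have id: "frechet_derivative \<phi> (at x) = id"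
    by (simp add: D D\<phi>_def fun_eq_iff)
  obtain U W \<psi> where *: "open U" "x \<in> U" "open W" "homeomorphism U W \<phi> \<psi>" "smooth_on \<psi> W"
    "\<And>y. y \<in> U \<Longrightarrow> bij (D\<phi> y)"
    "\<And>y. y \<in> W \<Longrightarrow> (\<psi> has_derivative inv (D\<phi> (\<psi> y))) (at y)"
    using smooth_inverse_function[OF smooth id] unfolding D by blast
  have \<phi>_E: "\<phi> y \<in> E \<longleftrightarrow> y \<in> E" for y
    using sum_E subspace_E by (simp add: \<phi>_def subspace_add_iff)
  have D\<phi>_E: "D\<phi> y v \<in> E \<longleftrightarrow> v \<in> E" for y v
    using sum_E subspace_E by (simp add: D\<phi>_def subspace_add_iff)
  have Dg_\<phi>: "Dg j x (\<phi> y) = g j y" if "j \<in> I" for j y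
    using D_sum[OF that, of "\<lambda>i. g i y - Dg i x y"] by (simp add: \<phi>_def linear_add[OF linear_Dg[OF that]])
  have Dg_D\<phi>: "Dg j x (D\<phi> y v) = Dg j y v" if "j \<in> I" for j y v
    using D_sum[OF that, of "\<lambda>i. Dg i y v - Dg i x v"] by (simp add: D\<phi>_def linear_add[OF linear_Dg[OF that]])
  have regular: "\<exists>v\<in>E. \<forall>i\<in>I. Dg i y v = c i" if "y \<in> U" for y c
  proof -
    define v where "v = inv (D\<phi> y) (\<Sum>i\<in>I. c i *\<^sub>R d i)"
    have v: "D\<phi> y v = (\<Sum>i\<in>I. c i *\<^sub>R d i)"
      unfolding v_def by (rule surj_f_inv_f[OF bij_is_surj[OF *(6)[OF that]]])
    have "v \<in> E" using D\<phi>_E[of y v] sum_E[of c] by (simp add: v)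
    moreover have "Dg i y v = c i" if "i \<in> I" for i
      using Dg_D\<phi>[OF that, of y v] D_sum[OF that, of c] by (simp add: v)
    ultimately show ?thesis by blast
  qed
  have M_U: "y \<in> M \<longleftrightarrow> \<phi> y \<in> kernel x" if "y \<in> U" for y
    using that \<phi>_E Dg_\<phi> regular by (auto simp: M_eq regular_level_set_def kernel_def)
  have img: "\<phi> ` U = W" using *(4) by (simp add: homeomorphism_def)
  have "\<phi> ` (M \<inter> U) = kernel x \<inter> W"
    unfolding img[symmetric] using M_U by blast
  moreover have "(\<psi> has_derivative id) (at (\<phi> x))"
  proof -
    have "\<psi> (\<phi> x) = x" "\<phi> x \<in> W" using *(2,4) by (auto simp: homeomorphism_def)
    moreover have "D\<phi> x = id" by (simp add: D\<phi>_def fun_eq_iff)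
    ultimately show ?thesis using *(7)[of "\<phi> x"] by (simp add: inv_id)
  qed
  ultimately show ?thesis using that[OF *(1-4) smooth *(5)] by blast
qed

lemma embedded_submanifold_M: "embedded_submanifold (dim E - card I) M"
  unfolding embedded_submanifold_def
proof
  fix x assume x: "x \<in> M"
  obtain U W \<phi> \<psi> where *: "open U" "x \<in> U" "open W" "homeomorphism U W \<phi> \<psi>"
    "smooth_on \<phi> UNIV" "smooth_on \<psi> W" "\<phi> ` (M \<inter> U) = kernel x \<inter> W"
    "(\<psi> has_derivative id) (at (\<phi> x))"
    by (rule chart[OF x])
  then show "\<exists>U W \<phi> \<psi>. \<exists>L::'v set. open U \<and> x \<in> U \<and> open W \<and> homeomorphism U W \<phi> \<psi> \<and>
       smooth_on \<phi> U \<and> smooth_on \<psi> W \<and> subspace L \<and> dim L = dim E - card I \<and> \<phi> ` (M \<inter> U) = L \<inter> W"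
    using subspace_kernel dim_kernel[OF x] smooth_on_subset[OF *(5) subset_UNIV]
    by (intro exI[of _ U] exI[of _ W] exI[of _ \<phi>] exI[of _ \<psi>] exI[of _ "kernel x"] conjI)
qed

text \<open>A curve in \<open>M\<close> satisfies the equations, so its velocity lies in the kernel. Conversely, the inverse
  of the chart maps straight lines in the kernel to curves in \<open>M\<close>.\<close>

lemma tangent_space_M:
  assumes x: "x \<in> M"
  shows "tangent_space M x = kernel x"
proof
  show "tangent_space M x \<subseteq> kernel x"
  proof
    fix v assume v: "v \<in> tangent_space M x"
    have "Dg i x v = 0" if "i \<in> I" for i
      using tangent_derivative_zero[OF v open_UNIV UNIV_I has_derivative_g[OF that]] that
      by (simp add: M_eq regular_level_set_def)
    moreover have "v \<in> E"
    proof (rule subspace_memI_orthogonal[OF subspace_E])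
      fix b assume "\<And>w. w \<in> E \<Longrightarrow> w \<bullet> b = 0"
      then show "v \<bullet> b = 0"
        by (intro tangent_derivative_zero[OF v open_UNIV UNIV_I, where h = "\<lambda>w. w \<bullet> b" and h' = "\<lambda>w. w \<bullet> b"]
            has_derivative_inner_left has_derivative_ident) (auto simp: M_eq regular_level_set_def)
    qed
    ultimately show "v \<in> kernel x" by (simp add: kernel_def)
  qed
  show "kernel x \<subseteq> tangent_space M x"
  proof
    fix v assume v: "v \<in> kernel x"
    obtain U W \<phi> \<psi> where *: "open U" "x \<in> U" "open W" "homeomorphism U W \<phi> \<psi>"
      "smooth_on \<phi> UNIV" "smooth_on \<psi> W" "\<phi> ` (M \<inter> U) = kernel x \<inter> W"
      "(\<psi> has_derivative id) (at (\<phi> x))"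
      by (rule chart[OF x])
    define line where "line t = \<phi> x + t *\<^sub>R v" for t :: real
    have line: "(line has_derivative (\<lambda>t. t *\<^sub>R v)) (at t)" for t
      unfolding line_def[abs_def] by (auto intro!: derivative_eq_intros)
    have "\<phi> x \<in> kernel x \<inter> W" unfolding *(7)[symmetric] using x *(2) by simp
    then have \<phi>x: "\<phi> x \<in> kernel x" "\<phi> x \<in> W" by simp_all
    have "open (line -` W)"
      by (rule open_vimage[OF \<open>open W\<close>]) (auto simp: line_def[abs_def] intro!: continuous_intros)
    moreover have "0 \<in> line -` W" using \<phi>x by (simp add: line_def)
    ultimately obtain e where e: "e > 0" "ball 0 e \<subseteq> line -` W" by (rule openE)
    have lineW: "line ` {-e<..<e} \<subseteq> W" using e(2) by (auto simp: ball_eq_greaterThanLessThan)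
    have "smooth_on (\<lambda>t. \<psi> (line t)) {-e<..<e}"
      unfolding smooth_on_def
    proof
      fix k
      have "C_on k line {-e<..<e}"
        unfolding line_def[abs_def]
        by (intro C_on_add C_on_const C_on_scaleR C_on_bounded_linear_id[OF bounded_linear_ident]) auto
      then show "C_on k (\<lambda>t. \<psi> (line t)) {-e<..<e}"
        by (rule C_on_compose[OF open_greaterThanLessThan *(3) lineW *(6)[unfolded smooth_on_def, rule_format]])
    qed
    moreover have "(\<lambda>t. \<psi> (line t)) ` {-e<..<e} \<subseteq> M"
    proof (rule image_subsetI)
      fix t assume "t \<in> {-e<..<e}"
      then have "line t \<in> W" using lineW by blast
      moreover have "line t \<in> kernel x"
        unfolding line_def by (intro subspace_add subspace_scale subspace_kernel v \<phi>x)
      ultimately have "line t \<in> kernel x \<inter> W" by simp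
      then obtain y where y: "y \<in> M" "y \<in> U" "line t = \<phi> y" unfolding *(7)[symmetric] by blast
      then show "\<psi> (line t) \<in> M" using homeomorphism_apply1[OF *(4) y(2)] by simp
    qed
    moreover have "\<psi> (line 0) = x" using homeomorphism_apply1[OF *(4,2)] by (simp add: line_def)
    moreover have "((\<lambda>t. \<psi> (line t)) has_vector_derivative v) (at 0)"
    proof -
      have "(\<psi> has_derivative id) (at (line 0))" using *(8) by (simp add: line_def)
      from has_derivative_compose[OF line this] show ?thesis by (simp add: has_vector_derivative_def)
    qed
    ultimately show "v \<in> tangent_space M x"
      using e(1) unfolding tangent_space_def
      by (intro CollectI exI[of _ "\<lambda>t. \<psi> (line t)"] exI[of _ e] conjI)
  qed
qed

text \<open>Differentiating \<open>Dg i (Y) = 0\<close> along \<open>X\<close> and \<open>Dg i (X) = 0\<close> along \<open>Y\<close> and subtracting, the second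
  derivatives of \<open>g i\<close> cancel by symmetry and \<open>Dg i [X, Y] = 0\<close> remains.\<close>

lemma lie_bracket_tangent:
  assumes X: "tangent_field M X" and Y: "tangent_field M Y" and x: "x \<in> M"
  shows "lie_bracket M X Y x \<in> tangent_space M x"
proof -
  obtain U X' where U: "open U" "x \<in> U" "smooth_on X' U" "\<And>y. y \<in> M \<inter> U \<Longrightarrow> X y = X' y"
    using smooth_along_local[OF _ x] X unfolding tangent_field_def by blast
  obtain V Y' where V: "open V" "x \<in> V" "smooth_on Y' V" "\<And>y. y \<in> M \<inter> V \<Longrightarrow> Y y = Y' y"
    using smooth_along_local[OF _ x] Y unfolding tangent_field_def by blast
  let ?DX = "frechet_derivative X' (at x)" and ?DY = "frechet_derivative Y' (at x)"
  have Xx: "X y \<in> kernel y" and Yx: "Y y \<in> kernel y" if "y \<in> M" for y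
    using X Y that tangent_space_M by (auto simp: tangent_field_def)
  have tan: "X x \<in> tangent_space M x" "Y x \<in> tangent_space M x"
    using X Y x by (auto simp: tangent_field_def)
  have "differential M Y x (X x) = ?DY (X x)"
    by (rule differential_eq[OF tan(1) V(1,2) smooth_on_has_derivative[OF V(3,2)]]) (rule V(4))
  moreover have "differential M X x (Y x) = ?DX (Y x)"
    by (rule differential_eq[OF tan(2) U(1,2) smooth_on_has_derivative[OF U(3,2)]]) (rule U(4))
  ultimately have lie: "lie_bracket M X Y x = ?DY (X x) - ?DX (Y x)"
    by (simp add: lie_bracket_def)
  have X': "X' y \<in> kernel y" if "y \<in> M \<inter> U" for y using Xx[of y] U(4)[OF that] that by simp
  have Y': "Y' y \<in> kernel y" if "y \<in> M \<inter> V" for y using Yx[of y] V(4)[OF that] that by simp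
  have eq_x: "X' x = X x" "Y' x = Y x" using U(2,4) V(2,4) x by simp_all
  have in_E: "frechet_derivative Z (at x) v \<in> E"
    if "open O'" "x \<in> O'" "smooth_on Z O'" "\<And>y. y \<in> M \<inter> O' \<Longrightarrow> Z y \<in> E" "v \<in> tangent_space M x"
    for Z O' v
  proof (rule subspace_memI_orthogonal[OF subspace_E])
    fix b assume b: "\<And>w. w \<in> E \<Longrightarrow> w \<bullet> b = 0"
    show "frechet_derivative Z (at x) v \<bullet> b = 0"
      by (intro tangent_derivative_zero[OF that(5,1,2), where h = "\<lambda>y. Z y \<bullet> b"
            and h' = "\<lambda>v. frechet_derivative Z (at x) v \<bullet> b"] b that(4)
          has_derivative_inner_left smooth_on_has_derivative[OF that(3,2)])
  qed
  \<comment> \<open>The derivative along \<open>v\<close> of the identity \<open>Dg i y (Z y) = 0\<close> on \<open>M\<close>.\<close>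
  have 2: "frechet_derivative (\<lambda>y. Dg i y (Z x)) (at x) v + Dg i x (frechet_derivative Z (at x) v) = 0"
    if "open O'" "x \<in> O'" "smooth_on Z O'" "\<And>y. y \<in> M \<inter> O' \<Longrightarrow> Z y \<in> kernel y"
      "v \<in> tangent_space M x" "i \<in> I"
    for Z O' v i
    by (rule tangent_derivative_zero[OF that(5,1,2) has_derivative_frechet_apply[OF open_UNIV UNIV_I
            smooth_g[OF that(6)] smooth_on_has_derivative[OF that(3,2)]]])
      (use that(4,6) in \<open>auto simp: kernel_def\<close>)
  have "Dg i x (?DY (X x) - ?DX (Y x)) = 0" if "i \<in> I" for i
    using 2[OF V(1-3) Y' tan(1) that] 2[OF U(1-3) X' tan(2) that]
      second_derivative_symmetric[OF open_UNIV UNIV_I smooth_g[OF that],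
        where x = x and u = "X x" and v = "Y x"]
    unfolding linear_diff[OF linear_Dg[OF that]] eq_x by linarith
  moreover have "?DY (X x) - ?DX (Y x) \<in> E"
    using in_E[OF V(1-3) _ tan(1)] in_E[OF U(1-3) _ tan(2)] X' Y'
    by (intro subspace_diff[OF subspace_E]) (simp_all add: kernel_def)
  ultimately show ?thesis
    unfolding lie tangent_space_M[OF x] by (simp add: kernel_def)
qed

end

section \<open>Submanifolds with a global normal frame\<close>

lemma orth_projI:
  assumes "subspace W" "p \<in> W" "\<And>w. w \<in> W \<Longrightarrow> (v - p) \<bullet> w = 0"
  shows "orth_proj W v = p"
  unfolding orth_proj_def
proof (rule the_equality)
  show "p \<in> W \<and> v - p \<in> orthogonal_comp W"
    using assms by (simp add: orthogonal_comp_def orthogonal_def inner_commute)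
  fix q assume q: "q \<in> W \<and> v - q \<in> orthogonal_comp W"
  have "q - p \<in> W" using q assms by (simp add: subspace_diff)
  moreover have "(v - q) \<bullet> w = 0" if "w \<in> W" for w
    using q that by (simp add: orthogonal_comp_def orthogonal_def inner_commute)
  ultimately have "(q - p) \<bullet> (q - p) = 0"
    using assms(3)[of "q - p"] by (simp add: inner_diff_left)
  then show "q = p" by simp
qed

lemma orth_proj_decomp:
  fixes W :: "'v::euclidean_space set"
  assumes "subspace W"
  shows "orth_proj W v \<in> W" and "w \<in> W \<Longrightarrow> orth_proj W v \<bullet> w = v \<bullet> w"
proof -
  obtain y z where yz: "y \<in> span W" "\<And>w. w \<in> span W \<Longrightarrow> orthogonal z w" "v = y + z"
    using orthogonal_subspace_decomp_exists[of W v] by blast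
  have W: "span W = W" using assms by (simp add: span_eq_iff)
  have "orth_proj W v = y"
    by (rule orth_projI[OF assms]) (use yz W in \<open>simp_all add: orthogonal_def\<close>)
  then show "orth_proj W v \<in> W" "w \<in> W \<Longrightarrow> orth_proj W v \<bullet> w = v \<bullet> w"
    using yz W by (simp_all add: orthogonal_def inner_add_left)
qed

lemma linear_orth_proj:
  assumes "subspace W"
  shows "linear (orth_proj W)"
proof (rule linearI)
  fix u v :: 'a and r :: real
  show "orth_proj W (u + v) = orth_proj W u + orth_proj W v"
    by (rule orth_projI[OF assms])
      (simp_all add: assms subspace_add orth_proj_decomp inner_diff_left inner_add_left)
  show "orth_proj W (r *\<^sub>R u) = r *\<^sub>R orth_proj W u"
    by (rule orth_projI[OF assms])
      (simp_all add: assms subspace_scale orth_proj_decomp inner_diff_left)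
qed

lemma orth_proj_nested:
  assumes "subspace T" "subspace S" "T \<subseteq> S"
  shows "orth_proj T (orth_proj S v) = orth_proj T v"
  by (rule orth_projI[OF assms(1)])
    (use assms in \<open>auto simp: orth_proj_decomp inner_diff_left\<close>)

lemma orth_proj_eq_0:
  assumes "subspace W" "\<And>w. w \<in> W \<Longrightarrow> v \<bullet> w = 0"
  shows "orth_proj W v = 0"
  by (rule orth_projI[OF assms(1)]) (simp_all add: assms subspace_0)

lemma orth_proj_id: "subspace W \<Longrightarrow> v \<in> W \<Longrightarrow> orth_proj W v = v"
  by (rule orth_projI) simp_all

lemma orthonormal_expansion:
  assumes "finite K" "\<And>j k. j \<in> K \<Longrightarrow> k \<in> K \<Longrightarrow> e j \<bullet> e k = (if j = k then 1 else 0)"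
  shows "orth_proj (span (e ` K)) w = (\<Sum>k\<in>K. (w \<bullet> e k) *\<^sub>R e k)"
proof (rule orth_projI[OF subspace_span])
  show "(\<Sum>k\<in>K. (w \<bullet> e k) *\<^sub>R e k) \<in> span (e ` K)"
    by (intro span_sum span_scale span_base imageI)
  fix u assume "u \<in> span (e ` K)"
  then show "(w - (\<Sum>k\<in>K. (w \<bullet> e k) *\<^sub>R e k)) \<bullet> u = 0"
  proof (induction rule: span_induct)
    case base
    show ?case by (auto simp: subspace_def inner_add_right)
  next
    case (step u)
    then obtain j where j: "j \<in> K" "u = e j" by blast
    have "(\<Sum>k\<in>K. (w \<bullet> e k) * (e k \<bullet> e j)) = (\<Sum>k\<in>K. if k = j then w \<bullet> e j else 0)"
      by (rule sum.cong) (auto simp: assms(2) j)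
    then show ?case using assms(1) j by (simp add: inner_diff_left inner_sum_left)
  qed
qed

text \<open>Orthonormal frames make the orthogonal projections to the spaces \<open>span {\<xi> k y}\<close> explicit, and
  thereby differentiable in \<open>y\<close>. The covariant derivative of a normal
  field involves these projections, and it has to be differentiated once more in the curvature.\<close>

lemma gram_schmidt_frame:
  fixes \<xi> :: "'k \<Rightarrow> 'a::real_normed_vector \<Rightarrow> 'v::euclidean_space"
  assumes "finite K" "\<And>k. k \<in> K \<Longrightarrow> \<xi> k differentiable (at x)"
    and "\<And>c. \<exists>v. \<forall>k\<in>K. \<xi> k x \<bullet> v = c k"
  shows "\<exists>e. (\<forall>k\<in>K. e k differentiable (at x)) \<and>
    (\<forall>\<^sub>F y in nhds x. (\<forall>j\<in>K. \<forall>k\<in>K. e j y \<bullet> e k y = (if j = k then 1 else 0)) \<and>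
        span ((\<lambda>k. e k y) ` K) = span ((\<lambda>k. \<xi> k y) ` K))"
  using assms
proof (induction K)
  case empty
  show ?case by simp
next
  case (insert i K)
  have "\<exists>v. \<forall>k\<in>K. \<xi> k x \<bullet> v = c k" for c using insert.prems(2)[of c] by auto
  then have "\<exists>e. (\<forall>k\<in>K. e k differentiable (at x)) \<and>
      (\<forall>\<^sub>F y in nhds x. (\<forall>j\<in>K. \<forall>k\<in>K. e j y \<bullet> e k y = (if j = k then 1 else 0)) \<and>
        span ((\<lambda>k. e k y) ` K) = span ((\<lambda>k. \<xi> k y) ` K))"
    by (intro insert.IH insert.prems(1) insertI2)
  then obtain e where e_ball: "\<forall>k\<in>K. e k differentiable (at x)"
    and ev: "\<forall>\<^sub>F y in nhds x. (\<forall>j\<in>K. \<forall>k\<in>K. e j y \<bullet> e k y = (if j = k then 1 else 0)) \<and>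
        span ((\<lambda>k. e k y) ` K) = span ((\<lambda>k. \<xi> k y) ` K)"
    by (elim exE conjE)
  have e: "e k differentiable (at x)" if "k \<in> K" for k using e_ball that by simp
  define w where "w y = \<xi> i y - (\<Sum>k\<in>K. (\<xi> i y \<bullet> e k y) *\<^sub>R e k y)" for y
  have diff_w: "w differentiable (at x)"
    unfolding w_def[abs_def]
    by (intro differentiable_diff differentiable_sum differentiable_scaleR differentiable_inner
        insert.hyps(1) insert.prems(1) insertI1 e ballI)
  have w_proj: "w y = \<xi> i y - orth_proj (span ((\<lambda>k. e k y) ` K)) (\<xi> i y)"
    if "\<And>j k. j \<in> K \<Longrightarrow> k \<in> K \<Longrightarrow> e j y \<bullet> e k y = (if j = k then 1 else 0)" for y
    unfolding w_def by (subst orthonormal_expansion[OF insert.hyps(1) that]) simp_all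
  \<comment> \<open>A vector dual to \<open>\<xi> i x\<close> is orthogonal to the span of the others.\<close>
  have "w x \<noteq> 0"
  proof
    assume "w x = 0"
    with w_proj[of x] eventually_nhds_x_imp_x[OF ev]
    have in_span: "\<xi> i x \<in> span ((\<lambda>k. \<xi> k x) ` K)"
      using orth_proj_decomp(1)[OF subspace_span[of "(\<lambda>k. e k x) ` K"], of "\<xi> i x"] by simp
    obtain v where v: "\<forall>k\<in>insert i K. \<xi> k x \<bullet> v = (if k = i then 1 else 0)"
      using insert.prems(2)[of "\<lambda>k. if k = i then 1 else 0"] by blast
    have "u \<bullet> v = 0" if "u \<in> span ((\<lambda>k. \<xi> k x) ` K)" for u
      using that by (induction rule: span_induct)
        (use v insert.hyps(2) in \<open>auto simp: subspace_def inner_add_left\<close>)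
    with in_span v show False by fastforce
  qed
  then have ev_w: "\<forall>\<^sub>F y in nhds x. w y \<noteq> 0"
    using differentiable_imp_continuous_within[OF diff_w]
    by (auto simp: eventually_nhds_conv_at isCont_def intro: tendsto_imp_eventually_ne)
  define e' where "e' = e(i := (\<lambda>y. w y /\<^sub>R norm (w y)))"
  have e'_K: "e' k = e k" if "k \<in> K" for k using that insert.hyps(2) by (auto simp: e'_def)
  show ?case
  proof (intro exI[of _ e'] conjI ballI)
    fix k assume "k \<in> insert i K"
    moreover have "(\<lambda>y. w y /\<^sub>R norm (w y)) differentiable (at x)"
    proof -
      have "(\<lambda>y. norm (w y)) differentiable (at x)"
        using differentiable_chain_at[OF diff_w differentiable_norm_at[OF \<open>w x \<noteq> 0\<close>]] by (simp add: o_def)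
      then have "(\<lambda>y. inverse (norm (w y))) differentiable (at x)"
        using \<open>w x \<noteq> 0\<close> by (intro differentiable_inverse) auto
      then show ?thesis by (intro differentiable_scaleR diff_w)
    qed
    ultimately show "e' k differentiable (at x)" using e e'_K by (auto simp: e'_def)
  next
    show "\<forall>\<^sub>F y in nhds x. (\<forall>j\<in>insert i K. \<forall>k\<in>insert i K. e' j y \<bullet> e' k y = (if j = k then 1 else 0)) \<and>
        span ((\<lambda>k. e' k y) ` insert i K) = span ((\<lambda>k. \<xi> k y) ` insert i K)"
      using ev ev_w
    proof eventually_elim
      case (elim y)
      let ?S = "span ((\<lambda>k. e k y) ` K)"
      have S: "?S = span ((\<lambda>k. \<xi> k y) ` K)" using elim by simp
      have w: "w y = \<xi> i y - orth_proj ?S (\<xi> i y)" using elim by (intro w_proj) simp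
      have w_orth: "w y \<bullet> u = 0" if "u \<in> ?S" for u
        using orth_proj_decomp(2)[OF subspace_span that] by (simp add: w inner_diff_left)
      have w_e: "w y \<bullet> e k y = 0" "e k y \<bullet> w y = 0" if "k \<in> K" for k
        using w_orth[of "e k y"] that by (auto simp: inner_commute intro: span_base)
      have ii: "e' i y = w y /\<^sub>R norm (w y)" by (simp add: e'_def)
      have "w y \<bullet> w y / (norm (w y) * norm (w y)) = 1"
        using elim(2) by (simp add: dot_square_norm power2_eq_square)
      then have 1: "\<forall>j\<in>insert i K. \<forall>k\<in>insert i K. e' j y \<bullet> e' k y = (if j = k then 1 else 0)"
        using elim insert.hyps(2) w_e by (auto simp: ii e'_K field_simps)
      have img: "(\<lambda>k. e' k y) ` K = (\<lambda>k. e k y) ` K"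
        by (simp add: e'_K)
      have proj: "orth_proj ?S (\<xi> i y) \<in> ?S" by (simp add: orth_proj_decomp(1))
      have sub1: "?S \<subseteq> span (insert (w y /\<^sub>R norm (w y)) ((\<lambda>k. e k y) ` K))" by (intro span_mono) auto
      have sub2: "?S \<subseteq> span (insert (\<xi> i y) ((\<lambda>k. \<xi> k y) ` K))" unfolding S by (intro span_mono) auto
      have "w y = norm (w y) *\<^sub>R (w y /\<^sub>R norm (w y))" using elim(2) by simp
      then have "w y \<in> span (insert (w y /\<^sub>R norm (w y)) ((\<lambda>k. e k y) ` K))"
        by (metis insertI1 span_base span_scale)
      then have "w y + orth_proj ?S (\<xi> i y) \<in> span (insert (w y /\<^sub>R norm (w y)) ((\<lambda>k. e k y) ` K))"
        using proj sub1 by (intro span_add) auto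
      then have 2: "\<xi> i y \<in> span (insert (w y /\<^sub>R norm (w y)) ((\<lambda>k. e k y) ` K))" by (simp add: w)
      have "\<xi> i y - orth_proj ?S (\<xi> i y) \<in> span (insert (\<xi> i y) ((\<lambda>k. \<xi> k y) ` K))"
        using proj sub2 by (intro span_diff) (auto intro: span_base)
      then have 3: "w y /\<^sub>R norm (w y) \<in> span (insert (\<xi> i y) ((\<lambda>k. \<xi> k y) ` K))"
        by (intro span_scale) (simp add: w)
      have "(\<lambda>k. \<xi> k y) ` K \<subseteq> ?S" unfolding S by (rule span_superset)
      moreover have "(\<lambda>k. e k y) ` K \<subseteq> ?S" by (rule span_superset)
      ultimately have "span (insert (w y /\<^sub>R norm (w y)) ((\<lambda>k. e k y) ` K)) = span (insert (\<xi> i y) ((\<lambda>k. \<xi> k y) ` K))"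
        unfolding span_eq using 2 3 sub1 sub2 by auto
      then show ?case using 1 by (simp only: image_insert ii img)
    qed
  qed
qed

text \<open>A submanifold \<open>M\<close> of \<open>N\<close> whose normal bundle is spanned by the restrictions of globally defined
  smooth maps \<open>\<xi> k\<close>. The shape operators and the normal curvature can then be expressed by the
  derivatives of these maps alone. Independence is stated by prescribing inner products, the form in
  which regularity of level sets supplies it.\<close>

locale framed_submanifold =
  fixes N M :: "'v::euclidean_space set" and K :: "'k set" and \<xi> :: "'k \<Rightarrow> 'v \<Rightarrow> 'v"
  assumes finite_K: "finite K"
    and smooth_frame: "\<And>k. k \<in> K \<Longrightarrow> smooth_on (\<xi> k) UNIV"
    and subspace_TN: "\<And>x. x \<in> M \<Longrightarrow> subspace (tangent_space N x)"
    and subspace_TM: "\<And>x. x \<in> M \<Longrightarrow> subspace (tangent_space M x)"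
    and TM_subset: "\<And>x. x \<in> M \<Longrightarrow> tangent_space M x \<subseteq> tangent_space N x"
    and normal_eq: "\<And>x. x \<in> M \<Longrightarrow> normal_space N M x = span ((\<lambda>k. \<xi> k x) ` K)"
    and independent: "\<And>x c. x \<in> M \<Longrightarrow> \<exists>v. \<forall>k\<in>K. \<xi> k x \<bullet> v = c k"
    and bracket: "\<And>X Y x. tangent_field M X \<Longrightarrow> tangent_field M Y \<Longrightarrow> x \<in> M \<Longrightarrow>
       lie_bracket M X Y x \<in> tangent_space M x"
begin

abbreviation D\<xi> :: "'k \<Rightarrow> 'v \<Rightarrow> 'v \<Rightarrow> 'v" where "D\<xi> k x \<equiv> frechet_derivative (\<xi> k) (at x)"

lemma D\<xi>: "k \<in> K \<Longrightarrow> (\<xi> k has_derivative D\<xi> k x) (at x)"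
  using smooth_on_has_derivative[OF smooth_frame] by simp

lemma subspace_normal: "x \<in> M \<Longrightarrow> subspace (normal_space N M x)"
  by (simp add: normal_eq)

lemma normal_subset: "normal_space N M x \<subseteq> tangent_space N x"
  by (simp add: normal_space_def)

lemma normal_tangent_orth: "u \<in> normal_space N M x \<Longrightarrow> v \<in> tangent_space M x \<Longrightarrow> u \<bullet> v = 0"
  by (auto simp: normal_space_def orthogonal_comp_def orthogonal_def inner_commute)

lemma frame_in_normal: "x \<in> M \<Longrightarrow> k \<in> K \<Longrightarrow> \<xi> k x \<in> normal_space N M x"
  by (simp add: normal_eq span_base)

lemma local_frame:
  assumes "x \<in> M"
  obtains e U where "\<And>k. k \<in> K \<Longrightarrow> e k differentiable (at x)" "open U" "x \<in> U"
    "\<And>y w. y \<in> M \<inter> U \<Longrightarrow> orth_proj (normal_space N M y) w = (\<Sum>k\<in>K. (w \<bullet> e k y) *\<^sub>R e k y)"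
proof -
  have "\<exists>e. (\<forall>k\<in>K. e k differentiable (at x)) \<and>
      (\<forall>\<^sub>F y in nhds x. (\<forall>j\<in>K. \<forall>k\<in>K. e j y \<bullet> e k y = (if j = k then 1 else 0)) \<and>
        span ((\<lambda>k. e k y) ` K) = span ((\<lambda>k. \<xi> k y) ` K))"
  proof (rule gram_schmidt_frame[OF finite_K])
    show "\<xi> k differentiable (at x)" if "k \<in> K" for k by (rule differentiableI[OF D\<xi>[OF that]])
    show "\<exists>v. \<forall>k\<in>K. \<xi> k x \<bullet> v = c k" for c by (rule independent[OF assms])
  qed
  then obtain e where e: "\<forall>k\<in>K. e k differentiable (at x)"
    "\<forall>\<^sub>F y in nhds x. (\<forall>j\<in>K. \<forall>k\<in>K. e j y \<bullet> e k y = (if j = k then 1 else 0)) \<and>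
        span ((\<lambda>k. e k y) ` K) = span ((\<lambda>k. \<xi> k y) ` K)"
    by (elim exE conjE)
  obtain U where U: "open U" "x \<in> U"
    "\<forall>y\<in>U. (\<forall>j\<in>K. \<forall>k\<in>K. e j y \<bullet> e k y = (if j = k then 1 else 0)) \<and>
        span ((\<lambda>k. e k y) ` K) = span ((\<lambda>k. \<xi> k y) ` K)"
    using e(2) unfolding eventually_nhds by (elim exE conjE)
  show ?thesis
  proof (rule that[OF _ U(1,2)])
    show "e k differentiable (at x)" if "k \<in> K" for k using e(1) that by simp
    fix y w assume y: "y \<in> M \<inter> U"
    have *: "normal_space N M y = span ((\<lambda>k. e k y) ` K)" using U(3) y by (simp add: normal_eq)
    show "orth_proj (normal_space N M y) w = (\<Sum>k\<in>K. (w \<bullet> e k y) *\<^sub>R e k y)"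
      unfolding * by (rule orthonormal_expansion[OF finite_K]) (use U(3) y in simp)
  qed
qed

text \<open>The derivative at a zero of a normal field is normal: the field equals its projection to the normal
  spaces, and at a zero the derivative of the projection does not contribute.\<close>

lemma normal_field_vanishing:
  assumes x: "x \<in> M" and v: "v \<in> tangent_space M x" and U: "open U" "x \<in> U"
    and \<eta>: "(\<eta> has_derivative \<eta>') (at x)" and nor: "\<And>y. y \<in> M \<inter> U \<Longrightarrow> \<eta> y \<in> normal_space N M y"
    and zero: "\<eta> x = 0"
  shows "\<eta>' v \<in> normal_space N M x"
proof -
  obtain e V where V: "\<And>k. k \<in> K \<Longrightarrow> e k differentiable (at x)" "open V" "x \<in> V"
    "\<And>y w. y \<in> M \<inter> V \<Longrightarrow> orth_proj (normal_space N M y) w = (\<Sum>k\<in>K. (w \<bullet> e k y) *\<^sub>R e k y)"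
    using local_frame[OF x] by blast
  define e' where "e' k = frechet_derivative (e k) (at x)" for k
  have e': "(e k has_derivative e' k) (at x)" if "k \<in> K" for k
    unfolding e'_def using V(1)[OF that] by (simp flip: frechet_derivative_works)
  let ?h' = "\<lambda>v. \<eta>' v - (\<Sum>k\<in>K. (\<eta> x \<bullet> e k x) *\<^sub>R e' k v + (\<eta> x \<bullet> e' k v + \<eta>' v \<bullet> e k x) *\<^sub>R e k x)"
  have "?h' v = 0"
  proof (rule tangent_derivative_zero[OF v, of "U \<inter> V"])
    show "((\<lambda>y. \<eta> y - (\<Sum>k\<in>K. (\<eta> y \<bullet> e k y) *\<^sub>R e k y)) has_derivative ?h') (at x)"
      by (intro has_derivative_diff has_derivative_sum has_derivative_scaleR has_derivative_inner \<eta> e')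
    show "\<eta> y - (\<Sum>k\<in>K. (\<eta> y \<bullet> e k y) *\<^sub>R e k y) = 0" if "y \<in> M \<inter> (U \<inter> V)" for y
    proof -
      have "orth_proj (normal_space N M y) (\<eta> y) = \<eta> y"
        using that by (intro orth_proj_id subspace_normal nor) auto
      then show ?thesis using V(4)[of y "\<eta> y"] that by simp
    qed
  qed (use U V in auto)
  then have "\<eta>' v = (\<Sum>k\<in>K. (\<eta>' v \<bullet> e k x) *\<^sub>R e k x)" by (simp add: zero)
  also have "\<dots> = orth_proj (normal_space N M x) (\<eta>' v)" using V(4)[of x] V(3) x by simp
  also have "\<dots> \<in> normal_space N M x" by (rule orth_proj_decomp(1)[OF subspace_normal[OF x]])
  finally show ?thesis .
qed

text \<open>Up to normal vectors, the derivative of a normal field depends only on its value at the point. This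
  makes the shape operator independent of the extension and the normal curvature tensorial.\<close>

lemma derivative_normal_field:
  assumes x: "x \<in> M" and v: "v \<in> tangent_space M x" and U: "open U" "x \<in> U"
    and Z: "(Z has_derivative Z') (at x)" and nor: "\<And>y. y \<in> M \<inter> U \<Longrightarrow> Z y \<in> normal_space N M y"
    and Zx: "Z x = (\<Sum>k\<in>K. c k *\<^sub>R \<xi> k x)"
  shows "Z' v - (\<Sum>k\<in>K. c k *\<^sub>R D\<xi> k x v) \<in> normal_space N M x"
proof (rule normal_field_vanishing[OF x v U, where \<eta> = "\<lambda>y. Z y - (\<Sum>k\<in>K. c k *\<^sub>R \<xi> k y)"
      and \<eta>' = "\<lambda>v. Z' v - (\<Sum>k\<in>K. c k *\<^sub>R D\<xi> k x v)"])
  show "((\<lambda>y. Z y - (\<Sum>k\<in>K. c k *\<^sub>R \<xi> k y)) has_derivative (\<lambda>v. Z' v - (\<Sum>k\<in>K. c k *\<^sub>R D\<xi> k x v))) (at x)"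
    by (intro has_derivative_diff has_derivative_sum has_derivative_scaleR_right Z D\<xi>)
  show "Z y - (\<Sum>k\<in>K. c k *\<^sub>R \<xi> k y) \<in> normal_space N M y" if "y \<in> M \<inter> U" for y
    using that by (intro subspace_diff subspace_sum subspace_scale subspace_normal nor frame_in_normal) auto
qed (simp add: Zx)

lemma normal_field_local:
  assumes \<zeta>: "normal_field N M \<zeta>" and x: "x \<in> M"
  obtains U Z where "open U" "x \<in> U" "smooth_on Z U" "\<And>y. y \<in> M \<inter> U \<Longrightarrow> \<zeta> y = Z y"
    "\<And>y. y \<in> M \<inter> U \<Longrightarrow> Z y \<in> normal_space N M y"
proof -
  obtain U Z where *: "open U" "x \<in> U" "smooth_on Z U" "\<And>y. y \<in> M \<inter> U \<Longrightarrow> \<zeta> y = Z y"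
    using smooth_along_local[OF _ x] \<zeta> unfolding normal_field_def by blast
  have "Z y \<in> normal_space N M y" if "y \<in> M \<inter> U" for y
  proof -
    have "\<zeta> y \<in> normal_space N M y" using \<zeta> that unfolding normal_field_def by simp
    then show ?thesis using *(4)[OF that] by simp
  qed
  with * show ?thesis by (rule that)
qed

lemma normal_space_coeffs:
  assumes "x \<in> M" "u \<in> normal_space N M x"
  obtains c where "u = (\<Sum>k\<in>K. c k *\<^sub>R \<xi> k x)"
proof -
  have inj: "inj_on (\<lambda>k. \<xi> k x) K"
  proof (rule inj_onI, rule ccontr)
    fix j k assume jk: "j \<in> K" "k \<in> K" "\<xi> j x = \<xi> k x" "j \<noteq> k"
    obtain v where "\<forall>i\<in>K. \<xi> i x \<bullet> v = (if i = j then 1 else 0)"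
      using independent[OF assms(1), of "\<lambda>i. if i = j then 1 else 0"] by (elim exE)
    from bspec[OF this jk(1)] bspec[OF this jk(2)] show False using jk(3,4) by simp
  qed
  have "u \<in> range (\<lambda>c. \<Sum>v\<in>(\<lambda>k. \<xi> k x) ` K. c v *\<^sub>R v)"
    using assms(2) finite_K by (simp add: normal_eq[OF assms(1)] span_finite)
  then show ?thesis using that by (auto simp: sum.reindex[OF inj])
qed

theorem shape_operator_eq:
  assumes x: "x \<in> M" and v: "v \<in> tangent_space M x"
  shows "shape_operator N M x (\<Sum>k\<in>K. c k *\<^sub>R \<xi> k x) v
     = - orth_proj (tangent_space M x) (\<Sum>k\<in>K. c k *\<^sub>R D\<xi> k x v)"
proof -
  let ?\<xi> = "\<Sum>k\<in>K. c k *\<^sub>R \<xi> k x" and ?T = "tangent_space M x"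
  define \<zeta> where "\<zeta> = (SOME \<zeta>. normal_field N M \<zeta> \<and> \<zeta> x = ?\<xi>)"
  have "normal_field N M (\<lambda>y. \<Sum>k\<in>K. c k *\<^sub>R \<xi> k y)"
    unfolding normal_field_def smooth_along_def
  proof (intro conjI ballI exI)
    show "smooth_on (\<lambda>y. \<Sum>k\<in>K. c k *\<^sub>R \<xi> k y) UNIV"
      unfolding smooth_on_def
      by (intro allI C_on_sum C_on_scaleR C_on_const open_UNIV smooth_frame[unfolded smooth_on_def, rule_format])
    show "(\<Sum>k\<in>K. c k *\<^sub>R \<xi> k y) \<in> normal_space N M y" if "y \<in> M" for y
      using that by (intro subspace_sum subspace_scale subspace_normal frame_in_normal) auto
  qed simp_all
  then have "normal_field N M \<zeta> \<and> \<zeta> x = ?\<xi>"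
    unfolding \<zeta>_def by (intro someI[of "\<lambda>\<zeta>. normal_field N M \<zeta> \<and> \<zeta> x = ?\<xi>"]) simp
  then have \<zeta>: "normal_field N M \<zeta>" "\<zeta> x = ?\<xi>" by simp_all
  obtain U Z where Z: "open U" "x \<in> U" "smooth_on Z U" "\<And>y. y \<in> M \<inter> U \<Longrightarrow> \<zeta> y = Z y"
    "\<And>y. y \<in> M \<inter> U \<Longrightarrow> Z y \<in> normal_space N M y"
    using normal_field_local[OF \<zeta>(1) x] by blast
  note DZ = smooth_on_has_derivative[OF Z(3,2)]
  let ?DZ = "frechet_derivative Z (at x)" and ?s = "\<Sum>k\<in>K. c k *\<^sub>R D\<xi> k x v"
  have "differential M \<zeta> x v = ?DZ v"
    by (rule differential_eq[OF v Z(1,2) DZ]) (rule Z(4))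
  then have "shape_operator N M x ?\<xi> v = - orth_proj ?T (?DZ v)"
    unfolding shape_operator_def Let_def levi_civita_def \<zeta>_def[symmetric]
    by (simp add: orth_proj_nested[OF subspace_TM[OF x] subspace_TN[OF x] TM_subset[OF x]])
  moreover have "?DZ v - ?s \<in> normal_space N M x"
    by (rule derivative_normal_field[OF x v Z(1,2) DZ Z(5)]) (use Z(2,4) x \<zeta>(2) in simp_all)
  then have "orth_proj ?T (?DZ v - ?s) = 0"
    using normal_tangent_orth by (intro orth_proj_eq_0 subspace_TM x)
  then have "orth_proj ?T (?DZ v) = orth_proj ?T ?s"
    by (simp add: linear_diff[OF linear_orth_proj[OF subspace_TM[OF x]]])
  ultimately show ?thesis by simp
qed

lemma normal_connection_eq:
  assumes "x \<in> M"
  shows "normal_connection N M X \<zeta> x = orth_proj (normal_space N M x) (differential M \<zeta> x (X x))"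
  unfolding normal_connection_def levi_civita_def
  by (rule orth_proj_nested[OF subspace_normal[OF assms] subspace_TN[OF assms] normal_subset])

text \<open>Both sides of \<open>\<nabla>\<^sub>Y \<zeta> \<bullet> \<xi> l = D\<zeta> (Y) \<bullet> \<xi> l\<close>, which holds on \<open>M\<close> because \<open>\<xi> l\<close> is normal, are
  differentiated in the direction \<open>v\<close>. The left side is differentiable because of the local
  orthonormal frame.\<close>

lemma derivative_normal_connection:
  assumes x: "x \<in> M" and v: "v \<in> tangent_space M x" and l: "l \<in> K"
    and Y: "tangent_field M Y"
    and Z: "open U" "x \<in> U" "smooth_on Z U" "\<And>y. y \<in> M \<inter> U \<Longrightarrow> \<zeta> y = Z y"
    and Y': "open V" "x \<in> V" "(Y' has_derivative DY) (at x)" "\<And>y. y \<in> M \<inter> V \<Longrightarrow> Y y = Y' y"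
  shows "differential M (normal_connection N M Y \<zeta>) x v \<bullet> \<xi> l x
    = (frechet_derivative (\<lambda>y. frechet_derivative Z (at y) (Y x)) (at x) v
        + frechet_derivative Z (at x) (DY v)) \<bullet> \<xi> l x
      + (frechet_derivative Z (at x) (Y x) - normal_connection N M Y \<zeta> x) \<bullet> D\<xi> l x v"
proof -
  obtain e W where W: "\<And>k. k \<in> K \<Longrightarrow> e k differentiable (at x)" "open W" "x \<in> W"
    "\<And>y w. y \<in> M \<inter> W \<Longrightarrow> orth_proj (normal_space N M y) w = (\<Sum>k\<in>K. (w \<bullet> e k y) *\<^sub>R e k y)"
    using local_frame[OF x] by blast
  define e' where "e' k = frechet_derivative (e k) (at x)" for k
  have e': "(e k has_derivative e' k) (at x)" if "k \<in> K" for k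
    unfolding e'_def using W(1)[OF that] by (simp flip: frechet_derivative_works)
  define z where "z y = frechet_derivative Z (at y) (Y' y)" for y
  define z' where "z' v = frechet_derivative (\<lambda>y. frechet_derivative Z (at y) (Y' x)) (at x) v
        + frechet_derivative Z (at x) (DY v)" for v
  have z: "(z has_derivative z') (at x)"
    unfolding z_def[abs_def] z'_def[abs_def] by (rule has_derivative_frechet_apply[OF Z(1-3) Y'(3)])
  have Yx: "Y' x = Y x" using Y'(4)[of x] x Y'(2) by simp
  have diff: "differential M \<zeta> y (Y y) = z y" if "y \<in> M \<inter> (U \<inter> V)" for y
  proof -
    have "differential M \<zeta> y (Y y) = frechet_derivative Z (at y) (Y y)"
      by (rule differential_eq[OF _ Z(1) _ smooth_on_has_derivative[OF Z(3)]])
        (use that Y Z(4) in \<open>simp_all add: tangent_field_def\<close>)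
    then show ?thesis using Y'(4)[of y] that by (simp add: z_def)
  qed
  define h where "h y = (\<Sum>k\<in>K. (z y \<bullet> e k y) *\<^sub>R e k y)" for y
  define h' where "h' v = (\<Sum>k\<in>K. (z x \<bullet> e k x) *\<^sub>R e' k v + (z x \<bullet> e' k v + z' v \<bullet> e k x) *\<^sub>R e k x)" for v
  have h: "(h has_derivative h') (at x)"
    unfolding h_def[abs_def] h'_def[abs_def]
    by (intro has_derivative_sum has_derivative_scaleR has_derivative_inner z e')
  let ?O = "U \<inter> V \<inter> W"
  have O: "open ?O" "x \<in> ?O" using Z Y' W by auto
  have nabla: "normal_connection N M Y \<zeta> y = h y" if "y \<in> M \<inter> ?O" for y
    using that by (simp add: normal_connection_eq diff W(4) h_def)
  have h_proj: "h y = orth_proj (normal_space N M y) (z y)" if "y \<in> M \<inter> ?O" for y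
    using that by (simp add: W(4) h_def)
  have 1: "differential M (normal_connection N M Y \<zeta>) x v = h' v"
    by (rule differential_eq[OF v O h nabla])
  have "(h x \<bullet> D\<xi> l x v + h' v \<bullet> \<xi> l x) - (z x \<bullet> D\<xi> l x v + z' v \<bullet> \<xi> l x) = 0"
  proof (rule tangent_derivative_zero[OF v O, where h = "\<lambda>y. h y \<bullet> \<xi> l y - z y \<bullet> \<xi> l y"])
    show "((\<lambda>y. h y \<bullet> \<xi> l y - z y \<bullet> \<xi> l y) has_derivative
      (\<lambda>v. (h x \<bullet> D\<xi> l x v + h' v \<bullet> \<xi> l x) - (z x \<bullet> D\<xi> l x v + z' v \<bullet> \<xi> l x))) (at x)"
      by (intro has_derivative_diff has_derivative_inner h z D\<xi> l)
    show "h y \<bullet> \<xi> l y - z y \<bullet> \<xi> l y = 0" if y: "y \<in> M \<inter> ?O" for y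
      using h_proj[OF y] orth_proj_decomp(2)[OF subspace_normal frame_in_normal[OF _ l]] y by simp
  qed
  then have "h' v \<bullet> \<xi> l x = z' v \<bullet> \<xi> l x + (z x - h x) \<bullet> D\<xi> l x v"
    by (simp add: inner_diff_left)
  moreover have "h x = normal_connection N M Y \<zeta> x" using nabla[of x] x O by simp
  ultimately show ?thesis by (simp add: 1 z_def z'_def Yx)
qed

text \<open>This is the Ricci equation. In the commutator of the derivatives of \<open>\<nabla>\<^sub>Y \<zeta>\<close> and \<open>\<nabla>\<^sub>X \<zeta>\<close>, tested
  against \<open>\<xi> l\<close>, the second derivatives of \<open>\<zeta>\<close> cancel by symmetry and the first derivatives cancel
  against the Lie bracket term. What remains pairs the non-normal part of \<open>D\<zeta>\<close> with \<open>D\<xi> l\<close>, and the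
  non-normal part of \<open>D\<zeta>\<close> is a combination of those of the \<open>D\<xi> k\<close>.\<close>

theorem flat_normal_bundleI:
  assumes sym: "\<And>x k l u w. x \<in> M \<Longrightarrow> k \<in> K \<Longrightarrow> l \<in> K \<Longrightarrow>
      u \<in> tangent_space M x \<Longrightarrow> w \<in> tangent_space M x \<Longrightarrow>
      (D\<xi> k x u - orth_proj (normal_space N M x) (D\<xi> k x u)) \<bullet> D\<xi> l x w
      = (D\<xi> k x w - orth_proj (normal_space N M x) (D\<xi> k x w)) \<bullet> D\<xi> l x u"
  shows "flat_normal_bundle M N"
  unfolding flat_normal_bundle_def
proof (intro allI impI ballI)
  fix X Y \<zeta> x
  assume X: "tangent_field M X" and Y: "tangent_field M Y" and \<zeta>: "normal_field N M \<zeta>" and x: "x \<in> M"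
  let ?R = "normal_curvature N M X Y \<zeta> x" and ?P = "orth_proj (normal_space N M x)"
  obtain U Z where Z: "open U" "x \<in> U" "smooth_on Z U" "\<And>y. y \<in> M \<inter> U \<Longrightarrow> \<zeta> y = Z y"
    "\<And>y. y \<in> M \<inter> U \<Longrightarrow> Z y \<in> normal_space N M y"
    using normal_field_local[OF \<zeta> x] by blast
  obtain V X' where X': "open V" "x \<in> V" "smooth_on X' V" "\<And>y. y \<in> M \<inter> V \<Longrightarrow> X y = X' y"
    using smooth_along_local[OF _ x] X unfolding tangent_field_def by blast
  obtain W Y' where Y': "open W" "x \<in> W" "smooth_on Y' W" "\<And>y. y \<in> M \<inter> W \<Longrightarrow> Y y = Y' y"
    using smooth_along_local[OF _ x] Y unfolding tangent_field_def by blast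
  note DX' = smooth_on_has_derivative[OF X'(3,2)] and DY' = smooth_on_has_derivative[OF Y'(3,2)]
    and DZ' = smooth_on_has_derivative[OF Z(3,2)]
  let ?DX = "frechet_derivative X' (at x)" and ?DY = "frechet_derivative Y' (at x)"
    and ?DZ = "frechet_derivative Z (at x)"
  have tan: "X x \<in> tangent_space M x" "Y x \<in> tangent_space M x"
    using X Y x by (auto simp: tangent_field_def)
  have dZ: "differential M \<zeta> x v = ?DZ v" if "v \<in> tangent_space M x" for v
    by (rule differential_eq[OF that Z(1,2) DZ']) (rule Z(4))
  have "differential M Y x (X x) = ?DY (X x)"
    by (rule differential_eq[OF tan(1) Y'(1,2) DY']) (rule Y'(4))
  moreover have "differential M X x (Y x) = ?DX (Y x)"
    by (rule differential_eq[OF tan(2) X'(1,2) DX']) (rule X'(4))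
  ultimately have lie: "lie_bracket M X Y x = ?DY (X x) - ?DX (Y x)"
    by (simp add: lie_bracket_def)
  have nX: "normal_connection N M X \<zeta> x = ?P (?DZ (X x))"
    and nY: "normal_connection N M Y \<zeta> x = ?P (?DZ (Y x))"
    and nL: "normal_connection N M (lie_bracket M X Y) \<zeta> x = ?P (?DZ (lie_bracket M X Y x))"
    using dZ[OF tan(1)] dZ[OF tan(2)] dZ[OF bracket[OF X Y x]] by (simp_all add: normal_connection_eq[OF x])
  have Zx: "Z x \<in> normal_space N M x" using Z(5)[of x] Z(2) x by simp
  obtain c where c: "Z x = (\<Sum>k\<in>K. c k *\<^sub>R \<xi> k x)" by (rule normal_space_coeffs[OF x Zx])
  have linP: "linear ?P" by (rule linear_orth_proj[OF subspace_normal[OF x]])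
  \<comment> \<open>\<open>\<zeta>\<close> may be replaced by the combination of the frame with constant coefficients \<open>c\<close>.\<close>
  have res: "?DZ v - ?P (?DZ v) = (\<Sum>k\<in>K. c k *\<^sub>R (D\<xi> k x v - ?P (D\<xi> k x v)))"
    if "v \<in> tangent_space M x" for v
  proof -
    let ?s = "\<Sum>k\<in>K. c k *\<^sub>R D\<xi> k x v"
    have "?DZ v - ?s \<in> normal_space N M x"
      by (rule derivative_normal_field[OF x that Z(1,2) DZ' Z(5) c])
    then have "?P (?DZ v - ?s) = ?DZ v - ?s" by (rule orth_proj_id[OF subspace_normal[OF x]])
    then have "?DZ v - ?P (?DZ v) = ?s - ?P ?s"
      by (simp add: linear_diff[OF linP] algebra_simps)
    then show ?thesis
      by (simp add: linear_sum[OF linP] linear_scale[OF linP] scaleR_diff_right sum_subtractf)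
  qed
  have "?R \<bullet> \<xi> l x = 0" if l: "l \<in> K" for l
  proof -
    note P = orth_proj_decomp(2)[OF subspace_normal[OF x] frame_in_normal[OF x l]]
    have linDZ: "linear ?DZ" using DZ' by (rule has_derivative_linear)
    have "?R \<bullet> \<xi> l x = differential M (normal_connection N M Y \<zeta>) x (X x) \<bullet> \<xi> l x
       - differential M (normal_connection N M X \<zeta>) x (Y x) \<bullet> \<xi> l x
       - ?DZ (?DY (X x) - ?DX (Y x)) \<bullet> \<xi> l x"
      unfolding normal_curvature_def nL unfolding normal_connection_eq[OF x] lie
      by (simp add: inner_diff_left P)
    moreover have "differential M (normal_connection N M Y \<zeta>) x (X x) \<bullet> \<xi> l x
        = (frechet_derivative (\<lambda>y. frechet_derivative Z (at y) (Y x)) (at x) (X x) + ?DZ (?DY (X x))) \<bullet> \<xi> l x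
          + (?DZ (Y x) - ?P (?DZ (Y x))) \<bullet> D\<xi> l x (X x)"
      unfolding nY[symmetric]
      by (rule derivative_normal_connection[OF x tan(1) l Y Z(1-3) _ Y'(1,2) DY'], rule Z(4), assumption,
          rule Y'(4), assumption)
    moreover have "differential M (normal_connection N M X \<zeta>) x (Y x) \<bullet> \<xi> l x
        = (frechet_derivative (\<lambda>y. frechet_derivative Z (at y) (X x)) (at x) (Y x) + ?DZ (?DX (Y x))) \<bullet> \<xi> l x
          + (?DZ (X x) - ?P (?DZ (X x))) \<bullet> D\<xi> l x (Y x)"
      unfolding nX[symmetric]
      by (rule derivative_normal_connection[OF x tan(2) l X Z(1-3) _ X'(1,2) DX'], rule Z(4), assumption,
          rule X'(4), assumption)
    moreover have "frechet_derivative (\<lambda>y. frechet_derivative Z (at y) (X x)) (at x) (Y x)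
        = frechet_derivative (\<lambda>y. frechet_derivative Z (at y) (Y x)) (at x) (X x)"
      by (rule second_derivative_symmetric[OF Z(1-3)])
    ultimately have "?R \<bullet> \<xi> l x = (?DZ (Y x) - ?P (?DZ (Y x))) \<bullet> D\<xi> l x (X x)
       - (?DZ (X x) - ?P (?DZ (X x))) \<bullet> D\<xi> l x (Y x)"
      by (simp add: linear_diff[OF linDZ] inner_diff_left inner_add_left)
    also have "\<dots> = 0"
      unfolding res[OF tan(1)] res[OF tan(2)] inner_sum_left
      using sym[OF x _ l tan] by simp
    finally show ?thesis .
  qed
  note R_\<xi> = this
  \<comment> \<open>A normal vector orthogonal to the frame is orthogonal to itself.\<close>
  have "?R \<in> normal_space N M x"
    unfolding normal_curvature_def normal_connection_eq[OF x]
    by (intro subspace_diff subspace_normal x orth_proj_decomp(1))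
  then obtain d where "?R = (\<Sum>k\<in>K. d k *\<^sub>R \<xi> k x)" by (rule normal_space_coeffs[OF x])
  then have "?R \<bullet> ?R = ?R \<bullet> (\<Sum>k\<in>K. d k *\<^sub>R \<xi> k x)" by (rule arg_cong)
  also have "\<dots> = 0" by (simp add: inner_sum_right R_\<xi>)
  finally show "?R = 0" by simp
qed

end

section \<open>Self-adjoint operators and symmetric spectra\<close>

text \<open>A maximum \<open>v\<close> of the quadratic form on the unit sphere of \<open>T\<close>, with value \<open>\<mu>\<close>, is a zero of the
  nonnegative form \<open>\<mu> |w|\<^sup>2 - F w \<bullet> w\<close>. The first variation of the latter vanishes there, which says
  that \<open>\<mu> v - F v\<close> is orthogonal to \<open>T\<close>.\<close>

lemma self_adjoint_eigenvector:
  fixes T :: "'v::euclidean_space set"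
  assumes T: "subspace T" "T \<noteq> {0}" and F: "linear F" "\<And>v. v \<in> T \<Longrightarrow> F v \<in> T"
    and sym: "\<And>v w. v \<in> T \<Longrightarrow> w \<in> T \<Longrightarrow> F v \<bullet> w = v \<bullet> F w"
  obtains v \<mu> where "v \<in> T" "norm v = 1" "F v = \<mu> *\<^sub>R v"
proof -
  let ?S = "T \<inter> sphere 0 1"
  obtain u where u: "u \<in> T" "u \<noteq> 0" using T subspace_0 by blast
  then have "u /\<^sub>R norm u \<in> ?S" using T(1) by (simp add: subspace_scale)
  then have ne: "?S \<noteq> {}" by blast
  have "compact ?S"
    using closed_subspace[OF T(1)] by (simp add: closed_Int_compact)
  moreover have "continuous_on ?S (\<lambda>v. F v \<bullet> v)"
    using F(1) by (intro continuous_intros linear_continuous_on) (simp add: linear_linear)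
  ultimately have "\<exists>v\<in>?S. \<forall>w\<in>?S. F w \<bullet> w \<le> F v \<bullet> v"
    by (intro continuous_attains_sup[OF _ ne])
  then obtain v where v: "v \<in> ?S" "\<And>w. w \<in> ?S \<Longrightarrow> F w \<bullet> w \<le> F v \<bullet> v"
    by blast
  define \<mu> where "\<mu> = F v \<bullet> v"
  define q where "q w = \<mu> * (w \<bullet> w) - F w \<bullet> w" for w
  have vT: "v \<in> T" "norm v = 1" using v(1) by simp_all
  have q_nonneg: "q w \<ge> 0" if "w \<in> T" for w
  proof (cases "w = 0")
    case False
    have "w /\<^sub>R norm w \<in> ?S" using that False T(1) by (simp add: subspace_scale)
    from v(2)[OF this] have "(F w \<bullet> w) / (norm w * norm w) \<le> \<mu>"
      by (simp add: linear_scale[OF F(1)] \<mu>_def divide_inverse mult_ac)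
    then show ?thesis using False by (simp add: q_def field_simps dot_square_norm power2_eq_square)
  qed (simp add: q_def)
  have "(\<mu> *\<^sub>R v - F v) \<bullet> w = 0" if w: "w \<in> T" for w
  proof -
    let ?b = "(\<mu> *\<^sub>R v - F v) \<bullet> w"
    \<comment> \<open>Twice this number is the derivative at 0 of the nonnegative polynomial \<open>t \<mapsto> q (v + t w)\<close>.\<close>
    have q: "q (v + t *\<^sub>R w) = 2 * t * ?b + t\<^sup>2 * q w" for t
    proof -
      have "v \<bullet> v = 1" using vT(2) by (simp add: dot_square_norm)
      moreover have "F w \<bullet> v = F v \<bullet> w" using sym[OF w vT(1)] by (simp add: inner_commute)
      ultimately show ?thesis
        by (simp add: q_def linear_add[OF F(1)] linear_scale[OF F(1)] inner_add_left inner_add_right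
            inner_diff_left \<mu>_def[symmetric] inner_commute[of w v] algebra_simps power2_eq_square)
    qed
    have inT: "v + t *\<^sub>R w \<in> T" for t using vT(1) w T(1) by (simp add: subspace_add subspace_scale)
    have nonneg: "2 * t * ?b + t\<^sup>2 * q w \<ge> 0" for t
      unfolding q[symmetric] by (rule q_nonneg[OF inT])
    show ?thesis
    proof (rule ccontr)
      assume b: "?b \<noteq> 0"
      \<comment> \<open>Any small positive multiple of \<open>- ?b\<close> would do; the shift by 1 keeps the denominator positive.\<close>
      define t where "t = - ?b / (q w + 1)"
      have pos: "q w + 1 > 0" using q_nonneg[OF w] by simp
      have "2 * (- B / c) * B + (- B / c)\<^sup>2 * (c - 1) = - (B\<^sup>2 * (c + 1)) / c\<^sup>2" if "c \<noteq> 0" for B c :: real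
        using that by (simp add: divide_simps power2_eq_square) (simp add: algebra_simps)
      from this[of "q w + 1" ?b] pos
      have "2 * t * ?b + t\<^sup>2 * q w = - (?b\<^sup>2 * (q w + 2)) / (q w + 1)\<^sup>2"
        by (simp add: t_def)
      also have "0 < ?b\<^sup>2 * (q w + 2)" using b pos by (intro mult_pos_pos) auto
      then have "- (?b\<^sup>2 * (q w + 2)) / (q w + 1)\<^sup>2 < 0" using pos by (intro divide_neg_pos) auto
      finally show False using nonneg[of t] by simp
    qed
  qed
  moreover have "\<mu> *\<^sub>R v - F v \<in> T"
    using vT(1) F(2) T(1) by (simp add: subspace_diff subspace_scale)
  ultimately have "(\<mu> *\<^sub>R v - F v) \<bullet> (\<mu> *\<^sub>R v - F v) = 0" by blast
  then show ?thesis using that[OF vT, of \<mu>] by simp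
qed

lemma dim_orthogonal_to_vector:
  fixes S :: "'v::euclidean_space set"
  assumes "subspace S" "v \<in> S" "v \<noteq> 0"
  shows "dim S = Suc (dim {u \<in> S. u \<bullet> v = 0})"
proof -
  have "{y \<in> S. \<forall>x \<in> span {v}. orthogonal x y} = {u \<in> S. u \<bullet> v = 0}"
    by (auto simp: span_singleton orthogonal_def inner_commute dest: spec[of _ 1])
  moreover have "dim (span {v}) = 1" using assms(3) by (simp add: dim_span dim_insert)
  moreover have "span {v} \<subseteq> S" using assms by (simp add: span_minimal)
  ultimately show ?thesis
    using dim_subspace_orthogonal_to_vectors[OF subspace_span assms(1), of "{v}"] by simp
qed

text \<open>Induction on the dimension: splitting off a unit eigenvector with eigenvalue \<open>\<mu>\<close> lowers the
  dimension of \<open>T\<close> and of the eigenspace of \<open>\<mu>\<close> by one and leaves the other eigenspaces alone, as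
  they are orthogonal to the eigenvector.\<close>

lemma self_adjoint_has_eigenvalues:
  fixes T :: "'v::euclidean_space set"
  assumes "subspace T" "linear F" "\<And>v. v \<in> T \<Longrightarrow> F v \<in> T"
    and "\<And>v w. v \<in> T \<Longrightarrow> w \<in> T \<Longrightarrow> F v \<bullet> w = v \<bullet> F w"
  shows "\<exists>\<Omega>. has_eigenvalues T F \<Omega>"
  using assms
proof (induction "dim T" arbitrary: T)
  case 0
  then have "T = {0}" using subspace_0 by (metis dim_eq_0 subset_singletonD empty_iff)
  moreover have "{v. v = 0 \<and> F v = c *\<^sub>R v} = {0}" for c using linear_0[OF \<open>linear F\<close>] by auto
  ultimately show ?case by (intro exI[of _ "{#}"]) (simp add: has_eigenvalues_def)
next
  case (Suc d T)
  note F = \<open>linear F\<close> and sub = \<open>subspace T\<close>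
  have "T \<noteq> {0}" using Suc.hyps(2) by auto
  then obtain v \<mu> where v: "v \<in> T" "norm v = 1" "F v = \<mu> *\<^sub>R v"
    by (rule self_adjoint_eigenvector[OF sub _ F]) (use Suc.prems in auto)
  have v0: "v \<noteq> 0" using v(2) by auto
  define T' where "T' = {u \<in> T. u \<bullet> v = 0}"
  have sub': "subspace T'"
    using sub unfolding T'_def subspace_def by (auto simp: inner_add_left)
  have dim': "dim T = Suc (dim T')" unfolding T'_def by (rule dim_orthogonal_to_vector[OF sub v(1) v0])
  have Fv: "F u \<bullet> v = \<mu> * (u \<bullet> v)" if "u \<in> T" for u
    using Suc.prems(4)[OF that v(1)] v(3) by simp
  have "\<exists>\<Omega>. has_eigenvalues T' F \<Omega>"
  proof (rule Suc.hyps(1)[OF _ sub' F])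
    show "d = dim T'" using Suc.hyps(2) dim' by simp
    show "F u \<in> T'" if "u \<in> T'" for u using that Suc.prems(3) Fv by (auto simp: T'_def)
    show "F u \<bullet> w = u \<bullet> F w" if "u \<in> T'" "w \<in> T'" for u w
      using that Suc.prems(4) by (auto simp: T'_def)
  qed
  then obtain \<Omega> where \<Omega>: "has_eigenvalues T' F \<Omega>" by blast
  have "dim {u \<in> T. F u = c *\<^sub>R u} = (if c = \<mu> then 1 else 0) + dim {u \<in> T'. F u = c *\<^sub>R u}" for c
  proof (cases "c = \<mu>")
    case True
    have "subspace {u \<in> T. F u = c *\<^sub>R u}"
      using sub unfolding subspace_def
      by (auto simp: linear_0[OF F] linear_add[OF F] linear_scale[OF F] scaleR_add_right)
    moreover have "{u \<in> {u \<in> T. F u = c *\<^sub>R u}. u \<bullet> v = 0} = {u \<in> T'. F u = c *\<^sub>R u}"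
      by (auto simp: T'_def)
    ultimately show ?thesis
      using dim_orthogonal_to_vector[of "{u \<in> T. F u = c *\<^sub>R u}" v] v v0 True by simp
  next
    case False
    have "u \<bullet> v = 0" if "u \<in> T" "F u = c *\<^sub>R u" for u
      using Fv[OF that(1)] that(2) False by simp
    then have "{u \<in> T. F u = c *\<^sub>R u} = {u \<in> T'. F u = c *\<^sub>R u}" by (auto simp: T'_def)
    then show ?thesis using False by simp
  qed
  then have "has_eigenvalues T F (add_mset \<mu> \<Omega>)"
    using \<Omega> dim' by (simp add: has_eigenvalues_def)
  then show ?case by blast
qed

lemma symmetric_multiset_decomp:
  fixes \<Omega> :: "real multiset"
  assumes "\<And>c. count \<Omega> (- c) = count \<Omega> c"
  shows "\<exists>\<Lambda> z. \<Omega> = \<Lambda> + image_mset uminus \<Lambda> + replicate_mset z 0"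
proof (intro exI multiset_eqI)
  let ?\<Lambda> = "filter_mset (\<lambda>c. c > 0) \<Omega>"
  fix c :: real
  have "uminus -` {c} = {- c}" by auto
  then have "count (image_mset uminus ?\<Lambda>) c = count ?\<Lambda> (- c)"
    by (auto simp: count_image_mset Int_insert_left not_in_iff)
  then have "count (image_mset uminus ?\<Lambda>) c = (if c < 0 then count \<Omega> c else 0)"
    using assms[of c] by simp
  then show "count \<Omega> c = count (?\<Lambda> + image_mset uminus ?\<Lambda> + replicate_mset (count \<Omega> 0) 0) c"
    by auto
qed

text \<open>An injective map that anticommutes with \<open>F\<close> embeds the eigenspace of \<open>c\<close> into the one of \<open>- c\<close>.
  Applied to \<open>c\<close> and to \<open>- c\<close>, this shows that both have the same dimension.\<close>

lemma anticommuting_symmetric_eigenvalues: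
  fixes T :: "'v::euclidean_space set"
  assumes T: "subspace T" and F: "linear F" "\<And>v. v \<in> T \<Longrightarrow> F v \<in> T"
    and sym: "\<And>v w. v \<in> T \<Longrightarrow> w \<in> T \<Longrightarrow> F v \<bullet> w = v \<bullet> F w"
    and \<tau>: "linear \<tau>" "inj \<tau>" "\<And>v. v \<in> T \<Longrightarrow> \<tau> v \<in> T"
    and anti: "\<And>v. v \<in> T \<Longrightarrow> F (\<tau> v) = - \<tau> (F v)"
  shows "\<exists>\<Lambda> z. has_eigenvalues T F (\<Lambda> + image_mset uminus \<Lambda> + replicate_mset z 0)"
proof -
  obtain \<Omega> where \<Omega>: "has_eigenvalues T F \<Omega>"
    using self_adjoint_has_eigenvalues[OF T F sym] by blast
  let ?E = "\<lambda>c. {v \<in> T. F v = c *\<^sub>R v}"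
  have le: "dim (?E c) \<le> dim (?E (- c))" for c
  proof -
    have "\<tau> ` ?E c \<subseteq> ?E (- c)"
      using \<tau>(3) anti by (auto simp: linear_scale[OF \<tau>(1)])
    then have "dim (\<tau> ` ?E c) \<le> dim (?E (- c))" by (rule dim_subset)
    moreover have "dim (\<tau> ` ?E c) = dim (?E c)"
      by (rule dim_image_eq[OF \<tau>(1)]) (rule inj_on_subset[OF \<tau>(2) subset_UNIV])
    ultimately show ?thesis by simp
  qed
  have "count \<Omega> (- c) = count \<Omega> c" for c
    using le[of c] le[of "- c"] \<Omega> by (simp add: has_eigenvalues_def)
  from symmetric_multiset_decomp[OF this] obtain \<Lambda> z
    where "\<Omega> = \<Lambda> + image_mset uminus \<Lambda> + replicate_mset z 0" by blast
  then show ?thesis using \<Omega> by blast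
qed

text \<open>Newton's identities as a logarithmic derivative: with \<open>P = \<Prod>i. (1 - a i X)\<close>, the power sums of \<open>a\<close>
  are the coefficients of \<open>- P' / P\<close>.\<close>

lemma fps_deriv_prod_linear:
  fixes a :: "'i \<Rightarrow> real"
  assumes "finite I"
  shows "fps_deriv (\<Prod>i\<in>I. 1 - fps_const (a i) * fps_X)
     = - ((\<Prod>i\<in>I. 1 - fps_const (a i) * fps_X) * Abs_fps (\<lambda>k. \<Sum>i\<in>I. a i ^ Suc k))"
  using assms
proof (induction I)
  case empty
  have "Abs_fps (\<lambda>k. 0 :: real) = 0" by (rule fps_ext) simp
  then show ?case by simp
next
  case (insert j I)
  let ?P = "\<Prod>i\<in>I. 1 - fps_const (a i) * fps_X" and ?S = "Abs_fps (\<lambda>k. \<Sum>i\<in>I. a i ^ Suc k)"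
  have split: "Abs_fps (\<lambda>k. \<Sum>i\<in>insert j I. a i ^ Suc k) = Abs_fps (\<lambda>k. a j ^ Suc k) + ?S"
    using insert.hyps by (intro fps_ext) simp
  have geo: "(1 - fps_const (a j) * fps_X) * Abs_fps (\<lambda>k. a j ^ Suc k) = fps_const (a j)"
  proof (rule fps_ext)
    fix n
    show "fps_nth ((1 - fps_const (a j) * fps_X) * Abs_fps (\<lambda>k. a j ^ Suc k)) n = fps_nth (fps_const (a j)) n"
      by (cases n) (simp_all add: left_diff_distrib mult.assoc)
  qed
  have "fps_deriv (\<Prod>i\<in>insert j I. 1 - fps_const (a i) * fps_X)
     = (1 - fps_const (a j) * fps_X) * fps_deriv ?P - fps_const (a j) * ?P"
    using insert.hyps by (simp flip: fps_const_neg)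
  also have "\<dots> = - ((1 - fps_const (a j) * fps_X) * ?P * ?S)
      - ((1 - fps_const (a j) * fps_X) * Abs_fps (\<lambda>k. a j ^ Suc k)) * ?P"
    by (simp only: insert.IH geo) (simp add: algebra_simps)
  also have "\<dots> = - ((\<Prod>i\<in>insert j I. 1 - fps_const (a i) * fps_X) * (Abs_fps (\<lambda>k. a j ^ Suc k) + ?S))"
    using insert.hyps by (simp add: algebra_simps)
  finally show ?case unfolding split .
qed

text \<open>By Newton's identities, the power sums up to the number of entries determine the coefficients of
  \<open>\<Prod>i. (1 - a i X)\<close> recursively. The reversed polynomial \<open>\<Prod>i. (X - a i)\<close> then agrees at all nonzero
  points, and its roots are the entries, zero included.\<close>

lemma power_sums_determine_multiset:
  fixes a b :: "'i \<Rightarrow> real"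
  assumes I: "finite I" and eq: "\<And>k. 1 \<le> k \<Longrightarrow> k \<le> card I \<Longrightarrow> (\<Sum>i\<in>I. a i ^ k) = (\<Sum>i\<in>I. b i ^ k)"
  shows "image_mset a (mset_set I) = image_mset b (mset_set I)"
proof -
  define P where "P a = (\<Prod>i\<in>I. [:1, - a i:])" for a :: "'i \<Rightarrow> real"
  define S where "S a k = (\<Sum>i\<in>I. a i ^ Suc k)" for a :: "'i \<Rightarrow> real" and k
  have fps_P: "fps_of_poly (P a) = (\<Prod>i\<in>I. 1 - fps_const (a i) * fps_X)" for a
    by (simp add: P_def fps_of_poly_prod fps_of_poly_linear' flip: fps_const_neg)
  have rec: "of_nat (Suc n) * coeff (P a) (Suc n) = - (\<Sum>i=0..n. coeff (P a) i * S a (n - i))" for a n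
  proof -
    have "fps_nth (fps_deriv (fps_of_poly (P a))) n = fps_nth (- (fps_of_poly (P a) * Abs_fps (S a))) n"
      unfolding fps_P fps_deriv_prod_linear[OF I] by (simp add: S_def[abs_def])
    then show ?thesis by (simp add: fps_mult_nth)
  qed
  have "coeff (P a) n = coeff (P b) n" if "n \<le> card I" for n
    using that
  proof (induction n rule: less_induct)
    case (less n)
    show ?case
    proof (cases n)
      case 0
      have "coeff (P a) 0 = 1" for a by (simp add: P_def coeff_0_prod_list poly_prod flip: poly_0_coeff_0)
      then show ?thesis using 0 by simp
    next
      case (Suc m)
      have "(\<Sum>i=0..m. coeff (P a) i * S a (m - i)) = (\<Sum>i=0..m. coeff (P b) i * S b (m - i))"
      proof (rule sum.cong[OF refl])
        fix i assume "i \<in> {0..m}"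
        then have "coeff (P a) i = coeff (P b) i" "S a (m - i) = S b (m - i)"
          using less Suc by (auto simp: S_def intro!: eq simp del: power_Suc)
        then show "coeff (P a) i * S a (m - i) = coeff (P b) i * S b (m - i)" by simp
      qed
      then have "of_nat (Suc m) * coeff (P a) (Suc m) = of_nat (Suc m) * coeff (P b) (Suc m)"
        unfolding rec by simp
      then show ?thesis using Suc by simp
    qed
  qed
  moreover have "coeff (P a) n = 0" if "n > card I" for a n
  proof (rule coeff_eq_0)
    have "degree (P a) \<le> (\<Sum>i\<in>I. degree [:1, - a i:])"
      unfolding P_def using degree_prod_sum_le[OF I, of "\<lambda>i. [:1, - a i:]"] by (simp add: o_def)
    also have "\<dots> \<le> (\<Sum>i\<in>I. 1)" by (rule sum_mono) simp
    finally show "degree (P a) < n" using that by simp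
  qed
  ultimately have P: "P a = P b" by (intro poly_eqI) (metis not_le)
  define Q where "Q a = (\<Prod>i\<in>I. [:- a i, 1:])" for a :: "'i \<Rightarrow> real"
  have Q: "poly (Q a) x = x ^ card I * poly (P a) (1 / x)" if "x \<noteq> 0" for a x
    using that by (simp add: Q_def P_def poly_prod divide_simps flip: prod_constant prod.distrib)
  have "poly (Q a - Q b) x = 0" if "x \<in> UNIV - {0}" for x using Q[of x] P that by simp
  then have "UNIV - {0} \<subseteq> {x. poly (Q a - Q b) x = 0}" by blast
  then have "infinite {x. poly (Q a - Q b) x = 0}"
    using infinite_UNIV_char_0[where 'a = real] by (metis finite_subset finite_Diff2 finite.emptyI finite_insert)
  then have "Q a = Q b" using poly_roots_finite[of "Q a - Q b"] by fastforce
  moreover have "proots (Q a) = image_mset a (mset_set I)" for a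
  proof -
    have "proots (Q a) = (\<Sum>i\<in>I. {#a i#})" unfolding Q_def by (subst proots_prod) simp_all
    also have "\<dots> = image_mset a (mset_set I)" using I by (induction I) simp_all
    finally show ?thesis .
  qed
  ultimately show ?thesis by metis
qed

text \<open>The families \<open>a\<close> and \<open>- a\<close> have the same even power sums, and by assumption the same odd ones.\<close>

lemma odd_power_sums_vanish_symmetric:
  fixes a :: "'i \<Rightarrow> real"
  assumes I: "finite I" and odd: "\<And>k. 2 * k + 1 \<le> card I \<Longrightarrow> (\<Sum>i\<in>I. a i ^ (2 * k + 1)) = 0"
  obtains \<pi> where "\<pi> permutes I" "\<And>i. i \<in> I \<Longrightarrow> a (\<pi> i) = - a i"
proof -
  have "image_mset (\<lambda>i. - a i) (mset_set I) = image_mset a (mset_set I)"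
  proof (rule power_sums_determine_multiset[OF I])
    fix k assume k: "k \<le> card I"
    show "(\<Sum>i\<in>I. (- a i) ^ k) = (\<Sum>i\<in>I. a i ^ k)"
    proof (cases "even k")
      case False
      then obtain l where "k = 2 * l + 1" by (rule oddE)
      then show ?thesis using odd[of l] k by (simp add: sum_negf)
    qed simp
  qed
  then obtain \<pi> where "\<pi> permutes I" "\<forall>i\<in>I. - a i = a (\<pi> i)"
    by (rule image_mset_eq_implies_permutes[OF I])
  then show ?thesis using that by simp
qed

text \<open>The permutation exchanges positive and negative entries, so each positive square uses up two indices
  and the square 0, if it occurs, one more.\<close>

lemma card_squares_le:
  fixes a :: "'i \<Rightarrow> real"
  assumes I: "finite I" and \<pi>: "\<pi> permutes I" "\<And>i. i \<in> I \<Longrightarrow> a (\<pi> i) = - a i"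
  shows "card ((\<lambda>i. (a i)\<^sup>2) ` I) \<le> (card I - 1) div 2 + 1"
proof -
  let ?P = "{i \<in> I. a i > 0}" and ?N = "{i \<in> I. a i < 0}" and ?Z = "{i \<in> I. a i = 0}"
  have "I = ?P \<union> ?N \<union> ?Z" by auto
  then have "card I = card (?P \<union> ?N \<union> ?Z)" by simp
  also have "\<dots> = card ?P + card ?N + card ?Z"
    using I by (subst card_Un_disjoint; auto)+
  finally have I_eq: "card I = card ?P + card ?N + card ?Z" .
  have "\<pi> ` ?P \<subseteq> ?N" using \<pi> by (auto simp: permutes_in_image)
  then have "card (\<pi> ` ?P) \<le> card ?N" using I by (intro card_mono) auto
  then have PN: "card ?P \<le> card ?N"
    using card_image[OF inj_on_subset[OF permutes_inj[OF \<pi>(1)] subset_UNIV], of ?P] by simp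
  have "\<pi> ` ?N \<subseteq> ?P" using \<pi> by (auto simp: permutes_in_image)
  then have "card (\<pi> ` ?N) \<le> card ?P" using I by (intro card_mono) auto
  then have NP: "card ?N \<le> card ?P"
    using card_image[OF inj_on_subset[OF permutes_inj[OF \<pi>(1)] subset_UNIV], of ?N] by simp
  have sub: "(\<lambda>i. (a i)\<^sup>2) ` I \<subseteq> (\<lambda>i. (a i)\<^sup>2) ` ?P \<union> (\<lambda>i. (a i)\<^sup>2) ` ?Z"
  proof (rule image_subsetI)
    fix i assume i: "i \<in> I"
    consider "a i > 0" | "a i = 0" | "a i < 0" by linarith
    then show "(a i)\<^sup>2 \<in> (\<lambda>i. (a i)\<^sup>2) ` ?P \<union> (\<lambda>i. (a i)\<^sup>2) ` ?Z"
    proof cases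
      case 3
      then have "\<pi> i \<in> ?P" using i \<pi> by (simp add: permutes_in_image)
      moreover have "(a i)\<^sup>2 = (a (\<pi> i))\<^sup>2" using i \<pi> by simp
      ultimately show ?thesis by blast
    qed (use i in auto)
  qed
  have "card ((\<lambda>i. (a i)\<^sup>2) ` ?Z) \<le> (if ?Z = {} then 0 else 1)"
  proof (cases "?Z = {}")
    case False
    have "(\<lambda>i. (a i)\<^sup>2) ` ?Z \<subseteq> {0}" by auto
    then have "card ((\<lambda>i. (a i)\<^sup>2) ` ?Z) \<le> card {0::real}" by (rule card_mono[rotated]) simp
    then show ?thesis unfolding if_not_P[OF False] by simp
  qed (simp only: image_empty card.empty if_True)
  moreover have "(if ?Z = {} then 0 else 1) \<le> card ?Z" using I by (auto simp: Suc_le_eq card_gt_0_iff)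
  moreover have "card ((\<lambda>i. (a i)\<^sup>2) ` ?P) \<le> card ?P" using I by (intro card_image_le) auto
  moreover have "card ((\<lambda>i. (a i)\<^sup>2) ` I) \<le> card ((\<lambda>i. (a i)\<^sup>2) ` ?P) + card ((\<lambda>i. (a i)\<^sup>2) ` ?Z)"
  proof -
    have "card ((\<lambda>i. (a i)\<^sup>2) ` I) \<le> card ((\<lambda>i. (a i)\<^sup>2) ` ?P \<union> (\<lambda>i. (a i)\<^sup>2) ` ?Z)"
      by (rule card_mono[OF _ sub]) (use I in simp)
    also have "\<dots> \<le> card ((\<lambda>i. (a i)\<^sup>2) ` ?P) + card ((\<lambda>i. (a i)\<^sup>2) ` ?Z)" by (rule card_Un_le)
    finally show ?thesis .
  qed
  moreover have "(if ?Z = {} then 0 else 1) \<le> (1::nat)" by simp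
  ultimately show ?thesis using I_eq PN NP by linarith
qed

text \<open>The remainder of \<open>X ^ m\<close> modulo the polynomial with root set \<open>S\<close> has degree less than \<open>card S\<close> and
  agrees with \<open>X ^ m\<close> on \<open>S\<close>.\<close>

lemma power_eq_lower_powers:
  fixes S :: "real set"
  assumes "finite S" "card S \<le> d"
  shows "\<exists>c. \<forall>s\<in>S. s ^ m = (\<Sum>k<d. c k * s ^ k)"
proof -
  define r where "r = (\<Prod>s\<in>S. [:- s, 1:])"
  define q where "q = monom 1 m mod r"
  have "poly r s = 0" if "s \<in> S" for s using that assms(1) by (auto simp: r_def poly_prod)
  note r_root = this
  have q: "poly q s = s ^ m" if "s \<in> S" for s
  proof -
    have "poly (monom 1 m div r * r + q) s = poly (monom 1 m) s" unfolding q_def div_mult_mod_eq ..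
    then show ?thesis by (simp add: r_root[OF that] poly_monom)
  qed
  have r0: "r \<noteq> 0" using assms(1) by (simp add: r_def)
  have deg: "degree r = card S" unfolding r_def by (subst degree_prod_eq_sum_degree) simp_all
  have coeff0: "coeff q k = 0" if "k \<ge> d" for k
    using degree_mod_less[OF r0, of "monom 1 m"] that assms(2) deg
    by (cases "q = 0") (auto simp: q_def intro: coeff_eq_0)
  have "poly q s = (\<Sum>k<d. coeff q k * s ^ k)" for s
  proof -
    have "poly q s = (\<Sum>k\<le>degree q. coeff q k * s ^ k)" by (rule poly_altdef)
    also have "\<dots> = (\<Sum>k\<in>{..degree q} \<union> {..<d}. coeff q k * s ^ k)"
      by (rule sum.mono_neutral_left) (auto simp: coeff_eq_0)
    also have "\<dots> = (\<Sum>k<d. coeff q k * s ^ k)"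
      by (rule sum.mono_neutral_right) (auto simp: coeff0)
    finally show ?thesis .
  qed
  then show ?thesis using q by (intro exI[of _ "coeff q"]) metis
qed

section \<open>Hermitian matrices over the three algebras\<close>

lemma conjg_eq: "conjg x = (2 * (x \<bullet> 1)) *\<^sub>R 1 - (x :: 'f::conj_div_algebra)"
  using add_conjg[of x] by (simp add: eq_diff_eq add.commute)

lemma conjg_scaleR: "conjg (r *\<^sub>R x) = r *\<^sub>R conjg (x :: 'f::conj_div_algebra)"
  by (simp add: conjg_eq algebra_simps)

lemma inner_1_1: "(1 :: 'f::conj_div_algebra) \<bullet> 1 = 1"
  by (simp add: dot_square_norm)

lemma inner_conjg_conjg: "conjg x \<bullet> conjg y = x \<bullet> (y :: 'f::conj_div_algebra)"
  by (simp add: conjg_eq inner_diff_left inner_diff_right inner_1_1 inner_commute[of 1 y])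

text \<open>Although the quaternions are not commutative, the real part of a product is independent of the
  order of its factors. This makes the real part of the trace cyclic.\<close>

lemma inner_mult_commute: "(x * y) \<bullet> 1 = (y * x) \<bullet> (1 :: 'f::conj_div_algebra)"
proof -
  have "(x * y) \<bullet> 1 = x \<bullet> conjg y" by (simp add: inner_conv_conjg[of x "conjg y"] conjg_conjg)
  also have "\<dots> = y \<bullet> conjg x"
    using inner_conjg_conjg[of "conjg x" y] by (simp add: conjg_conjg inner_commute)
  also have "\<dots> = (y * x) \<bullet> 1" by (simp add: inner_conv_conjg[of y "conjg x"] conjg_conjg)
  finally show ?thesis .
qed

lemma conjg_mult_self: "conjg x * x = (x \<bullet> x) *\<^sub>R (1 :: 'f::conj_div_algebra)"
proof -
  let ?y = "conjg x * x"
  have "2 *\<^sub>R ?y = (2 * (?y \<bullet> 1)) *\<^sub>R 1"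
    using add_conjg[of ?y] by (simp add: conjg_mult conjg_conjg scaleR_2)
  then have "2 *\<^sub>R ?y = 2 *\<^sub>R ((?y \<bullet> 1) *\<^sub>R 1)" by simp
  then have "?y = (?y \<bullet> 1) *\<^sub>R 1" by (metis scaleR_cancel_left zero_neq_numeral)
  moreover have "?y \<bullet> 1 = x \<bullet> x" using inner_mult_commute[of "conjg x" x] inner_conv_conjg[of x x] by simp
  ultimately show ?thesis by simp
qed

lemma conj_transpose_nth: "conj_transpose A $ i $ j = conjg (A $ j $ i)"
  by (simp add: conj_transpose_def transpose_def)

lemma conj_transpose_conj_transpose [simp]: "conj_transpose (conj_transpose A) = A"
  by (simp add: vec_eq_iff conj_transpose_nth conjg_conjg)

lemma linear_conj_transpose: "linear (conj_transpose :: 'f::conj_div_algebra^'n^'n \<Rightarrow> _)"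
  by (rule linearI) (simp_all add: vec_eq_iff conj_transpose_nth conjg_add conjg_scaleR)

lemma matrix_mult_scaleR_left: "(r *\<^sub>R A) ** B = r *\<^sub>R (A ** B)"
  and matrix_mult_scaleR_right: "A ** (r *\<^sub>R B) = r *\<^sub>R (A ** B)"
  for A B :: "'f::conj_div_algebra^'n^'n"
  by (simp_all add: vec_eq_iff matrix_matrix_mult_def scaleR_sum_right)

lemma matrix_add_rdistrib: "(A + B) ** C = A ** C + B ** C"
  for A B C :: "'f::conj_div_algebra^'n^'n"
  by (simp add: vec_eq_iff matrix_matrix_mult_def distrib_right sum.distrib)

lemma bounded_bilinear_matrix_mult:
  "bounded_bilinear ((**) :: 'f::conj_div_algebra^'n^'n \<Rightarrow> 'f^'n^'n \<Rightarrow> 'f^'n^'n)"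
  unfolding bilinear_conv_bounded_bilinear[symmetric] bilinear_def
  by (intro conjI allI linearI)
    (simp_all add: matrix_add_ldistrib matrix_add_rdistrib matrix_mult_scaleR_left matrix_mult_scaleR_right)

lemmas matrix_mult_sum_left = bounded_bilinear.sum_left[OF bounded_bilinear_matrix_mult]
lemmas matrix_mult_sum_right = bounded_bilinear.sum_right[OF bounded_bilinear_matrix_mult]
lemmas matrix_mult_minus_left = bounded_bilinear.minus_left[OF bounded_bilinear_matrix_mult]
lemmas matrix_mult_minus_right = bounded_bilinear.minus_right[OF bounded_bilinear_matrix_mult]

definition real_trace :: "'f::conj_div_algebra^'n^'n \<Rightarrow> real"
  where "real_trace A = real_part (trace A)"

lemma real_trace_commute: "real_trace (A ** B) = real_trace (B ** A)"
  for A B :: "'f::conj_div_algebra^'n^'n"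
proof -
  have "real_trace (A ** B) = (\<Sum>i\<in>UNIV. \<Sum>k\<in>UNIV. (A $ i $ k * B $ k $ i) \<bullet> 1)"
    by (simp add: real_trace_def real_part_def trace_def matrix_matrix_mult_def inner_sum_left)
  also have "\<dots> = (\<Sum>k\<in>UNIV. \<Sum>i\<in>UNIV. (B $ k $ i * A $ i $ k) \<bullet> 1)"
    by (subst sum.swap) (simp add: inner_mult_commute)
  also have "\<dots> = real_trace (B ** A)"
    by (simp add: real_trace_def real_part_def trace_def matrix_matrix_mult_def inner_sum_left)
  finally show ?thesis .
qed

lemma inner_eq_real_trace: "A \<bullet> B = real_trace (A ** conj_transpose B)"
  for A B :: "'f::conj_div_algebra^'n^'n"
  by (simp add: inner_matrix_eq real_trace_def)

lemma real_trace_eq_inner: "real_trace A = A \<bullet> mat 1"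
  for A :: "'f::conj_div_algebra^'n^'n"
  by (simp add: inner_eq_real_trace conj_transpose_mat_1)

lemma inner_matrix_mult_left: "(A ** B) \<bullet> C = B \<bullet> (conj_transpose A ** C)"
  for A B C :: "'f::conj_div_algebra^'n^'n"
  using real_trace_commute[of A "B ** conj_transpose C"]
  by (simp add: inner_eq_real_trace conj_transpose_mult matrix_mul_assoc)

lemma inner_matrix_mult_right: "(A ** B) \<bullet> C = A \<bullet> (C ** conj_transpose B)"
  for A B C :: "'f::conj_div_algebra^'n^'n"
  by (simp add: inner_eq_real_trace conj_transpose_mult matrix_mul_assoc)

lemma matrix_power_0: "matrix_power A 0 = mat 1"
  by (simp add: matrix_power_def)

lemma matrix_power_1: "matrix_power A (Suc 0) = A"
  by (simp add: matrix_power_def)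

lemma matrix_power_add: "matrix_power A (j + k) = matrix_power A j ** matrix_power A k"
  for A :: "'f::conj_div_algebra^'n^'n"
  by (induction j) (simp_all add: matrix_power_0 matrix_power_Suc matrix_mul_assoc)

lemma matrix_powers_commute: "matrix_power A j ** matrix_power A k = matrix_power A k ** matrix_power A j"
  for A :: "'f::conj_div_algebra^'n^'n"
  by (metis add.commute matrix_power_add)

lemma conj_transpose_matrix_power:
  fixes A :: "'f::conj_div_algebra^'n^'n"
  assumes "conj_transpose A = A"
  shows "conj_transpose (matrix_power A k) = matrix_power A k"
  by (induction k)
    (simp_all add: matrix_power_0 conj_transpose_mat_1 matrix_power_Suc conj_transpose_mult assms
      matrix_power_commute)

lemma matrix_power_uminus: "matrix_power (- A) k = (- 1) ^ k *\<^sub>R matrix_power A k"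
  for A :: "'f::conj_div_algebra^'n^'n"
  by (induction k)
    (simp_all add: matrix_power_0 matrix_power_Suc matrix_mult_minus_left matrix_mult_scaleR_right)

lemma matrix_power_conjugate:
  fixes A U :: "'f::conj_div_algebra^'n^'n"
  assumes "V ** U = mat 1" "U ** V = mat 1"
  shows "matrix_power (U ** A ** V) k = U ** matrix_power A k ** V"
proof (induction k)
  case (Suc k)
  have "matrix_power (U ** A ** V) (Suc k) = U ** A ** (V ** U) ** matrix_power A k ** V"
    by (simp add: matrix_power_Suc Suc matrix_mul_assoc)
  then show ?case by (simp add: assms matrix_power_Suc matrix_mul_assoc)
qed (simp add: matrix_power_0 assms)

text \<open>Determinants are of no use over the quaternions. But left multiplication by \<open>P\<close> is an injective
  real linear map of a finite-dimensional space, hence surjective.\<close>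

lemma left_inverse_imp_right_inverse:
  fixes P Q :: "'f::conj_div_algebra^'n^'n"
  assumes "Q ** P = mat 1"
  shows "P ** Q = mat 1"
proof -
  have lin: "linear ((**) P :: 'f^'n^'n \<Rightarrow> 'f^'n^'n)"
    by (rule linearI) (simp_all add: matrix_add_ldistrib matrix_mult_scaleR_right)
  have "inj ((**) P :: 'f^'n^'n \<Rightarrow> 'f^'n^'n)"
    by (rule inj_on_inverseI[of _ "(**) Q"]) (simp add: matrix_mul_assoc assms)
  then have "surj ((**) P :: 'f^'n^'n \<Rightarrow> 'f^'n^'n)" by (rule linear_injective_imp_surjective[OF lin]) simp
  then obtain X :: "'f^'n^'n" where X: "P ** X = mat 1" unfolding surj_def by metis
  have "Q = Q ** (P ** X)" by (simp add: X)
  also have "\<dots> = X" by (simp add: matrix_mul_assoc assms)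
  finally show ?thesis using X by simp
qed

definition diagm :: "('n \<Rightarrow> real) \<Rightarrow> 'f::conj_div_algebra^'n^'n"
  where "diagm a = (\<chi> i j. if i = j then of_real (a i) else 0)"

lemma matrix_mult_diagm: "(P ** diagm a) $ i $ j = a j *\<^sub>R (P $ i $ j)"
  for P :: "'f::conj_div_algebra^'n^'n"
proof -
  have "(P ** diagm a) $ i $ j = (\<Sum>k\<in>UNIV. if k = j then P $ i $ k * of_real (a k) else 0)"
    unfolding matrix_matrix_mult_def diagm_def by (simp add: if_distrib cong: if_cong)
  then show ?thesis by (simp add: of_real_def)
qed

lemma diagm_mult: "diagm a ** diagm b = (diagm (\<lambda>i. a i * b i) :: 'f::conj_div_algebra^'n^'n)"
  by (simp add: vec_eq_iff matrix_mult_diagm) (simp add: diagm_def of_real_def)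

lemma conjugate_diagm_nth:
  "(P ** diagm a ** conj_transpose P) $ i $ j = (\<Sum>k\<in>UNIV. a k *\<^sub>R (P $ i $ k * conjg (P $ j $ k)))"
  for P :: "'f::conj_div_algebra^'n^'n"
  by (subst matrix_matrix_mult_def) (simp add: matrix_mult_diagm conj_transpose_nth)

lemma diagm_1: "diagm (\<lambda>_. 1) = (mat 1 :: 'f::conj_div_algebra^'n^'n)"
  by (simp add: diagm_def mat_def vec_eq_iff)

text \<open>The Hermitian product with values in the algebra, linear in the second argument with respect to
  scalars from the right. Matrices act from the left, so over the quaternions eigenspaces are right
  subspaces; for the real eigenvalues of Hermitian matrices the side is irrelevant.\<close>

definition hprod :: "'f::conj_div_algebra^'n \<Rightarrow> 'f^'n \<Rightarrow> 'f"
  where "hprod v w = (\<Sum>i\<in>UNIV. conjg (v $ i) * w $ i)"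

lemma hprod_adjoint: "hprod v (A *v w) = hprod (conj_transpose A *v v) w"
proof -
  have "hprod v (A *v w) = (\<Sum>i\<in>UNIV. \<Sum>j\<in>UNIV. conjg (v $ i) * (A $ i $ j * w $ j))"
    by (simp add: hprod_def matrix_vector_mult_def sum_distrib_left)
  also have "\<dots> = (\<Sum>j\<in>UNIV. \<Sum>i\<in>UNIV. conjg (v $ i) * (A $ i $ j * w $ j))" by (rule sum.swap)
  also have "\<dots> = hprod (conj_transpose A *v v) w"
    by (simp add: hprod_def matrix_vector_mult_def conj_transpose_nth conjg_sum conjg_mult
        conjg_conjg sum_distrib_right mult.assoc)
  finally show ?thesis .
qed

lemma linear_hprod: "linear (hprod v)"
  by (rule linearI) (simp_all add: hprod_def algebra_simps sum.distrib scaleR_sum_right)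

lemma hprod_scaleR_left: "hprod (r *\<^sub>R v) w = r *\<^sub>R hprod v w"
  by (simp add: hprod_def conjg_scaleR scaleR_sum_right)

lemma hprod_flip: "hprod w v = conjg (hprod v w)"
  by (simp add: hprod_def conjg_sum conjg_mult conjg_conjg)

lemma hprod_self: "hprod v v = (v \<bullet> v) *\<^sub>R 1"
  by (simp add: hprod_def conjg_mult_self inner_vec_def scaleR_sum_left)

lemma inner_eq_hprod: "v \<bullet> w = hprod w v \<bullet> 1"
proof -
  have "x \<bullet> y = (conjg y * x) \<bullet> 1" for x y :: 'a
    by (metis inner_conv_conjg inner_mult_commute)
  then show ?thesis by (simp add: hprod_def inner_vec_def inner_sum_left)
qed

text \<open>The vectors orthogonal to those already found form a real subspace \<open>W\<close> that is invariant under \<open>A\<close>.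
  It is nonzero: otherwise the Hermitian products with the vectors already found would embed the
  whole space into a space in which the coordinate \<open>m\<close> is missing. Since \<open>A\<close> is real self-adjoint,
  \<open>W\<close> contains a real eigenvector. The vectors are indexed by \<open>'n\<close> itself, so that they become the
  columns of a square matrix.\<close>

lemma hermitian_eigenvectors:
  fixes A :: "'f::conj_div_algebra^'n^'n" and J :: "'n set"
  assumes A: "conj_transpose A = A"
  shows "\<exists>(v :: 'n \<Rightarrow> 'f^'n) a. \<forall>i\<in>J. A *v v i = a i *\<^sub>R v i \<and> (\<forall>j\<in>J. hprod (v i) (v j) = (if i = j then 1 else 0))"
  using finite[of J]
proof (induction J)
  case empty
  show ?case by simp
next
  case (insert m J)
  then obtain v :: "'n \<Rightarrow> 'f^'n" and a where va:
    "\<forall>i\<in>J. A *v v i = a i *\<^sub>R v i \<and> (\<forall>j\<in>J. hprod (v i) (v j) = (if i = j then 1 else 0))"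
    by (elim exE)
  define W where "W = {w. \<forall>i\<in>J. hprod (v i) w = 0}"
  have linA: "linear ((*v) A)" by (rule matrix_vector_mul_linear)
  have W: "subspace W"
    by (auto simp: W_def subspace_def linear_0[OF linear_hprod] linear_add[OF linear_hprod] linear_scale[OF linear_hprod])
  have W_ne: "W \<noteq> {0}"
  proof
    assume W0: "W = {0}"
    define g :: "'f^'n \<Rightarrow> 'f^'n" where "g w = (\<chi> i. if i \<in> J then hprod (v i) w else 0)" for w
    have lin: "linear g"
      by (rule linearI) (simp_all add: g_def vec_eq_iff linear_add[OF linear_hprod] linear_scale[OF linear_hprod])
    have "w = 0" if "g w = 0" for w
    proof -
      have "w \<in> W" using that by (auto simp: W_def g_def vec_eq_iff split: if_splits)
      then show ?thesis using W0 by simp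
    qed
    then have "inj g" using linear_injective_0[OF lin] by blast
    then have "surj g" by (rule linear_injective_imp_surjective[OF lin]) simp
    then obtain w where "g w = axis m 1" unfolding surj_def by metis
    then have "g w $ m = 1" by (simp add: axis_def)
    then show False using insert.hyps(2) by (simp add: g_def)
  qed
  have W_inv: "A *v w \<in> W" if "w \<in> W" for w
    using that va unfolding W_def by (simp add: hprod_adjoint A hprod_scaleR_left)
  have sym: "(A *v u) \<bullet> w = u \<bullet> (A *v w)" for u w
    by (simp add: inner_eq_hprod[of u] inner_eq_hprod[of "A *v u"] hprod_adjoint A)
  obtain u b where u: "u \<in> W" "norm u = 1" "A *v u = b *\<^sub>R u"
    by (rule self_adjoint_eigenvector[OF W W_ne linA W_inv sym])
  have uu: "hprod u u = 1" using u(2) by (simp add: hprod_self dot_square_norm)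
  have vu: "hprod (v i) u = 0" "hprod u (v i) = 0" if "i \<in> J" for i
    using u(1) that hprod_flip[of u "v i"] by (auto simp: W_def)
  show ?case
    by (intro exI[of _ "v(m := u)"] exI[of _ "a(m := b)"])
      (use va u(3) uu vu insert.hyps(2) in auto)
qed

theorem hermitian_spectral:
  fixes A :: "'f::conj_div_algebra^'n^'n"
  assumes A: "conj_transpose A = A"
  obtains P :: "'f^'n^'n" and a where "conj_transpose P ** P = mat 1" "P ** conj_transpose P = mat 1"
    "A = P ** diagm a ** conj_transpose P"
proof -
  obtain v :: "'n \<Rightarrow> 'f^'n" and a where
    "\<forall>i\<in>UNIV. A *v v i = a i *\<^sub>R v i \<and> (\<forall>j\<in>UNIV. hprod (v i) (v j) = (if i = j then 1 else 0))"
    using hermitian_eigenvectors[OF A, of UNIV] by (elim exE)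
  then have va: "A *v v i = a i *\<^sub>R v i" "hprod (v i) (v j) = (if i = j then 1 else 0)" for i j
    by simp_all
  define P :: "'f^'n^'n" where "P = (\<chi> i j. v j $ i)"
  have 1: "conj_transpose P ** P = mat 1"
    using va(2) by (simp add: vec_eq_iff matrix_matrix_mult_def conj_transpose_nth P_def mat_def hprod_def)
  then have 2: "P ** conj_transpose P = mat 1" by (rule left_inverse_imp_right_inverse)
  have "A ** P = P ** diagm a"
  proof (simp add: vec_eq_iff matrix_mult_diagm, intro allI)
    fix i j
    have "(A ** P) $ i $ j = (A *v v j) $ i"
      by (simp add: matrix_matrix_mult_def matrix_vector_mult_def P_def)
    then show "(A ** P) $ i $ j = a j *\<^sub>R P $ i $ j" by (simp add: va(1) P_def)
  qed
  then have "P ** diagm a ** conj_transpose P = A ** (P ** conj_transpose P)"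
    by (simp add: matrix_mul_assoc)
  then have "A = P ** diagm a ** conj_transpose P" by (simp add: 2)
  then show ?thesis by (rule that[OF 1 2])
qed

lemma matrix_power_diagonalized:
  fixes P :: "'f::conj_div_algebra^'n^'n"
  assumes "conj_transpose P ** P = mat 1" "P ** conj_transpose P = mat 1"
  shows "matrix_power (P ** diagm a ** conj_transpose P) k = P ** diagm (\<lambda>i. a i ^ k) ** conj_transpose P"
proof -
  have "matrix_power (diagm a) k = (diagm (\<lambda>i. a i ^ k) :: 'f^'n^'n)"
    by (induction k) (simp_all add: matrix_power_0 diagm_1 matrix_power_Suc diagm_mult)
  then show ?thesis by (simp add: matrix_power_conjugate[OF assms])
qed

lemma real_trace_diagonalized:
  fixes P :: "'f::conj_div_algebra^'n^'n"
  assumes "conj_transpose P ** P = mat 1"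
  shows "real_trace (P ** diagm a ** conj_transpose P) = (\<Sum>i\<in>UNIV. a i)"
proof -
  have "real_trace (P ** diagm a ** conj_transpose P) = real_trace (conj_transpose P ** (P ** diagm a))"
    by (rule real_trace_commute)
  also have "\<dots> = real_trace (diagm a :: 'f^'n^'n)" by (simp add: matrix_mul_assoc assms)
  also have "\<dots> = (\<Sum>i\<in>UNIV. a i)"
    by (simp add: real_trace_def real_part_def trace_def diagm_def inner_sum_left of_real_def inner_1_1)
  finally show ?thesis .
qed

context
  fixes A :: "'f::conj_div_algebra^'n^'n"
  assumes herm: "conj_transpose A = A"
    and odd_traces: "\<And>k. k \<le> num_p CARD('n) \<Longrightarrow> real_trace (matrix_power A (2 * k + 1)) = 0"
begin

text \<open>With \<open>p = num_p n\<close>, the number \<open>2 p + 1\<close> is the largest odd number not exceeding \<open>n\<close>, so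
  exactly the odd power sums of the eigenvalues up to exponent \<open>n\<close> are known to vanish; these suffice.\<close>

lemma symmetric_spectrum:
  obtains P :: "'f^'n^'n" and a \<pi> where "conj_transpose P ** P = mat 1" "P ** conj_transpose P = mat 1"
    "A = P ** diagm a ** conj_transpose P" "\<pi> permutes UNIV" "\<And>i. a (\<pi> i) = - a i"
proof -
  obtain P :: "'f^'n^'n" and a where P: "conj_transpose P ** P = mat 1" "P ** conj_transpose P = mat 1"
    "A = P ** diagm a ** conj_transpose P"
    by (rule hermitian_spectral[OF herm])
  have "(\<Sum>i\<in>UNIV. a i ^ (2 * k + 1)) = 0" if "2 * k + 1 \<le> card (UNIV :: 'n set)" for k
  proof -
    have "k \<le> num_p CARD('n)" using that by (simp add: num_p_def)
    from odd_traces[OF this] show ?thesis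
      unfolding P(3) matrix_power_diagonalized[OF P(1,2)] real_trace_diagonalized[OF P(1)] .
  qed
  from odd_power_sums_vanish_symmetric[OF finite this] obtain \<pi>
    where "\<pi> permutes UNIV" "\<And>i. i \<in> UNIV \<Longrightarrow> a (\<pi> i) = - a i" by blast
  then show ?thesis using that[OF P] by blast
qed

text \<open>If \<open>Q\<close> arises from the diagonalizing matrix \<open>P\<close> by permuting the columns so that the eigenvalues
  change sign, then \<open>Q P\<^sup>*\<close> conjugates \<open>A\<close> to \<open>- A\<close>.\<close>

lemma unitary_to_negative:
  obtains U :: "'f^'n^'n" where "U ** conj_transpose U = mat 1" "conj_transpose U ** U = mat 1"
    "U ** A ** conj_transpose U = - A"
proof -
  obtain P :: "'f^'n^'n" and a \<pi> where P: "conj_transpose P ** P = mat 1" "P ** conj_transpose P = mat 1"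
    "A = P ** diagm a ** conj_transpose P" and \<pi>: "\<pi> permutes UNIV" "\<And>i. a (\<pi> i) = - a i"
    using symmetric_spectrum by blast
  define Q :: "'f^'n^'n" where "Q = (\<chi> i j. P $ i $ \<pi> j)"
  have reindex: "(\<Sum>k\<in>UNIV. f (\<pi> k)) = (\<Sum>k\<in>UNIV. f k)" for f :: "'n \<Rightarrow> 'f"
    using sum.permute[OF \<pi>(1), of f] by (simp add: o_def)
  have Q: "(Q ** diagm b ** conj_transpose Q) $ i $ j = (\<Sum>k\<in>UNIV. b k *\<^sub>R (P $ i $ \<pi> k * conjg (P $ j $ \<pi> k)))"
    for b i j unfolding conjugate_diagm_nth by (simp add: Q_def)
  have QQ: "Q ** conj_transpose Q = mat 1"
  proof -
    have "Q ** diagm (\<lambda>_. 1) ** conj_transpose Q = P ** diagm (\<lambda>_. 1) ** conj_transpose P"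
      using reindex[of "\<lambda>k. P $ i $ k * conjg (P $ j $ k)" for i j]
      by (simp add: vec_eq_iff conjugate_diagm_nth Q_def)
    then show ?thesis by (simp add: diagm_1 P(2))
  qed
  have QD: "Q ** diagm a ** conj_transpose Q = - A"
  proof (simp add: vec_eq_iff Q, intro allI)
    fix i j
    have "A $ i $ j = (\<Sum>k\<in>UNIV. a k *\<^sub>R (P $ i $ k * conjg (P $ j $ k)))"
      by (subst P(3)) (rule conjugate_diagm_nth)
    also have "\<dots> = (\<Sum>k\<in>UNIV. a (\<pi> k) *\<^sub>R (P $ i $ \<pi> k * conjg (P $ j $ \<pi> k)))"
      by (rule reindex[symmetric])
    finally show "(\<Sum>k\<in>UNIV. a k *\<^sub>R (P $ i $ \<pi> k * conjg (P $ j $ \<pi> k))) = - A $ i $ j"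
      by (simp add: \<pi>(2) sum_negf)
  qed
  let ?U = "Q ** conj_transpose P"
  have ct: "conj_transpose ?U = P ** conj_transpose Q" by (simp add: conj_transpose_mult)
  have U: "?U ** conj_transpose ?U = mat 1"
  proof -
    have "?U ** conj_transpose ?U = Q ** (conj_transpose P ** P) ** conj_transpose Q"
      by (simp only: ct matrix_mul_assoc)
    then show ?thesis by (simp add: P(1) QQ)
  qed
  have "?U ** A ** conj_transpose ?U
     = Q ** (conj_transpose P ** P) ** diagm a ** (conj_transpose P ** P) ** conj_transpose Q"
    by (simp only: ct P(3) matrix_mul_assoc)
  then have "?U ** A ** conj_transpose ?U = - A" by (simp add: P(1) QD)
  then show ?thesis using that[of ?U] U left_inverse_imp_right_inverse[OF U] by simp
qed

text \<open>The matrix \<open>A\<^sup>2\<close> has at most \<open>p + 1\<close> different eigenvalues, so its powers up to exponent \<open>p\<close> span all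
  of them.\<close>

lemma even_power_reduction:
  "\<exists>c. matrix_power A (2 * m) = (\<Sum>k\<le>num_p CARD('n). c k *\<^sub>R matrix_power A (2 * k))"
proof -
  obtain P :: "'f^'n^'n" and a \<pi> where P: "conj_transpose P ** P = mat 1" "P ** conj_transpose P = mat 1"
    "A = P ** diagm a ** conj_transpose P" and \<pi>: "\<pi> permutes UNIV" "\<And>i. a (\<pi> i) = - a i"
    using symmetric_spectrum by blast
  have "card ((\<lambda>i. (a i)\<^sup>2) ` UNIV) \<le> Suc (num_p CARD('n))"
    using card_squares_le[OF finite \<pi>(1), of a] \<pi>(2) by (simp add: num_p_def)
  from power_eq_lower_powers[OF finite_imageI[OF finite] this, of m]
  obtain c where c: "\<forall>s\<in>(\<lambda>i. (a i)\<^sup>2) ` UNIV. s ^ m = (\<Sum>k<Suc (num_p CARD('n)). c k * s ^ k)"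
    by (elim exE)
  have c: "a i ^ (2 * m) = (\<Sum>k\<le>num_p CARD('n). c k * a i ^ (2 * k))" for i
    using c by (simp add: power_mult lessThan_Suc_atMost)
  have mp: "matrix_power A k = P ** diagm (\<lambda>i. a i ^ k) ** conj_transpose P" for k
    by (subst P(3)) (rule matrix_power_diagonalized[OF P(1,2)])
  have "matrix_power A (2 * m) = (\<Sum>k\<le>num_p CARD('n). c k *\<^sub>R matrix_power A (2 * k))"
    unfolding mp
    by (simp add: vec_eq_iff conjugate_diagm_nth c scaleR_sum_left scaleR_sum_right)
      (subst sum.swap, simp)
  then show ?thesis by blast
qed

end

text \<open>The derivative of \<open>A \<mapsto> A\<^sup>k\<close> in direction \<open>X\<close>, that is \<open>\<Sum>A\<^sup>i X A\<^sup>j\<close> over \<open>i + j = k - 1\<close>. For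
  Hermitian \<open>A\<close> these operators are self-adjoint, and they commute for different \<open>k\<close> because left and
  right multiplications by powers of \<open>A\<close> do.\<close>

definition power_deriv :: "nat \<Rightarrow> 'f::conj_div_algebra^'n^'n \<Rightarrow> 'f^'n^'n \<Rightarrow> 'f^'n^'n"
  where "power_deriv k A X = (\<Sum>i<k. matrix_power A i ** (X ** matrix_power A (k - Suc i)))"

lemma power_deriv_Suc: "power_deriv (Suc k) A X = A ** power_deriv k A X + X ** matrix_power A k"
  unfolding power_deriv_def sum.lessThan_Suc_shift
  by (simp add: matrix_power_0 matrix_power_Suc matrix_mult_sum_right matrix_mul_assoc add.commute)

lemma has_derivative_matrix_power: "((\<lambda>A. matrix_power A k) has_derivative power_deriv k A) (at A)"
proof (induction k)
  case 0
  show ?case by (simp add: matrix_power_0 power_deriv_def[abs_def])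
next
  case (Suc k)
  show ?case
    using bounded_bilinear.FDERIV[OF bounded_bilinear_matrix_mult has_derivative_ident Suc]
    unfolding matrix_power_Suc power_deriv_Suc[abs_def] .
qed

lemma C_on_matrix_power: "C_on l (\<lambda>A :: 'f::conj_div_algebra^'n^'n. matrix_power A k) UNIV"
  by (induction k)
    (simp_all add: matrix_power_0 matrix_power_Suc C_on_const C_on_bounded_linear_id[OF bounded_linear_ident]
      C_on_bounded_bilinear[OF bounded_bilinear_matrix_mult])

lemma linear_power_deriv: "linear (power_deriv k A)"
  using has_derivative_matrix_power by (rule has_derivative_linear)

lemma power_deriv_self_adjoint:
  fixes A X Y :: "'f::conj_div_algebra^'n^'n"
  assumes "conj_transpose A = A"
  shows "power_deriv k A X \<bullet> Y = X \<bullet> power_deriv k A Y"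
proof -
  have "(matrix_power A i ** (X ** matrix_power A j)) \<bullet> Y = X \<bullet> (matrix_power A i ** (Y ** matrix_power A j))" for i j
  proof -
    have "(matrix_power A i ** (X ** matrix_power A j)) \<bullet> Y
        = (X ** matrix_power A j) \<bullet> (conj_transpose (matrix_power A i) ** Y)"
      by (rule inner_matrix_mult_left)
    also have "\<dots> = X \<bullet> (conj_transpose (matrix_power A i) ** Y ** conj_transpose (matrix_power A j))"
      by (rule inner_matrix_mult_right)
    finally show ?thesis by (simp add: conj_transpose_matrix_power[OF assms] matrix_mul_assoc)
  qed
  then show ?thesis by (simp add: power_deriv_def inner_sum_left inner_sum_right)
qed

lemma power_deriv_commute: "power_deriv k A (power_deriv l A X) = power_deriv l A (power_deriv k A X)"
proof -
  let ?p = "matrix_power A"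
  have "?p i ** ((?p j ** (X ** ?p m)) ** ?p n) = ?p j ** ((?p i ** (X ** ?p n)) ** ?p m)" for i j m n
  proof -
    have "?p i ** ((?p j ** (X ** ?p m)) ** ?p n) = (?p i ** ?p j) ** X ** (?p m ** ?p n)"
      by (simp add: matrix_mul_assoc)
    also have "\<dots> = (?p j ** ?p i) ** X ** (?p n ** ?p m)"
      using matrix_powers_commute by metis
    finally show ?thesis by (simp add: matrix_mul_assoc)
  qed
  then show ?thesis
    unfolding power_deriv_def matrix_mult_sum_left matrix_mult_sum_right by (subst sum.swap) simp
qed

lemma power_deriv_power: "power_deriv (Suc k) A (matrix_power A m) = real (Suc k) *\<^sub>R matrix_power A (k + m)"
proof -
  have "matrix_power A i ** (matrix_power A m ** matrix_power A (k - i)) = matrix_power A (k + m)"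
    if "i \<le> k" for i
    using that by (simp add: add.commute flip: matrix_power_add)
  then have "power_deriv (Suc k) A (matrix_power A m) = (\<Sum>i<Suc k. matrix_power A (k + m))"
    unfolding power_deriv_def by (intro sum.cong) auto
  then show ?thesis by (simp add: scaleR_conv_of_real flip: sum_constant_scaleR)
qed

text \<open>Conjugation by \<open>U\<close> multiplies \<open>A\<^sup>i\<close> by \<open>(-1)\<^sup>i\<close>, and the two exponents in each summand add up to the
  odd number \<open>2 k - 1\<close>.\<close>

lemma power_deriv_anticommute:
  fixes A U :: "'f::conj_div_algebra^'n^'n"
  assumes U: "U ** conj_transpose U = mat 1" "conj_transpose U ** U = mat 1"
    and neg: "U ** A ** conj_transpose U = - A"
  shows "power_deriv (2 * k) A (U ** X ** conj_transpose U) = - (U ** power_deriv (2 * k) A X ** conj_transpose U)"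
proof -
  let ?p = "matrix_power A" and ?V = "conj_transpose U"
  have p: "?p i = (- 1) ^ i *\<^sub>R (U ** ?p i ** ?V)" for i
  proof -
    have "U ** ?p i ** ?V = (- 1) ^ i *\<^sub>R ?p i"
      using matrix_power_conjugate[OF U(2,1), of A i] matrix_power_uminus[of A i] by (simp add: neg)
    then show ?thesis by (simp flip: power_mult_distrib)
  qed
  have "?p i ** ((U ** X ** ?V) ** ?p j) = - (U ** (?p i ** (X ** ?p j)) ** ?V)" if "odd (i + j)" for i j
  proof -
    have "?p i ** ((U ** X ** ?V) ** ?p j)
       = ((- 1) ^ i * (- 1) ^ j) *\<^sub>R (U ** ?p i ** (?V ** U) ** X ** (?V ** U) ** ?p j ** ?V)"
      by (subst (1) p, subst (2) p)
        (simp add: matrix_mult_scaleR_left matrix_mult_scaleR_right matrix_mul_assoc)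
    also have "(- 1) ^ i * (- 1) ^ j = (- 1 :: real)"
      using that by (simp flip: power_add)
    finally show ?thesis by (simp add: U matrix_mul_assoc)
  qed
  then have "power_deriv (2 * k) A (U ** X ** ?V)
     = (\<Sum>i<2 * k. - (U ** (?p i ** (X ** ?p (2 * k - Suc i))) ** ?V))"
    unfolding power_deriv_def by (intro sum.cong) auto
  then show ?thesis
    by (simp add: power_deriv_def sum_negf matrix_mult_sum_left matrix_mult_sum_right)
qed

section \<open>The set of regular zeros as a level set\<close>

lemma card_less_pairs:
  fixes f :: "'n::finite \<Rightarrow> nat"
  assumes "inj f"
  shows "2 * card {(i, j). f i < f j} = CARD('n) * (CARD('n) - 1)"
proof -
  let ?L = "{(i, j). f i < f j}" and ?G = "{(i, j). f j < f i}" and ?D = "{(i, j). i = j} :: ('n \<times> 'n) set"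
  have "(UNIV :: ('n \<times> 'n) set) = (?L \<union> ?G) \<union> ?D"
    using inj_eq[OF assms] by (auto simp: set_eq_iff) (metis linorder_neqE_nat)
  then have "CARD('n \<times> 'n) = card ((?L \<union> ?G) \<union> ?D)" by simp
  also have "\<dots> = (card ?L + card ?G) + card ?D"
    by (subst card_Un_disjoint; (subst card_Un_disjoint)?) auto
  also have "card ?G = card ?L"
    by (rule bij_betw_same_card[of prod.swap]) (auto simp: bij_betw_def inj_on_def image_iff)
  also have "?D = range (\<lambda>i. (i, i))" by auto
  also have "card (range (\<lambda>i :: 'n. (i, i))) = CARD('n)"
    by (rule card_image) (simp add: inj_on_def)
  finally have "CARD('n) * CARD('n) = 2 * card ?L + CARD('n)" by simp
  then show ?thesis by (simp add: diff_mult_distrib2)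
qed

lemma subspace_hermitian: "subspace {A :: 'f::conj_div_algebra^'n^'n. conj_transpose A = A}"
  unfolding subspace_def
  by (simp add: linear_0[OF linear_conj_transpose] linear_add[OF linear_conj_transpose]
      linear_scale[OF linear_conj_transpose])

lemma hermitian_traceless_eq:
  "hermitian_traceless = {A \<in> {A. conj_transpose A = A}. A \<bullet> (mat 1 :: 'f::conj_div_algebra^'n^'n) = 0}"
proof -
  have "trace A = 0 \<longleftrightarrow> A \<bullet> mat 1 = 0" if "conj_transpose A = A" for A :: "'f^'n^'n"
    using trace_matrix_power_real[OF that, of "Suc 0"]
    by (auto simp: matrix_power_1 simp flip: real_trace_eq_inner) (auto simp: real_trace_def real_part_def)
  then show ?thesis by (auto simp: hermitian_traceless_def)
qed

lemma conj_transpose_axis: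
  "conj_transpose (axis i (axis j b) :: 'f::conj_div_algebra^'n^'n) = axis j (axis i (conjg b))"
proof (unfold vec_eq_iff conj_transpose_nth, intro allI)
  fix k l
  show "conjg ((axis i (axis j b) :: 'f^'n^'n) $ l $ k) = axis j (axis i (conjg b)) $ k $ l"
    by (cases "l = i"; cases "k = j"; simp add: axis_def)
qed

text \<open>The matrices \<open>e ((i, j), b)\<close>, sums of \<open>b\<close> placed at \<open>(i, j)\<close> and \<open>conjg b\<close> placed at \<open>(j, i)\<close>, satisfy
  \<open>e ((i, j), b) \<bullet> X = 2 (b \<bullet> X\<^sub>i\<^sub>j)\<close> for all Hermitian \<open>X\<close>. Taking \<open>i\<close> before \<open>j\<close> and \<open>b\<close> from a basis,
  together with \<open>i = j\<close> and \<open>b = 1\<close>, one obtains an orthogonal family, and only \<open>X = 0\<close> is orthogonal to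
  all of it. The injection \<open>f\<close> serves to order the indices.\<close>

lemma dim_hermitian:
  "dim {A :: 'f::conj_div_algebra^'n^'n. conj_transpose A = A} = CARD('n) * (CARD('n) - 1) * DIM('f) div 2 + CARD('n)"
    (is "dim ?H = _")
proof -
  obtain f :: "'n \<Rightarrow> nat" where f: "inj f"
    using finite_imp_inj_to_nat_seg[OF finite[of "UNIV :: 'n set"]] by blast
  have f_eq: "f i = f j \<longleftrightarrow> i = j" for i j using inj_eq[OF f] .
  define e :: "('n \<times> 'n) \<times> 'f \<Rightarrow> 'f^'n^'n"
    where "e = (\<lambda>((i, j), b). axis i (axis j b) + axis j (axis i (conjg b)))"
  have e_nth: "e ((k, l), c) $ i $ j = (if i = k \<and> j = l then c else 0) + (if i = l \<and> j = k then conjg c else 0)"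
    for i j k l c by (cases "i = k"; cases "i = l"; simp add: e_def axis_def)
  define S where "S = {(i, j). f i < f j} \<times> (Basis :: 'f set) \<union> range (\<lambda>i. (i, i)) \<times> {1}"
  have e_H: "e s \<in> ?H" for s
    by (simp add: e_def split_beta linear_add[OF linear_conj_transpose] conj_transpose_axis conjg_conjg add.commute)
  have flip: "X $ j $ i = conjg (X $ i $ j)" if "X \<in> ?H" for X i j
  proof -
    have "X = conj_transpose X" using that by simp
    then have "X $ j $ i = conj_transpose X $ j $ i" by (rule arg_cong)
    then show ?thesis by (simp only: conj_transpose_nth)
  qed
  have e_inner: "e ((i, j), b) \<bullet> X = 2 * (b \<bullet> (X $ i $ j))" if "X \<in> ?H" for X i j b
  proof -
    have "conjg b \<bullet> (X $ j $ i) = b \<bullet> (X $ i $ j)"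
      unfolding flip[OF that, of j i] by (rule inner_conjg_conjg)
    then show ?thesis by (simp add: e_def inner_add_left inner_axis')
  qed
  have orth: "e s \<bullet> e t = 0" if st: "s \<in> S" "t \<in> S" "s \<noteq> t" for s t
  proof -
    obtain i j b k l c where s: "s = ((i, j), b)" and t: "t = ((k, l), c)" by (metis surj_pair)
    have s': "f i < f j \<and> b \<in> Basis \<or> i = j \<and> b = 1" and t': "f k < f l \<and> c \<in> Basis \<or> k = l \<and> c = 1"
      using st(1,2) by (auto simp: s t S_def)
    have "b \<bullet> (e t $ i $ j) = 0"
    proof (cases "i = k \<and> j = l")
      case True
      then have bc: "i \<noteq> j" "b \<noteq> c" "b \<in> Basis" "c \<in> Basis" using s' t' st(3) by (auto simp: s t)
      then have "\<not> (i = l \<and> j = k)" using True by auto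
      then have "e t $ i $ j = c" unfolding t e_nth if_P[OF True] by (simp only: if_False add_0_right)
      then show ?thesis using bc by (simp add: inner_not_same_Basis)
    next
      case False
      have "\<not> (i = l \<and> j = k)" using s' t' False by auto
      then have "e t $ i $ j = 0" unfolding t e_nth if_not_P[OF False] by (simp only: if_False add_0_right)
      then show ?thesis by simp
    qed
    then show ?thesis unfolding s e_inner[OF e_H] by simp
  qed
  have nz: "e s \<bullet> e s \<noteq> 0" if "s \<in> S" for s
  proof -
    obtain i j b where s: "s = ((i, j), b)" by (metis surj_pair)
    have s': "f i < f j \<and> b \<in> Basis \<or> i = j \<and> b = 1" using that by (auto simp: s S_def)
    have "b \<bullet> (e s $ i $ j) \<noteq> 0"
    proof (cases "i = j")
      case True
      then have "b = 1" using s' by auto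
      then show ?thesis unfolding s e_nth True by (simp add: inner_add_right inner_1_1 del: one_add_one)
    next
      case False
      then have "e s $ i $ j = b" "b \<in> Basis" using s' unfolding s e_nth by auto
      then show ?thesis by simp
    qed
    then show ?thesis unfolding s e_inner[OF e_H] by simp
  qed
  have inj: "inj_on e S"
  proof (rule inj_onI, rule ccontr)
    fix s t assume st: "s \<in> S" "t \<in> S" "e s = e t" "s \<noteq> t"
    then show False using orth[OF st(1,2,4)] nz[OF st(1)] by simp
  qed
  have "independent (e ` S)"
  proof (rule pairwise_orthogonal_independent)
    show "pairwise orthogonal (e ` S)"
    proof (rule pairwiseI)
      fix x y assume "x \<in> e ` S" "y \<in> e ` S" "x \<noteq> y"
      then obtain s t where "s \<in> S" "x = e s" "t \<in> S" "y = e t" by (elim imageE)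
      moreover from this have "s \<noteq> t" using \<open>x \<noteq> y\<close> by blast
      ultimately show "orthogonal x y" by (simp add: orthogonal_def orth)
    qed
    show "0 \<notin> e ` S" using nz by force
  qed
  then have dim_span: "dim (span (e ` S)) = card S"
    by (simp add: dim_eq_card_independent card_image[OF inj])
  have zero: "X = 0" if X: "X \<in> ?H" and "\<And>s. s \<in> S \<Longrightarrow> e s \<bullet> X = 0" for X
  proof -
    have b: "b \<bullet> (X $ i $ j) = 0" if "((i, j), b) \<in> S" for i j b
      using that(1) \<open>\<And>s. s \<in> S \<Longrightarrow> e s \<bullet> X = 0\<close>[of "((i, j), b)"] e_inner[OF X] by simp
    have less: "X $ i $ j = 0" if "f i < f j" for i j
      by (rule euclidean_eqI) (use b[of i j] that in \<open>auto simp: S_def inner_commute\<close>)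
    have diag: "X $ i $ i = 0" for i
    proof -
      have "X $ i $ i + conjg (X $ i $ i) = 0"
        using b[of i i 1] by (simp add: add_conjg S_def inner_commute)
      then have "2 *\<^sub>R (X $ i $ i) = 0" using flip[OF X, of i i, symmetric] by (simp add: scaleR_2)
      then show ?thesis by simp
    qed
    have "X $ i $ j = 0" for i j
    proof (cases "f i" "f j" rule: linorder_cases)
      case greater
      then show ?thesis using less[of j i] flip[OF X, of i j] by simp
    qed (use less diag f_eq in auto)
    then show ?thesis by (simp add: vec_eq_iff)
  qed
  have sub: "span (e ` S) \<subseteq> ?H" using e_H by (intro span_minimal subspace_hermitian) blast
  have "{y \<in> ?H. \<forall>x\<in>span (e ` S). orthogonal x y} = {0}"
    using zero by (auto simp: orthogonal_def span_base linear_0[OF linear_conj_transpose])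
  then have "dim ?H = card S"
    using dim_subspace_orthogonal_to_vectors[OF subspace_span subspace_hermitian sub] dim_span by simp
  also have "card S = card {(i, j). f i < f j} * DIM('f) + CARD('n)"
  proof -
    have "card (range (\<lambda>i :: 'n. (i, i))) = CARD('n)" by (rule card_image) (simp add: inj_on_def)
    then show ?thesis
      unfolding S_def by (subst card_Un_disjoint) (auto simp: card_cartesian_product)
  qed
  also have "card {(i, j). f i < f j} * DIM('f) = CARD('n) * (CARD('n) - 1) * DIM('f) div 2"
  proof -
    have "CARD('n) * (CARD('n) - 1) * DIM('f) = 2 * (card {(i, j). f i < f j} * DIM('f))"
      unfolding card_less_pairs[OF f, symmetric] by (simp only: mult.assoc)
    then show ?thesis by simp
  qed
  finally show ?thesis .
qed

lemma subspace_hermitian_traceless: "subspace (hermitian_traceless :: ('f::conj_div_algebra^'n^'n) set)"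
  using subspace_hermitian[where 'f = 'f and 'n = 'n]
  unfolding hermitian_traceless_eq subspace_def by (auto simp: inner_add_left)

lemma mat_1_inner_mat_1: "(mat 1 :: 'f::conj_div_algebra^'n^'n) \<bullet> mat 1 = CARD('n)"
  by (simp add: inner_vec_def mat_def if_distrib inner_1_1 cong: if_cong)

lemma dim_hermitian_traceless:
  "dim (hermitian_traceless :: ('f::conj_div_algebra^'n^'n) set) = dim_N DIM('f) CARD('n)"
proof -
  have "(mat 1 :: 'f^'n^'n) \<noteq> 0" using mat_1_inner_mat_1[where 'f = 'f and 'n = 'n] by auto
  then have "dim {A :: 'f^'n^'n. conj_transpose A = A} = Suc (dim (hermitian_traceless :: ('f^'n^'n) set))"
    unfolding hermitian_traceless_eq
    by (intro dim_orthogonal_to_vector subspace_hermitian) (simp_all add: conj_transpose_mat_1)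
  moreover have "CARD('n) > 0" by simp
  ultimately show ?thesis by (simp add: dim_hermitian dim_N_def)
qed

text \<open>The equations of the set of regular zeros inside the traceless Hermitian matrices. Index 0 is the
  equation of the unit sphere, which leaves the indices of the components of \<open>\<Phi>\<close> unchanged.\<close>

definition constraint :: "nat \<Rightarrow> 'f::conj_div_algebra^'n^'n \<Rightarrow> real"
  where "constraint k A = (if k = 0 then A \<bullet> A - 1 else Phi k A)"

definition constraint_deriv :: "nat \<Rightarrow> 'f::conj_div_algebra^'n^'n \<Rightarrow> 'f^'n^'n \<Rightarrow> real"
  where "constraint_deriv k A X = (if k = 0 then 2 * (A \<bullet> X) else power_deriv (2 * k + 1) A X \<bullet> mat 1)"

lemma Phi_eq_inner: "Phi k A = matrix_power A (2 * k + 1) \<bullet> mat 1"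
  by (simp add: Phi_def flip: real_trace_eq_inner) (simp add: real_trace_def)

lemma has_derivative_Phi: "(Phi k has_derivative (\<lambda>X. power_deriv (2 * k + 1) A X \<bullet> mat 1)) (at A)"
  unfolding Phi_eq_inner[abs_def] by (intro has_derivative_inner_left has_derivative_matrix_power)

lemma frechet_derivative_constraint: "frechet_derivative (constraint k) (at A) = constraint_deriv k A"
proof -
  have "(constraint k has_derivative constraint_deriv k A) (at A)"
  proof (cases "k = 0")
    case True
    have "((\<lambda>A. A \<bullet> A - 1) has_derivative (\<lambda>X. 2 * (A \<bullet> X))) (at A)"
      by (auto intro!: derivative_eq_intros simp: inner_commute)
    then show ?thesis by (simp add: True constraint_def[abs_def] constraint_deriv_def[abs_def])
  next
    case False
    then show ?thesis
      using has_derivative_Phi by (simp add: constraint_def[abs_def] constraint_deriv_def[abs_def])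
  qed
  then show ?thesis by (rule frechet_derivative_at[symmetric])
qed

lemma smooth_constraint: "smooth_on (constraint k) (UNIV :: ('f::conj_div_algebra^'n^'n) set)"
  unfolding smooth_on_def
proof
  fix l
  have id: "C_on l (\<lambda>A. A) (UNIV :: ('f^'n^'n) set)"
    by (rule C_on_bounded_linear_id[OF bounded_linear_ident open_UNIV])
  have "C_on l (\<lambda>A. A \<bullet> A + (- 1)) (UNIV :: ('f^'n^'n) set)"
    by (intro C_on_add C_on_inner id C_on_const open_UNIV)
  moreover have "C_on l (Phi k) (UNIV :: ('f^'n^'n) set)"
    unfolding Phi_eq_inner[abs_def] by (intro C_on_inner C_on_matrix_power C_on_const open_UNIV)
  ultimately show "C_on l (constraint k) (UNIV :: ('f^'n^'n) set)"
    by (cases "k = 0") (simp_all add: constraint_def[abs_def])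
qed

text \<open>The gradient of \<open>tr A\<^sup>2\<^sup>k\<^sup>+\<^sup>1\<close> is \<open>(2 k + 1) A\<^sup>2\<^sup>k\<close>.\<close>

lemma constraint_deriv_hermitian:
  assumes "conj_transpose A = A" "k \<noteq> 0"
  shows "constraint_deriv k A X = real (2 * k + 1) * (matrix_power A (2 * k) \<bullet> X)"
proof -
  have "power_deriv (2 * k + 1) A X \<bullet> mat 1 = X \<bullet> power_deriv (Suc (2 * k)) A (matrix_power A 0)"
    using power_deriv_self_adjoint[OF assms(1)] by (simp add: matrix_power_0)
  also have "\<dots> = real (2 * k + 1) * (matrix_power A (2 * k) \<bullet> X)"
    unfolding power_deriv_power by (simp add: inner_commute)
  finally show ?thesis using assms(2) by (simp add: constraint_deriv_def)
qed

lemma unit_sphere_level_set: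
  "level_set hermitian_traceless {0} constraint (unit_sphere :: ('f::conj_div_algebra^'n^'n) set)"
proof (rule level_set.intro)
  show "unit_sphere = regular_level_set hermitian_traceless {0} (constraint :: nat \<Rightarrow> 'f^'n^'n \<Rightarrow> real)"
  proof -
    have "\<exists>v\<in>hermitian_traceless. constraint_deriv 0 A v = r"
      if "A \<in> hermitian_traceless" "norm A = 1" for A :: "'f^'n^'n" and r
    proof
      show "constraint_deriv 0 A ((r / 2) *\<^sub>R A) = r"
        using that(2) by (simp add: constraint_deriv_def dot_square_norm)
      show "(r / 2) *\<^sub>R A \<in> hermitian_traceless"
        by (intro subspace_scale subspace_hermitian_traceless that)
    qed
    then show ?thesis
      by (auto simp: regular_level_set_def unit_sphere_def constraint_def frechet_derivative_constraint
          norm_eq_1)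
  qed
qed (simp_all add: subspace_hermitian_traceless smooth_constraint)

lemma tangent_space_unit_sphere:
  assumes "A \<in> unit_sphere"
  shows "tangent_space unit_sphere A = {v \<in> hermitian_traceless. A \<bullet> v = 0}"
  using level_set.tangent_space_M[OF unit_sphere_level_set assms]
  by (simp add: level_set.kernel_def[OF unit_sphere_level_set] frechet_derivative_constraint
      constraint_deriv_def)

lemma differential_Phi:
  assumes "X \<in> tangent_space M A"
  shows "differential M (Phi k) A X = power_deriv (2 * k + 1) A X \<bullet> mat 1"
  by (rule differential_eq[OF assms open_UNIV UNIV_I has_derivative_Phi]) simp

text \<open>Joint surjectivity of all differentials, that of the sphere equation included, amounts to
  surjectivity of \<open>d\<Phi>\<close> on the tangent space of the sphere: the multiples of \<open>A\<close> serve to adjust the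
  differential of the sphere equation, and the tangent space is its kernel.\<close>

lemma set_B_eq:
  "(set_B :: ('f::conj_div_algebra^'n^'n) set)
    = regular_level_set hermitian_traceless {0..num_p CARD('n)} constraint"
proof (intro equalityI subsetI)
  let ?p = "num_p CARD('n)"
  fix A :: "'f^'n^'n" assume A: "A \<in> set_B"
  then have A': "A \<in> unit_sphere" "A \<in> hermitian_traceless" "norm A = 1" "\<forall>k\<in>{1..?p}. Phi k A = 0"
    and reg: "\<And>c. \<exists>X\<in>tangent_space unit_sphere A. \<forall>k\<in>{1..?p}. differential unit_sphere (Phi k) A X = c k"
    by (auto simp: set_B_def regular_point_def unit_sphere_def)
  have "\<exists>v\<in>hermitian_traceless. \<forall>k\<in>{0..?p}. constraint_deriv k A v = c k" for c
  proof -
    let ?L = "\<lambda>k. constraint_deriv k A"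
    have lin: "linear (?L k)" for k
      using has_derivative_linear[OF smooth_on_has_derivative[OF smooth_constraint UNIV_I], of k A]
      by (simp add: frechet_derivative_constraint)
    define B where "B = (c 0 / 2) *\<^sub>R A"
    obtain X where X: "X \<in> tangent_space unit_sphere A"
      "\<forall>k\<in>{1..?p}. differential unit_sphere (Phi k) A X = c k - ?L k B"
      using reg[of "\<lambda>k. c k - ?L k B"] by blast
    have X': "X \<in> hermitian_traceless" "A \<bullet> X = 0"
      using X(1) unfolding tangent_space_unit_sphere[OF A'(1)] by simp_all
    have "?L k (X + B) = c k" if k: "k \<in> {0..?p}" for k
    proof (cases "k = 0")
      case True
      then show ?thesis
        using X'(2) A'(3) by (simp add: constraint_deriv_def B_def inner_add_right dot_square_norm)
    next
      case False
      then have "?L k X = c k - ?L k B"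
        using X(2) k differential_Phi[OF X(1), of k] by (simp add: constraint_deriv_def)
      then show ?thesis by (simp add: linear_add[OF lin])
    qed
    moreover have "X + B \<in> hermitian_traceless"
      unfolding B_def by (intro subspace_add subspace_scale subspace_hermitian_traceless X' A')
    ultimately show ?thesis by blast
  qed
  moreover have "A \<bullet> A = 1" using A'(3) by (simp add: norm_eq_1)
  ultimately show "A \<in> regular_level_set hermitian_traceless {0..?p} constraint"
    using A' by (auto simp: regular_level_set_def frechet_derivative_constraint constraint_def)
next
  let ?p = "num_p CARD('n)"
  fix A :: "'f^'n^'n" assume A: "A \<in> regular_level_set hermitian_traceless {0..?p} constraint"
  then have A': "A \<in> hermitian_traceless" "\<And>k. k \<le> ?p \<Longrightarrow> constraint k A = 0"
    and reg: "\<And>c. \<exists>v\<in>hermitian_traceless. \<forall>k\<in>{0..?p}. constraint_deriv k A v = c k"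
    by (auto simp: regular_level_set_def frechet_derivative_constraint)
  have S: "A \<in> unit_sphere" using A'(1) A'(2)[of 0] by (simp add: unit_sphere_def norm_eq_1 constraint_def)
  have "\<exists>X\<in>tangent_space unit_sphere A. \<forall>k\<in>{1..?p}. differential unit_sphere (Phi k) A X = c k" for c
  proof -
    obtain v where v: "v \<in> hermitian_traceless" "\<forall>k\<in>{0..?p}. constraint_deriv k A v = (if k = 0 then 0 else c k)"
      using reg[of "\<lambda>k. if k = 0 then 0 else c k"] by blast
    have "A \<bullet> v = 0" using v(2) by (auto simp: constraint_deriv_def dest: bspec[of _ _ 0])
    then have tan: "v \<in> tangent_space unit_sphere A" using v(1) by (simp add: tangent_space_unit_sphere[OF S])
    have "differential unit_sphere (Phi k) A v = c k" if "k \<in> {1..?p}" for k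
      using bspec[OF v(2), of k] that by (simp add: differential_Phi[OF tan] constraint_deriv_def)
    then show ?thesis using tan by blast
  qed
  moreover have "Phi k A = 0" if "k \<in> {1..?p}" for k using A'(2)[of k] that by (simp add: constraint_def)
  ultimately show "A \<in> set_B" using S by (simp add: set_B_def regular_point_def)
qed

lemma set_B_level_set:
  "level_set hermitian_traceless {0..num_p CARD('n)} constraint (set_B :: ('f::conj_div_algebra^'n^'n) set)"
  by (rule level_set.intro) (simp_all add: subspace_hermitian_traceless smooth_constraint set_B_eq)

lemma set_B_subset: "set_B \<subseteq> unit_sphere"
  by (auto simp: set_B_def regular_point_def)

lemma set_B_hermitian:
  assumes "A \<in> set_B"
  shows "conj_transpose A = A" "A \<bullet> mat 1 = 0"
  using assms set_B_subset by (auto simp: unit_sphere_def hermitian_traceless_eq)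

lemma set_B_odd_traces:
  fixes A :: "'f::conj_div_algebra^'n^'n"
  assumes "A \<in> set_B" "k \<le> num_p CARD('n)"
  shows "real_trace (matrix_power A (2 * k + 1)) = 0"
proof (cases "k = 0")
  case True
  then show ?thesis
    using set_B_hermitian[OF assms(1)] by (simp add: matrix_power_1 real_trace_eq_inner)
next
  case False
  then have "Phi k A = 0" using assms by (simp add: set_B_def)
  then show ?thesis unfolding real_trace_eq_inner Phi_eq_inner .
qed

lemma tangent_space_set_B:
  fixes A :: "'f::conj_div_algebra^'n^'n"
  assumes A: "A \<in> set_B"
  shows "tangent_space set_B A = {v \<in> tangent_space unit_sphere A.
    \<forall>k\<in>{1..num_p CARD('n)}. matrix_power A (2 * k) \<bullet> v = 0}"
proof -
  have "(\<forall>k\<in>{0..num_p CARD('n)}. constraint_deriv k A v = 0) \<longleftrightarrow>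
      A \<bullet> v = 0 \<and> (\<forall>k\<in>{1..num_p CARD('n)}. matrix_power A (2 * k) \<bullet> v = 0)" for v
  proof -
    have "{0..num_p CARD('n)} = insert 0 {1..num_p CARD('n)}" by auto
    moreover have "constraint_deriv 0 A v = 0 \<longleftrightarrow> A \<bullet> v = 0" by (simp add: constraint_deriv_def)
    moreover have "constraint_deriv k A v = 0 \<longleftrightarrow> matrix_power A (2 * k) \<bullet> v = 0"
      if "k \<in> {1..num_p CARD('n)}" for k
      using that constraint_deriv_hermitian[OF set_B_hermitian(1)[OF A], of k v] by auto
    ultimately show ?thesis by auto
  qed
  moreover have "A \<in> unit_sphere" using A set_B_subset by blast
  ultimately show ?thesis
    using level_set.tangent_space_M[OF set_B_level_set A]
    by (auto simp: level_set.kernel_def[OF set_B_level_set] frechet_derivative_constraint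
        tangent_space_unit_sphere)
qed

section \<open>Shape operators and normal curvature\<close>

text \<open>The even power \<open>A\<^sup>2\<^sup>k\<close> projected to the traceless matrices. On the set of regular zeros it is
  already orthogonal to \<open>A\<close>, as \<open>tr A\<^sup>2\<^sup>k\<^sup>+\<^sup>1 = 0\<close>, hence tangent to the sphere.\<close>

definition normal_frame :: "nat \<Rightarrow> 'f::conj_div_algebra^'n^'n \<Rightarrow> 'f^'n^'n"
  where "normal_frame k A = matrix_power A (2 * k) - ((matrix_power A (2 * k) \<bullet> mat 1) / CARD('n)) *\<^sub>R mat 1"

definition normal_frame_deriv :: "nat \<Rightarrow> 'f::conj_div_algebra^'n^'n \<Rightarrow> 'f^'n^'n \<Rightarrow> 'f^'n^'n"
  where "normal_frame_deriv k A X
    = power_deriv (2 * k) A X - ((power_deriv (2 * k) A X \<bullet> mat 1) / CARD('n)) *\<^sub>R mat 1"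

lemma smooth_normal_frame: "smooth_on (normal_frame k) (UNIV :: ('f::conj_div_algebra^'n^'n) set)"
proof -
  have "C_on l (\<lambda>A :: 'f^'n^'n. matrix_power A (2 * k) +
      (matrix_power A (2 * k) \<bullet> ((- 1 / CARD('n)) *\<^sub>R mat 1)) *\<^sub>R mat 1) UNIV" for l
    by (intro C_on_add C_on_scaleR C_on_inner C_on_matrix_power C_on_const open_UNIV)
  then show ?thesis by (simp add: smooth_on_def normal_frame_def[abs_def])
qed

lemma frechet_derivative_normal_frame:
  "frechet_derivative (normal_frame k) (at A) = normal_frame_deriv k A"
  unfolding normal_frame_def[abs_def] normal_frame_deriv_def[abs_def] divide_inverse
  by (rule frechet_derivative_at[symmetric])
    (intro has_derivative_diff has_derivative_scaleR_left has_derivative_mult_left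
      has_derivative_inner_left has_derivative_matrix_power)

text \<open>Biduality of orthogonal complements, relative to the ambient space \<open>T\<close>.\<close>

lemma relative_double_complement:
  fixes G :: "'v::euclidean_space set"
  assumes T: "subspace T" and G: "G \<subseteq> T"
  shows "T \<inter> orthogonal_comp {v \<in> T. \<forall>u\<in>G. u \<bullet> v = 0} = span G"
proof (intro equalityI subsetI)
  fix w assume w: "w \<in> T \<inter> orthogonal_comp {v \<in> T. \<forall>u\<in>G. u \<bullet> v = 0}"
  let ?q = "orth_proj (span G) w"
  have q: "?q \<in> span G" by (rule orth_proj_decomp(1)[OF subspace_span])
  have "span G \<subseteq> T" by (rule span_minimal[OF G T])
  then have "w - ?q \<in> T" using w q T by (auto intro: subspace_diff)
  moreover have orth: "u \<bullet> (w - ?q) = 0" if "u \<in> span G" for u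
    using orth_proj_decomp(2)[OF subspace_span that, of w] by (simp add: inner_diff_right inner_commute)
  ultimately have "(w - ?q) \<bullet> w = 0"
    using w by (auto simp: orthogonal_comp_def orthogonal_def span_base)
  moreover have "(w - ?q) \<bullet> ?q = 0" using orth[OF q] by (simp add: inner_commute)
  ultimately have "(w - ?q) \<bullet> (w - ?q) = 0" by (simp add: inner_diff_right)
  then show "w \<in> span G" using q by simp
next
  fix w assume w: "w \<in> span G"
  have "v \<bullet> w = 0" if "\<forall>u\<in>G. u \<bullet> v = 0" for v
    using w by (induction rule: span_induct) (use that in \<open>auto simp: subspace_def inner_add_right inner_commute\<close>)
  then show "w \<in> T \<inter> orthogonal_comp {v \<in> T. \<forall>u\<in>G. u \<bullet> v = 0}"
    using span_minimal[OF G T] w by (auto simp: orthogonal_comp_def orthogonal_def)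
qed

lemma normal_frame_inner:
  assumes "v \<in> hermitian_traceless"
  shows "normal_frame k A \<bullet> v = matrix_power A (2 * k) \<bullet> v"
  using assms by (simp add: normal_frame_def inner_diff_left hermitian_traceless_eq inner_commute[of "mat 1"])

lemma normal_frame_tangent_sphere:
  fixes A :: "'f::conj_div_algebra^'n^'n"
  assumes A: "A \<in> set_B" and k: "k \<le> num_p CARD('n)"
  shows "normal_frame k A \<in> tangent_space unit_sphere A"
proof -
  note herm = set_B_hermitian[OF A]
  have S: "A \<in> unit_sphere" and AE: "A \<in> hermitian_traceless"
    using A set_B_subset by (auto simp: unit_sphere_def)
  have "conj_transpose (normal_frame k A) = normal_frame k A"
    unfolding normal_frame_def
    by (simp add: linear_diff[OF linear_conj_transpose] linear_scale[OF linear_conj_transpose]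
        conj_transpose_matrix_power[OF herm(1)] conj_transpose_mat_1)
  moreover have "normal_frame k A \<bullet> mat 1 = 0"
    by (simp add: normal_frame_def inner_diff_left mat_1_inner_mat_1)
  moreover have "A \<bullet> normal_frame k A = real_trace (matrix_power A (2 * k + 1))"
  proof -
    have "A \<bullet> normal_frame k A = matrix_power A (2 * k) \<bullet> A"
      using normal_frame_inner[OF AE, of k A] by (simp add: inner_commute)
    also have "\<dots> = real_trace (matrix_power A (2 * k + 1))"
      by (simp add: inner_eq_real_trace herm matrix_power_Suc matrix_power_commute)
    finally show ?thesis .
  qed
  then have "A \<bullet> normal_frame k A = 0" using set_B_odd_traces[OF A k] by simp
  ultimately show ?thesis by (simp add: tangent_space_unit_sphere[OF S] hermitian_traceless_eq)
qed

lemma normal_space_set_B: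
  fixes A :: "'f::conj_div_algebra^'n^'n"
  assumes A: "A \<in> set_B"
  shows "normal_space unit_sphere set_B A = span ((\<lambda>k. normal_frame k A) ` {1..num_p CARD('n)})"
proof -
  have S: "A \<in> unit_sphere" using A set_B_subset by blast
  let ?T = "tangent_space unit_sphere A" and ?G = "(\<lambda>k. normal_frame k A) ` {1..num_p CARD('n)}"
  have sub: "subspace ?T"
    using subspace_hermitian_traceless[where 'f = 'f and 'n = 'n]
    unfolding tangent_space_unit_sphere[OF S] subspace_def by (auto simp: inner_add_right)
  have "tangent_space set_B A = {v \<in> ?T. \<forall>u\<in>?G. u \<bullet> v = 0}"
    by (auto simp: tangent_space_set_B[OF A] tangent_space_unit_sphere[OF S] normal_frame_inner)
  moreover have "?G \<subseteq> ?T" using normal_frame_tangent_sphere[OF A] by auto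
  ultimately show ?thesis unfolding normal_space_def by (simp only: relative_double_complement[OF sub])
qed

lemma set_B_framed:
  "framed_submanifold unit_sphere (set_B :: ('f::conj_div_algebra^'n^'n) set) {1..num_p CARD('n)} normal_frame"
proof (rule framed_submanifold.intro)
  fix A :: "'f^'n^'n" assume A: "A \<in> set_B"
  then have S: "A \<in> unit_sphere" using set_B_subset by blast
  show "subspace (tangent_space unit_sphere A)"
    using level_set.tangent_space_M[OF unit_sphere_level_set S]
      level_set.subspace_kernel[OF unit_sphere_level_set] by simp
  show "subspace (tangent_space set_B A)"
    using level_set.tangent_space_M[OF set_B_level_set A]
      level_set.subspace_kernel[OF set_B_level_set] by simp
  show "tangent_space set_B A \<subseteq> tangent_space unit_sphere A"
    unfolding tangent_space_set_B[OF A] by blast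
  show "normal_space unit_sphere set_B A = span ((\<lambda>k. normal_frame k A) ` {1..num_p CARD('n)})"
    by (rule normal_space_set_B[OF A])
  show "\<exists>v. \<forall>k\<in>{1..num_p CARD('n)}. normal_frame k A \<bullet> v = c k" for c :: "nat \<Rightarrow> real"
  proof -
    have "\<exists>v\<in>hermitian_traceless. \<forall>k\<in>{0..num_p CARD('n)}. constraint_deriv k A v = real (2 * k + 1) * c k"
      using A unfolding set_B_eq regular_level_set_def frechet_derivative_constraint mem_Collect_eq
      by (elim conjE allE[of _ "\<lambda>k. real (2 * k + 1) * c k"])
    then obtain v where v: "v \<in> hermitian_traceless"
      "\<forall>k\<in>{0..num_p CARD('n)}. constraint_deriv k A v = real (2 * k + 1) * c k" by blast
    have "normal_frame k A \<bullet> v = c k" if k: "k \<in> {1..num_p CARD('n)}" for k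
    proof -
      have "real (2 * k + 1) * (matrix_power A (2 * k) \<bullet> v) = real (2 * k + 1) * c k"
        using bspec[OF v(2), of k] constraint_deriv_hermitian[OF set_B_hermitian(1)[OF A], of k v] k by simp
      then show ?thesis unfolding normal_frame_inner[OF v(1)] mult_cancel_left by simp
    qed
    then show ?thesis by blast
  qed
next
  show "lie_bracket set_B X Y A \<in> tangent_space set_B A"
    if "tangent_field set_B X" "tangent_field set_B Y" "A \<in> set_B" for X Y and A :: "'f^'n^'n"
    using level_set.lie_bracket_tangent[OF set_B_level_set that] .
qed (simp_all add: smooth_normal_frame)

lemma submanifold_set_B:
  "submanifold_of (dim_N DIM('f) CARD('n) - num_p CARD('n) - 1) (set_B :: ('f::conj_div_algebra^'n^'n) set) unit_sphere"
  unfolding submanifold_of_def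
proof (intro conjI exI)
  show "embedded_submanifold (dim (hermitian_traceless :: ('f^'n^'n) set) - card {0::nat}) (unit_sphere :: ('f^'n^'n) set)"
    by (rule level_set.embedded_submanifold_M[OF unit_sphere_level_set])
  show "embedded_submanifold (dim_N DIM('f) CARD('n) - num_p CARD('n) - 1) (set_B :: ('f^'n^'n) set)"
    using level_set.embedded_submanifold_M[OF set_B_level_set[where 'f = 'f and 'n = 'n]]
    by (simp add: dim_hermitian_traceless)
qed (rule set_B_subset)

context
  fixes A :: "'f::conj_div_algebra^'n^'n"
  assumes A: "A \<in> set_B"
begin

private abbreviation "T \<equiv> tangent_space set_B A"

private lemma herm: "conj_transpose A = A"
  using set_B_hermitian[OF A] by simp

private lemma subspace_T: "subspace T"
  using framed_submanifold.subspace_TM[OF set_B_framed A] .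

private lemma T_eq: "T = {v. conj_transpose v = v \<and> v \<bullet> mat 1 = 0 \<and> A \<bullet> v = 0 \<and>
    (\<forall>k\<in>{1..num_p CARD('n)}. matrix_power A (2 * k) \<bullet> v = 0)}"
proof -
  have "A \<in> unit_sphere" using A set_B_subset by blast
  then show ?thesis
    by (auto simp: tangent_space_set_B[OF A] tangent_space_unit_sphere hermitian_traceless_eq)
qed

text \<open>Conjugation by \<open>U\<close> is an isometry that maps the conditions defining \<open>T\<close>, namely orthogonality to
  \<open>A\<close>, to the identity and to the even powers of \<open>A\<close>, to themselves up to sign.\<close>

private lemma conjugation_T:
  assumes U: "U ** conj_transpose U = mat 1" "conj_transpose U ** U = mat 1"
    and neg: "conj_transpose U ** A ** U = - A" and v: "v \<in> T"
  shows "U ** v ** conj_transpose U \<in> T"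
proof -
  let ?V = "conj_transpose U" and ?w = "U ** v ** conj_transpose U"
  have adj: "X \<bullet> ?w = (?V ** X ** U) \<bullet> v" for X
    by (simp add: inner_commute[of X] inner_commute[of _ v] inner_matrix_mult_right[of "U ** v"]
        inner_matrix_mult_left[of U] matrix_mul_assoc)
  have "?V ** matrix_power A (2 * k) ** U = matrix_power A (2 * k)" for k
    using matrix_power_conjugate[OF U, of A "2 * k"] by (simp add: neg matrix_power_uminus)
  then have "\<forall>k\<in>{1..num_p CARD('n)}. matrix_power A (2 * k) \<bullet> ?w = 0"
    using v by (simp add: adj T_eq)
  moreover have "A \<bullet> ?w = 0" using v by (simp add: adj neg T_eq)
  moreover have "?w \<bullet> mat 1 = 0"
    using v adj[of "mat 1"] by (simp add: U T_eq inner_commute)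
  moreover have "conj_transpose ?w = ?w"
    using v by (simp add: T_eq conj_transpose_mult matrix_mul_assoc)
  ultimately show ?thesis by (simp add: T_eq)
qed

private lemma orth_proj_T_normal_frame_deriv:
  "orth_proj T (\<Sum>k\<in>K. c k *\<^sub>R normal_frame_deriv k A v) = orth_proj T (\<Sum>k\<in>K. c k *\<^sub>R power_deriv (2 * k) A v)"
proof -
  note lin = linear_orth_proj[OF subspace_T]
  have "orth_proj T (mat 1) = 0"
    by (rule orth_proj_eq_0[OF subspace_T]) (simp add: T_eq inner_commute)
  then have "orth_proj T (normal_frame_deriv k A v) = orth_proj T (power_deriv (2 * k) A v)" for k
    by (simp add: normal_frame_deriv_def linear_diff[OF lin] linear_scale[OF lin])
  then show ?thesis by (simp add: linear_sum[OF lin] linear_scale[OF lin])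
qed

text \<open>The isometry \<open>\<tau> X = - U X U\<^sup>*\<close>, where \<open>U\<close> conjugates \<open>A\<close> to \<open>- A\<close>, preserves the set of regular
  zeros and fixes the point \<open>A\<close>, but reverses the normal vectors \<open>A\<^sup>2\<^sup>k\<close>. Hence it conjugates the shape
  operator to its negative. Algebraically: the derivatives of even powers anticommute with \<open>\<tau>\<close>, and the
  projection to the tangent space commutes with it.\<close>

lemma shape_operator_eigenvalues:
  assumes "\<xi> \<in> normal_space unit_sphere set_B A"
  shows "\<exists>\<Lambda> z. has_eigenvalues T (shape_operator unit_sphere set_B A \<xi>)
    (\<Lambda> + image_mset uminus \<Lambda> + replicate_mset z 0)"
proof -
  let ?K = "{1..num_p CARD('n)}"
  obtain c where c: "\<xi> = (\<Sum>k\<in>?K. c k *\<^sub>R normal_frame k A)"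
    by (rule framed_submanifold.normal_space_coeffs[OF set_B_framed A assms])
  define L where "L v = (\<Sum>k\<in>?K. c k *\<^sub>R power_deriv (2 * k) A v)" for v
  define F where "F v = - orth_proj T (L v)" for v
  note lin_P = linear_orth_proj[OF subspace_T]
  have shape: "shape_operator unit_sphere set_B A \<xi> v = F v" if "v \<in> T" for v
    using framed_submanifold.shape_operator_eq[OF set_B_framed A that, of c]
    by (simp only: c F_def L_def frechet_derivative_normal_frame orth_proj_T_normal_frame_deriv)
  have lin_L: "linear L"
    by (rule linearI)
      (simp_all add: L_def linear_add[OF linear_power_deriv] linear_scale[OF linear_power_deriv]
        scaleR_add_right sum.distrib scaleR_sum_right mult.commute)
  have lin_F: "linear F"
    by (rule linearI)
      (simp_all add: F_def linear_add[OF lin_L] linear_scale[OF lin_L] linear_add[OF lin_P] linear_scale[OF lin_P])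
  have F_T: "F v \<in> T" for v
    unfolding F_def by (intro subspace_neg subspace_T orth_proj_decomp(1))
  have L_sym: "L v \<bullet> w = v \<bullet> L w" for v w
    by (simp add: L_def inner_sum_left inner_sum_right power_deriv_self_adjoint[OF herm])
  have F_inner: "F v \<bullet> w = - (L v \<bullet> w)" if "w \<in> T" for v w
    by (simp add: F_def orth_proj_decomp(2)[OF subspace_T that])
  have F_sym: "F v \<bullet> w = v \<bullet> F w" if "v \<in> T" "w \<in> T" for v w
    using F_inner[OF that(2), of v] F_inner[OF that(1), of w] L_sym[of v w] by (simp add: inner_commute)
  obtain U where U: "U ** conj_transpose U = mat 1" "conj_transpose U ** U = mat 1"
    "U ** A ** conj_transpose U = - A"
    by (rule unitary_to_negative[OF herm set_B_odd_traces[OF A]])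
  let ?V = "conj_transpose U"
  have "?V ** A ** U = - (?V ** (U ** A ** ?V) ** U)" by (simp add: U(3) matrix_mult_minus_left matrix_mult_minus_right)
  also have "\<dots> = - ((?V ** U) ** A ** (?V ** U))" by (simp only: matrix_mul_assoc)
  finally have neg: "?V ** A ** U = - A" by (simp add: U)
  define \<tau> where "\<tau> X = - (U ** X ** ?V)" for X
  have lin_\<tau>: "linear \<tau>"
    by (rule linearI)
      (simp_all add: \<tau>_def matrix_add_ldistrib matrix_add_rdistrib matrix_mult_scaleR_left matrix_mult_scaleR_right)
  have \<tau>_inv: "- (?V ** \<tau> X ** U) = X" "\<tau> (- (?V ** X ** U)) = X" for X
  proof -
    have "- (?V ** \<tau> X ** U) = (?V ** U) ** X ** (?V ** U)"
      by (simp add: \<tau>_def matrix_mult_minus_left matrix_mult_minus_right matrix_mul_assoc)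
    then show "- (?V ** \<tau> X ** U) = X" by (simp add: U)
    have "\<tau> (- (?V ** X ** U)) = (U ** ?V) ** X ** (U ** ?V)"
      by (simp add: \<tau>_def matrix_mult_minus_left matrix_mult_minus_right matrix_mul_assoc)
    then show "\<tau> (- (?V ** X ** U)) = X" by (simp add: U)
  qed
  have \<tau>_T: "\<tau> v \<in> T" if "v \<in> T" for v
    unfolding \<tau>_def by (intro subspace_neg subspace_T conjugation_T U neg that)
  have \<tau>_adj: "\<tau> X \<bullet> Y = X \<bullet> (- (?V ** Y ** U))" for X Y
    by (simp add: \<tau>_def inner_matrix_mult_right[of "U ** X"] inner_matrix_mult_left[of U]
        matrix_mul_assoc)
  have proj_\<tau>: "orth_proj T (\<tau> X) = \<tau> (orth_proj T X)" for X
  proof (rule orth_projI[OF subspace_T])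
    show "\<tau> (orth_proj T X) \<in> T" by (intro \<tau>_T orth_proj_decomp(1) subspace_T)
    fix w assume w: "w \<in> T"
    have "?V ** w ** U \<in> T" using conjugation_T[of ?V w] U neg w by simp
    then have "- (?V ** w ** U) \<in> T" by (intro subspace_neg subspace_T)
    then have "(X - orth_proj T X) \<bullet> (- (?V ** w ** U)) = 0"
      using orth_proj_decomp(2)[OF subspace_T] by (simp only: inner_diff_left diff_self)
    then show "(\<tau> X - \<tau> (orth_proj T X)) \<bullet> w = 0"
      by (simp only: linear_diff[OF lin_\<tau>, symmetric] \<tau>_adj)
  qed
  have L_\<tau>: "L (\<tau> v) = - \<tau> (L v)" for v
  proof -
    have "power_deriv (2 * k) A (\<tau> v) = - \<tau> (power_deriv (2 * k) A v)" for k
      using power_deriv_anticommute[OF U, of k v]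
      by (simp add: \<tau>_def linear_neg[OF linear_power_deriv])
    then show ?thesis by (simp add: L_def linear_sum[OF lin_\<tau>] linear_scale[OF lin_\<tau>] sum_negf)
  qed
  have F_\<tau>: "F (\<tau> v) = - \<tau> (F v)" for v
    by (simp add: F_def L_\<tau> linear_neg[OF lin_P] proj_\<tau> linear_neg[OF lin_\<tau>])
  have "inj \<tau>" by (rule inj_on_inverseI[of _ "\<lambda>X. - (?V ** X ** U)"]) (rule \<tau>_inv(1))
  from anticommuting_symmetric_eigenvalues[OF subspace_T lin_F F_T F_sym lin_\<tau> this \<tau>_T F_\<tau>]
  obtain \<Lambda> z where "has_eigenvalues T F (\<Lambda> + image_mset uminus \<Lambda> + replicate_mset z 0)" by blast
  moreover have "{v \<in> T. shape_operator unit_sphere set_B A \<xi> v = r *\<^sub>R v} = {v \<in> T. F v = r *\<^sub>R v}" for r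
    using shape by auto
  ultimately have "has_eigenvalues T (shape_operator unit_sphere set_B A \<xi>)
      (\<Lambda> + image_mset uminus \<Lambda> + replicate_mset z 0)"
    unfolding has_eigenvalues_def by simp
  then show ?thesis by blast
qed

text \<open>The spans of the even and of the odd powers of \<open>A\<close>. The even powers up to \<open>2 p\<close> suffice to span all
  even powers, which ties \<open>Ev\<close> to the normal space: it is the normal space together with the identity.
  Differentiation of even powers exchanges \<open>Ev\<close> and \<open>Od\<close>.\<close>

private definition "Ev = span ((\<lambda>k. matrix_power A (2 * k)) ` {..num_p CARD('n)})"
private definition "Od = span (range (\<lambda>m. matrix_power A (2 * m + 1)))"

private lemma even_power_Ev: "matrix_power A (2 * m) \<in> Ev"
proof -
  obtain c where c: "matrix_power A (2 * m) = (\<Sum>k\<le>num_p CARD('n). c k *\<^sub>R matrix_power A (2 * k))"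
    using even_power_reduction[OF herm set_B_odd_traces[OF A]] by blast
  show ?thesis
    unfolding c Ev_def by (intro span_sum span_scale span_base) auto
qed

private lemma mat_1_Ev: "mat 1 \<in> Ev"
  using even_power_Ev[of 0] by (simp add: matrix_power_0)

private lemma power_deriv_Od:
  assumes "k \<ge> 1" "X \<in> Od"
  shows "power_deriv (2 * k) A X \<in> Ev"
proof -
  have "power_deriv (2 * k) A (matrix_power A (2 * m + 1)) \<in> Ev" for m
  proof -
    have "power_deriv (2 * k) A (matrix_power A (2 * m + 1)) = real (2 * k) *\<^sub>R matrix_power A (2 * (k + m))"
      using power_deriv_power[of "2 * k - 1" A "2 * m + 1"] assms(1) by simp
    then show ?thesis unfolding Ev_def by (simp only:) (intro span_scale even_power_Ev[unfolded Ev_def])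
  qed
  then have "power_deriv (2 * k) A ` Od \<subseteq> Ev"
    unfolding Od_def linear_span_image[OF linear_power_deriv, symmetric] Ev_def
    by (intro span_minimal subspace_span) auto
  then show ?thesis using assms(2) by blast
qed

private lemma power_deriv_Ev:
  assumes "k \<ge> 1" "X \<in> Ev"
  shows "power_deriv (2 * k) A X \<in> Od"
proof -
  have "power_deriv (2 * k) A (matrix_power A (2 * m)) \<in> Od" for m
  proof -
    have "power_deriv (2 * k) A (matrix_power A (2 * m)) = real (2 * k) *\<^sub>R matrix_power A (2 * (k - 1 + m) + 1)"
      using power_deriv_power[of "2 * (k - 1) + 1" A "2 * m"] assms(1) by (cases k) (simp_all add: algebra_simps)
    then show ?thesis unfolding Od_def by (simp only:) (intro span_scale span_base rangeI)
  qed
  then have "power_deriv (2 * k) A ` Ev \<subseteq> Od"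
    unfolding Ev_def linear_span_image[OF linear_power_deriv, symmetric] Od_def
    by (intro span_minimal subspace_span) auto
  then show ?thesis using assms(2) by blast
qed

private lemma traceless_Ev_normal:
  assumes "X \<in> Ev" "X \<bullet> mat 1 = 0"
  shows "X \<in> normal_space unit_sphere set_B A"
proof -
  let ?N = "normal_space unit_sphere set_B A"
  define \<rho> where "\<rho> X = X - ((X \<bullet> mat 1) / CARD('n)) *\<^sub>R mat 1" for X :: "'f^'n^'n"
  have lin: "linear \<rho>"
    by (rule linearI) (simp_all add: \<rho>_def inner_add_left algebra_simps add_divide_distrib)
  have "\<rho> (matrix_power A (2 * k)) \<in> ?N" if "k \<le> num_p CARD('n)" for k
  proof (cases "k = 0")
    case True
    then have "\<rho> (matrix_power A (2 * k)) = 0" by (simp add: \<rho>_def matrix_power_0 mat_1_inner_mat_1)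
    then show ?thesis by (simp add: normal_space_set_B[OF A] span_0)
  next
    case False
    then have "normal_frame k A \<in> ?N"
      unfolding normal_space_set_B[OF A] using that by (intro span_base imageI) simp
    then show ?thesis by (simp add: \<rho>_def normal_frame_def)
  qed
  then have "\<rho> ` Ev \<subseteq> ?N"
    unfolding Ev_def linear_span_image[OF lin, symmetric] normal_space_set_B[OF A]
    by (intro span_minimal subspace_span) auto
  moreover have "\<rho> X = X" using assms(2) by (simp add: \<rho>_def)
  ultimately show ?thesis using assms(1) by (metis imageI subsetD)
qed

private lemma normal_Ev: "normal_space unit_sphere set_B A \<subseteq> Ev"
proof -
  have "normal_frame k A \<in> Ev" for k
    using even_power_Ev[of k] mat_1_Ev unfolding normal_frame_def Ev_def
    by (intro span_diff span_scale)
  then show ?thesis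
    unfolding normal_space_set_B[OF A] by (metis (no_types, lifting) Ev_def image_subsetI span_minimal subspace_span)
qed

text \<open>The component orthogonal to the odd powers. The operators \<open>power_deriv (2 * k) A\<close> map the component
  in \<open>Od\<close> into \<open>Ev\<close> and, being self-adjoint, map this one into the complement of \<open>Ev\<close>.\<close>

private definition "res Y = Y - orth_proj Od Y"

private lemma res_orth:
  assumes "k \<ge> 1" "X \<in> Ev"
  shows "power_deriv (2 * k) A (res Y) \<bullet> X = 0"
proof -
  have "res Y \<bullet> power_deriv (2 * k) A X = 0"
    using orth_proj_decomp(2)[OF subspace_span power_deriv_Ev[OF assms, unfolded Od_def], of Y]
    by (simp add: res_def Od_def inner_diff_left)
  then show ?thesis by (simp add: power_deriv_self_adjoint[OF herm])
qed

private lemma power_deriv_split: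
  "power_deriv k A Y = power_deriv k A (orth_proj Od Y) + power_deriv k A (res Y)"
  by (simp add: res_def linear_diff[OF linear_power_deriv])

text \<open>The component of \<open>Y\<close> in \<open>Od\<close>, together with the multiple of the identity, contributes a traceless
  element of \<open>Ev\<close>, which is normal; the other component contributes a vector orthogonal to \<open>Ev\<close>.\<close>

lemma normal_frame_deriv_residual:
  assumes k: "k \<ge> 1"
  shows "normal_frame_deriv k A Y - orth_proj (normal_space unit_sphere set_B A) (normal_frame_deriv k A Y)
     = power_deriv (2 * k) A (res Y)"
proof -
  let ?N = "normal_space unit_sphere set_B A"
  let ?q = "normal_frame_deriv k A Y - power_deriv (2 * k) A (res Y)"
  have o: "orth_proj Od Y \<in> Od" unfolding Od_def by (rule orth_proj_decomp(1)[OF subspace_span])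
  have q: "?q = power_deriv (2 * k) A (orth_proj Od Y) - ((power_deriv (2 * k) A Y \<bullet> mat 1) / CARD('n)) *\<^sub>R mat 1"
    by (simp add: normal_frame_deriv_def power_deriv_split[of "2 * k" Y])
  have "?q \<in> Ev"
    unfolding q using power_deriv_Od[OF k o] mat_1_Ev unfolding Ev_def by (intro span_diff span_scale)
  moreover have "?q \<bullet> mat 1 = 0"
    using res_orth[OF k mat_1_Ev, of Y]
    by (simp add: normal_frame_deriv_def inner_diff_left mat_1_inner_mat_1)
  ultimately have "?q \<in> ?N" by (rule traceless_Ev_normal)
  then have "orth_proj ?N (normal_frame_deriv k A Y) = ?q"
    by (intro orth_projI) (use normal_Ev res_orth[OF k] in \<open>auto simp: normal_space_set_B[OF A]\<close>)
  then show ?thesis by simp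
qed

text \<open>By the decomposition along \<open>Ev\<close>, both sides reduce to inner products of the operators
  \<open>power_deriv\<close> applied to \<open>res Y\<close> and \<open>res W\<close>. These operators are self-adjoint and commute.\<close>

lemma normal_frame_deriv_symmetric:
  assumes k: "k \<ge> 1" and l: "l \<ge> 1"
  shows "(normal_frame_deriv k A Y - orth_proj (normal_space unit_sphere set_B A) (normal_frame_deriv k A Y))
        \<bullet> normal_frame_deriv l A W
     = (normal_frame_deriv k A W - orth_proj (normal_space unit_sphere set_B A) (normal_frame_deriv k A W))
        \<bullet> normal_frame_deriv l A Y"
proof -
  have red: "power_deriv (2 * k) A (res Y) \<bullet> normal_frame_deriv l A W
     = power_deriv (2 * k) A (res Y) \<bullet> power_deriv (2 * l) A (res W)" for Y W
  proof -
    have o: "orth_proj Od W \<in> Od" unfolding Od_def by (rule orth_proj_decomp(1)[OF subspace_span])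
    have "power_deriv (2 * k) A (res Y) \<bullet> power_deriv (2 * l) A (orth_proj Od W) = 0"
      by (rule res_orth[OF k power_deriv_Od[OF l o]])
    then show ?thesis
      using res_orth[OF k mat_1_Ev, of Y]
      by (simp add: normal_frame_deriv_def power_deriv_split[of "2 * l" W] inner_diff_right inner_add_right)
  qed
  have "power_deriv (2 * k) A (res Y) \<bullet> power_deriv (2 * l) A (res W)
      = power_deriv (2 * k) A (res W) \<bullet> power_deriv (2 * l) A (res Y)"
    by (metis inner_commute power_deriv_commute power_deriv_self_adjoint[OF herm])
  then show ?thesis unfolding normal_frame_deriv_residual[OF k] red .
qed

end

theorem set_B_austere:
  "austere_submanifold (dim_N DIM('f) CARD('n) - num_p CARD('n) - 1) (set_B :: ('f::conj_div_algebra^'n^'n) set) unit_sphere"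
  unfolding austere_submanifold_def using submanifold_set_B shape_operator_eigenvalues by blast

theorem set_B_flat_normal_bundle:
  "flat_normal_bundle (set_B :: ('f::conj_div_algebra^'n^'n) set) unit_sphere"
  by (rule framed_submanifold.flat_normal_bundleI[OF set_B_framed])
    (simp add: frechet_derivative_normal_frame normal_frame_deriv_symmetric)

theorem theorem3p5:
  assumes "CARD('n::finite) \<ge> 3"
  shows
    "(austere_submanifold (dim_N DIM(real) CARD('n) - num_p CARD('n) - 1)
        (set_B :: (real^'n^'n) set) unit_sphere
      \<and> flat_normal_bundle (set_B :: (real^'n^'n) set) unit_sphere)
   \<and> (austere_submanifold (dim_N DIM(complex) CARD('n) - num_p CARD('n) - 1)
        (set_B :: (complex^'n^'n) set) unit_sphere
      \<and> flat_normal_bundle (set_B :: (complex^'n^'n) set) unit_sphere)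
   \<and> (austere_submanifold (dim_N DIM(quat) CARD('n) - num_p CARD('n) - 1)
        (set_B :: (quat^'n^'n) set) unit_sphere
      \<and> flat_normal_bundle (set_B :: (quat^'n^'n) set) unit_sphere)"
  using set_B_austere[where 'f = real and 'n = 'n] set_B_flat_normal_bundle[where 'f = real and 'n = 'n]
    set_B_austere[where 'f = complex and 'n = 'n] set_B_flat_normal_bundle[where 'f = complex and 'n = 'n]
    set_B_austere[where 'f = quat and 'n = 'n] set_B_flat_normal_bundle[where 'f = quat and 'n = 'n]
  by (intro conjI)

end
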